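(* Assume the data $D_n=\{X^{(i)}:i\in[n]\}$ are $n$ iid copies of $X=(X_1,\dots,X_p)^{\mathrm T}$ generated by the true linear SEM $X_j = X_{\mathrm{pa}^*(j)}^{\mathrm T}\beta_j^*+\epsilon_j$ ($j\in[p]$) associated with a DAG $\gamma^*$ on $[p]$, where all entries of each $\beta_j^*$ are nonzero and the $\epsilon_j$ are independent (not necessarily Gaussian) with mean $0$ and common variance $\sigma^2>0$. For each DAG $\gamma$ on $[p]$, let $m(D_n\mid\gamma)$ be the marginal likelihood under the Gaussian working model with $g$-prior and Jeffreys prior described in the context, with $g=n$. Let $\pi(\cdot)$ be a prior on the set $\Gamma^p$ of all DAGs on $[p]$ such that there is $C>0$ with $\pi(\gamma)/\pi(\gamma')\le C$ for all $\gamma,\gamma'\in\Gamma^p$, and define the posterior $\pi(\gamma\mid D_n)\propto m(D_n\mid\gamma)\pi(\gamma)$. Then \[1-\pi(\gamma^*\mid D_n)\le \frac{1}{\sqrt n}\exp(O_p(1)) + \exp\Big(-\frac{np}{2}\big(\delta^*+o_p(1)\big)\Big)(1+n)^{|\gamma^*|/2},\] where $\delta^*:=\min_{\gamma\in\Gamma^p:\,\gamma^*\not\subseteq\gamma}\log r^\gamma-\log(p\sigma^2)>0$, and the $O_p,o_p$ statements are as $n\to\infty$ under the true distribution. Moreover, if $\gamma^*$ is a complete DAG, the term $n^{-1/2}\exp(O_p(1))$ can be omitted. In particular $\pi(\gamma^*\mid D_n)\to1$ in probability.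
   Context: A DAG on $[p]=\{1,\dots,p\}$ is a directed acyclic graph with vertex set $[p]$; $\mathrm{pa}^\gamma(j)$ denotes the parents of $j$ in $\gamma$, $\mathrm{pa}^*(j)=\mathrm{pa}^{\gamma^*}(j)$, $|\gamma|$ is the number of edges, and $\gamma'\supseteq\gamma$ means the edge set of $\gamma'$ contains that of $\gamma$. For a DAG $\gamma$, $r^\gamma:=\sum_{j=1}^p\min_{\beta_j}E(X_j-X_{\mathrm{pa}^\gamma(j)}^{\mathrm T}\beta_j)^2$ (expectation under the true distribution). Working model for $\gamma$: the observations are iid with $X_j=X_{\mathrm{pa}^\gamma(j)}^{\mathrm T}b_j^\gamma+e_j^\gamma$, $e_j^\gamma\overset{\text{ind}}{\sim}N(0,\theta^\gamma)$; priors $b_j^\gamma\mid\theta^\gamma\overset{\text{ind}}{\sim}N(0,g\theta^\gamma(D_{j,n}^{\gamma\,\mathrm T}D_{j,n}^\gamma)^{-1})$ and $\pi(\theta^\gamma)\propto1/\theta^\gamma$, where $D_{j,n}^\gamma$ is the $n\times|\mathrm{pa}^\gamma(j)|$ matrix of observations of $X_{\mathrm{pa}^\gamma(j)}$ (assumed of full column rank). The marginal likelihood $m(D_n\mid\gamma)$ is the integral of the working-model Gaussian likelihood against these priors over $b^\gamma=(b_j^\gamma)_j$ and $\theta^\gamma$. *)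

theory Defs
  imports "HOL-Probability.Probability" "HOL-Combinatorics.Permutations"
begin

text \<open>Graphs on the vertex set [p] = {1..p}: an edge (k, j) means k -> j.\<close>
type_synonym graph = "(nat \<times> nat) set"

definition DAGs :: "nat \<Rightarrow> graph set" where
  "DAGs p = {E. E \<subseteq> {1..p} \<times> {1..p} \<and> acyclic E}"

definition pa :: "graph \<Rightarrow> nat \<Rightarrow> nat set" where
  "pa E j = {k. (k, j) \<in> E}"

definition complete_DAG :: "nat \<Rightarrow> graph \<Rightarrow> bool" where
  "complete_DAG p E \<longleftrightarrow> E \<in> DAGs p \<and>
     (\<forall>k\<in>{1..p}. \<forall>j\<in>{1..p}. k \<noteq> j \<longrightarrow> (k, j) \<in> E \<or> (j, k) \<in> E)"

definition det_on :: "nat set \<Rightarrow> (nat \<Rightarrow> nat \<Rightarrow> real) \<Rightarrow> real" where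
  "det_on S A = (\<Sum>\<pi> | \<pi> permutes S. of_int (sign \<pi>) * (\<Prod>k\<in>S. A k (\<pi> k)))"

text \<open>Data: x i j is the j-th coordinate of the i-th observation, i in {1..n}.
  Gram matrix D^T D of the columns of the data.\<close>
definition gram :: "nat \<Rightarrow> (nat \<Rightarrow> nat \<Rightarrow> real) \<Rightarrow> nat \<Rightarrow> nat \<Rightarrow> real" where
  "gram n x k l = (\<Sum>i\<in>{1..n}. x i k * x i l)"

text \<open>Density of N(0, g theta (D^T D)^{-1}) on R^S at b (S = parent set).\<close>
definition gprior_dens ::
  "real \<Rightarrow> nat \<Rightarrow> (nat \<Rightarrow> nat \<Rightarrow> real) \<Rightarrow> nat set \<Rightarrow> (nat \<Rightarrow> real) \<Rightarrow> real \<Rightarrow> real" where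
  "gprior_dens g n x S b \<theta> =
     (2 * pi * g * \<theta>) powr (- real (card S) / 2) * sqrt (det_on S (gram n x)) *
     exp (- (\<Sum>i\<in>{1..n}. (\<Sum>k\<in>S. b k * x i k)\<^sup>2) / (2 * g * \<theta>))"

definition work_lik ::
  "nat \<Rightarrow> nat \<Rightarrow> graph \<Rightarrow> (nat \<Rightarrow> nat \<Rightarrow> real) \<Rightarrow> (nat \<times> nat \<Rightarrow> real) \<Rightarrow> real \<Rightarrow> real" where
  "work_lik p n E x b \<theta> =
     (\<Prod>i\<in>{1..n}. \<Prod>j\<in>{1..p}.
        exp (- (x i j - (\<Sum>k\<in>pa E j. b (k, j) * x i k))\<^sup>2 / (2 * \<theta>)) / sqrt (2 * pi * \<theta>))"

text \<open>Marginal likelihood m(D_n | E): integral of the likelihood against the g-prior on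
  the coefficients and the Jeffreys prior 1/theta on theta > 0.\<close>
definition marg_lik :: "real \<Rightarrow> nat \<Rightarrow> nat \<Rightarrow> graph \<Rightarrow> (nat \<Rightarrow> nat \<Rightarrow> real) \<Rightarrow> real" where
  "marg_lik g p n E x = enn2real
     (\<integral>\<^sup>+ \<theta>. indicator {0<..} \<theta> * ennreal (1 / \<theta>) *
        (\<integral>\<^sup>+ b. ennreal ((\<Prod>j\<in>{1..p}. gprior_dens g n x (pa E j) (\<lambda>k. b (k, j)) \<theta>)
                          * work_lik p n E x b \<theta>)
           \<partial>(PiM E (\<lambda>_. lborel))) \<partial>lborel)"

definition posterior ::
  "(graph \<Rightarrow> real) \<Rightarrow> real \<Rightarrow> nat \<Rightarrow> nat \<Rightarrow> (nat \<Rightarrow> nat \<Rightarrow> real) \<Rightarrow> graph \<Rightarrow> real" where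
  "posterior pri g p n x E =
     marg_lik g p n E x * pri E / (\<Sum>E'\<in>DAGs p. marg_lik g p n E' x * pri E')"

definition resid_risk :: "'a measure \<Rightarrow> nat \<Rightarrow> (nat \<Rightarrow> 'a \<Rightarrow> real) \<Rightarrow> graph \<Rightarrow> real" where
  "resid_risk M p X E =
     (\<Sum>j\<in>{1..p}. INF \<beta>\<in>(UNIV :: (nat \<Rightarrow> real) set).
        (\<integral>\<omega>. (X j \<omega> - (\<Sum>k\<in>pa E j. \<beta> k * X k \<omega>))\<^sup>2 \<partial>M))"

text \<open>Stochastic order notions, phrased with events (inner probability).\<close>
definition bounded_in_prob :: "'a measure \<Rightarrow> (nat \<Rightarrow> 'a \<Rightarrow> real) \<Rightarrow> bool" where
  "bounded_in_prob M A \<longleftrightarrow> (\<forall>\<delta>>0. \<exists>K N. \<forall>n\<ge>N. \<exists>S\<in>sets M.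
      measure M S \<ge> 1 - \<delta> \<and> (\<forall>\<omega>\<in>S. \<bar>A n \<omega>\<bar> \<le> K))"

definition tendsto_zero_in_prob :: "'a measure \<Rightarrow> (nat \<Rightarrow> 'a \<Rightarrow> real) \<Rightarrow> bool" where
  "tendsto_zero_in_prob M B \<longleftrightarrow> (\<forall>e>0. \<forall>\<delta>>0. \<exists>N. \<forall>n\<ge>N. \<exists>S\<in>sets M.
      measure M S \<ge> 1 - \<delta> \<and> (\<forall>\<omega>\<in>S. \<bar>B n \<omega>\<bar> \<le> e))"

definition wpa1 :: "'a measure \<Rightarrow> (nat \<Rightarrow> 'a \<Rightarrow> bool) \<Rightarrow> bool" where
  "wpa1 M P \<longleftrightarrow> (\<forall>\<delta>>0. \<exists>N. \<forall>n\<ge>N. \<exists>S\<in>sets M.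
      measure M S \<ge> 1 - \<delta> \<and> (\<forall>\<omega>\<in>S. P n \<omega>))"

end

theory Submission
  imports Defs "HOL-Real_Asymp.Real_Asymp"
begin

text \<open>Integrating out the coefficients and the variance gives
  \<open>m(D\<^sub>n | E) \<propto> (1 + n)\<^bsup>-|E|/2\<^esup> Q\<^sub>E\<^bsup>-np/2\<^esup>\<close>, where \<open>Q\<^sub>E\<close> is the residual sum of squares of \<open>E\<close>
  up to a shrinkage of relative size \<open>1/n\<close>. Writing \<open>X = L \<epsilon>\<close> with \<open>L\<close> unit triangular, every
  quadratic form in the data is controlled by the empirical second moments of the noise, which
  concentrate. For a proper supergraph \<open>E\<close> of the true graph \<open>G\<close> the gain \<open>Q\<^sub>G - Q\<^sub>E\<close> only involves the
  empirical cross moments of distinct noise variables and is bounded in probability, so the penalty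
  \<open>(1 + n)\<^bsup>-1/2\<^esup>\<close> dominates. For the other graphs \<open>Q\<^sub>E / n\<close> tends to the residual risk, which is
  strictly larger than \<open>p \<sigma>\<^sup>2\<close>: the product of the residual variances along any DAG is at least
  the determinant of the covariance matrix, i.e. \<open>\<sigma>\<^bsup>2p\<^esup>\<close>, and in case of equality the true parents
  can be recovered by removing sinks one at a time.\<close>

section \<open>Determinants and Gaussian integrals\<close>

text \<open>Only two moments of the noise are available. The diagonal empirical moments therefore
  obey a law of large numbers without a rate, with error o(n), while products of distinct noise
  variables have a second moment by independence and sum to O(sqrt n) by Chebyshev. An error o(n) in
  \<open>Q\<^sub>G - Q\<^sub>E\<close> would be fatal after raising a ratio to the power
  \<open>n * p / 2\<close>; the estimate for supergraphs is arranged so that the same diagonal term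
  \<open>gram n e j j\<close> occurs for both graphs and cancels. For the other graphs a vanishing
  relative error suffices, because the gap is a constant. Probability is kept apart from algebra:
  \<open>sem_data\<close> fixes one data set whose noise Gram matrix is within a tolerance of its
  mean, and all likelihood ratios are bounded there deterministically. It then remains to exhibit
  events of high probability, so measurability of the posterior never becomes an issue. Matrices are
  functions on finite index sets, since parent sets vary from node to node and the inductions add or
  remove one index.\<close>

lemma det_on_equal_rows:
  assumes "finite S" "s \<notin> S" "k \<in> S"
  shows "(\<Sum>\<pi> | \<pi> permutes insert s S.
           of_int (sign \<pi>) * (A k (\<pi> s) * (\<Prod>l\<in>S. A l (\<pi> l)))) = (0::real)" (is "?X = 0")
proof -
  let ?T = "insert s S" and ?t = "Transposition.transpose s k"
  have sk: "s \<noteq> k" using assms by auto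
  have tp: "?t permutes ?T" by (rule permutes_swap_id) (use assms in auto)
  let ?g = "\<lambda>\<pi>. of_int (sign \<pi>) * (A k (\<pi> s) * (\<Prod>l\<in>S. A l (\<pi> l)))"
  \<comment> \<open>Row \<open>s\<close> is a copy of row \<open>k\<close>, so composing with the
    transposition of the two indices preserves the product and flips the sign; the sum equals its
    own negative.\<close>
  have "?X = (\<Sum>\<pi> | \<pi> permutes ?T. ?g (\<pi> \<circ> ?t))"
    using sum_permutations_compose_right[OF tp, of ?g] by simp
  also have "\<dots> = (\<Sum>\<pi> | \<pi> permutes ?T. - ?g \<pi>)"
  proof (rule sum.cong[OF refl], clarsimp)
    fix \<pi> assume p: "\<pi> permutes ?T"
    have fin: "finite ?T" using assms by simp
    have sg: "sign (\<pi> \<circ> ?t) = - sign \<pi>"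
      using sign_compose[of \<pi> ?t] permutation_permutes[of \<pi>] p fin sk
      by (auto simp: sign_swap_id permutation_swap_id)
    have P: "(\<Prod>l\<in>S. A l (f l)) = A k (f k) * (\<Prod>l\<in>S-{k}. A l (f l))" for f
      using assms by (simp add: prod.remove)
    have "(\<Prod>l\<in>S-{k}. A l ((\<pi> \<circ> ?t) l)) = (\<Prod>l\<in>S-{k}. A l (\<pi> l))"
      by (rule prod.cong) (use assms in \<open>auto simp: Transposition.transpose_def\<close>)
    then show "of_int (sign (\<pi> \<circ> ?t)) * (A k (\<pi> k) * (\<Prod>l\<in>S. A l (\<pi> (?t l)))) =
        - (of_int (sign \<pi>) * (A k (\<pi> s) * (\<Prod>l\<in>S. A l (\<pi> l))))"
      unfolding P[of "\<lambda>l. \<pi> (?t l)"] P[of \<pi>] sg by simp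
  qed
  also have "\<dots> = - ?X" by (simp add: sum_negf)
  finally show ?thesis by simp
qed

text \<open>Expanding along row \<open>s\<close>, each of the other rows contributes a determinant
  with two equal rows, which vanishes. Only \<open>d\<close> at the diagonal survives, and it
  selects the permutations that fix \<open>s\<close>.\<close>

lemma det_on_insert_row:
  assumes fin: "finite S" and s: "s \<notin> S"
    and row: "\<And>l. l \<in> S \<Longrightarrow> A s l = (\<Sum>k\<in>S. w k * A k l)"
    and diag: "A s s = d + (\<Sum>k\<in>S. w k * A k s)"
  shows "det_on (insert s S) A = d * det_on S A"
proof -
  let ?T = "insert s S"
  have finT: "finite {\<pi>. \<pi> permutes ?T}" using fin by (simp add: finite_permutations)
  let ?c = "\<lambda>\<pi>. of_int (sign \<pi>) :: real"
  let ?P = "\<lambda>\<pi>. \<Prod>l\<in>S. A l (\<pi> l)"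
  have "det_on ?T A = (\<Sum>\<pi> | \<pi> permutes ?T. ?c \<pi> * (A s (\<pi> s) * ?P \<pi>))"
    unfolding det_on_def using fin s by simp
  also have "\<dots> = (\<Sum>\<pi> | \<pi> permutes ?T. (if \<pi> s = s then d * (?c \<pi> * ?P \<pi>) else 0)
       + (\<Sum>k\<in>S. w k * (?c \<pi> * (A k (\<pi> s) * ?P \<pi>))))"
  proof (rule sum.cong[OF refl], clarsimp)
    fix \<pi> assume p: "\<pi> permutes ?T"
    have "A s (\<pi> s) = (if \<pi> s = s then d else 0) + (\<Sum>k\<in>S. w k * A k (\<pi> s))"
    proof (cases "\<pi> s = s")
      case False
      then have "\<pi> s \<in> S" using permutes_in_image[OF p, of s] by auto
      then show ?thesis using False row by simp
    qed (use diag in simp)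
    then have "?c \<pi> * (A s (\<pi> s) * ?P \<pi>) = ?c \<pi> * (((if \<pi> s = s then d else 0) + (\<Sum>k\<in>S. w k * A k (\<pi> s))) * ?P \<pi>)" by simp
    also have "\<dots> = (if \<pi> s = s then d * (?c \<pi> * ?P \<pi>) else 0) + (\<Sum>k\<in>S. w k * (?c \<pi> * (A k (\<pi> s) * ?P \<pi>)))"
      by (simp add: algebra_simps sum_distrib_left)
    finally show "(\<pi> s = s \<longrightarrow> ?c \<pi> * (A s s * ?P \<pi>) = d * (?c \<pi> * ?P \<pi>) + (\<Sum>k\<in>S. w k * (?c \<pi> * (A k s * ?P \<pi>)))) \<and>
         (\<pi> s \<noteq> s \<longrightarrow> ?c \<pi> * (A s (\<pi> s) * ?P \<pi>) = (\<Sum>k\<in>S. w k * (?c \<pi> * (A k (\<pi> s) * ?P \<pi>))))"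
      by (auto split: if_splits)
  qed
  also have "\<dots> = (\<Sum>\<pi> | \<pi> permutes ?T. (if \<pi> s = s then d * (?c \<pi> * ?P \<pi>) else 0))
       + (\<Sum>k\<in>S. w k * (\<Sum>\<pi> | \<pi> permutes ?T. ?c \<pi> * (A k (\<pi> s) * ?P \<pi>)))"
    by (simp add: sum.distrib sum_distrib_left) (rule sum.swap)
  also have "(\<Sum>k\<in>S. w k * (\<Sum>\<pi> | \<pi> permutes ?T. ?c \<pi> * (A k (\<pi> s) * ?P \<pi>))) = 0"
    by (rule sum.neutral) (use det_on_equal_rows[OF fin s] in simp)
  also have "(\<Sum>\<pi> | \<pi> permutes ?T. (if \<pi> s = s then d * (?c \<pi> * ?P \<pi>) else 0))
      = (\<Sum>\<pi> | \<pi> permutes S. d * (?c \<pi> * ?P \<pi>))"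
  proof -
    have "{\<pi>. \<pi> permutes S} = {\<pi>. \<pi> permutes ?T} \<inter> {\<pi>. \<pi> s = s}"
      using s permutes_superset[of _ ?T S] permutes_subset[of _ S ?T] permutes_not_in[of _ S s] by auto
    then show ?thesis using finT by (simp add: sum.inter_restrict)
  qed
  finally show ?thesis by (simp add: det_on_def sum_distrib_left)
qed

lemma det_on_scale: "finite S \<Longrightarrow> det_on S (\<lambda>k l. c * A k l) = c ^ card S * det_on S A"
  by (simp add: det_on_def prod.distrib sum_distrib_left algebra_simps)

text \<open>Completing the square exhibits a multiple of the normal density with mean
  \<open>c / d\<close> and variance \<open>1 / d\<close>.\<close>

lemma nn_integral_gaussian_linear:
  fixes d c :: real
  assumes "d > 0"
  shows "(\<integral>\<^sup>+ t. ennreal (exp (- d * t\<^sup>2 / 2 + c * t)) \<partial>lborel) = ennreal (sqrt (2 * pi / d) * exp (c\<^sup>2 / (2 * d)))"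
proof -
  let ?K = "sqrt (2 * pi / d) * exp (c\<^sup>2 / (2 * d))"
  have "exp (- d * t\<^sup>2 / 2 + c * t) = ?K * normal_density (c / d) (1 / sqrt d) t" for t
  proof -
    have "- d * t\<^sup>2 / 2 + c * t = c\<^sup>2 / (2 * d) + (- (t - c / d)\<^sup>2 / (2 * (1 / sqrt d)\<^sup>2))"
      using assms by (simp add: field_simps power2_eq_square)
    moreover have "sqrt (2 * pi / d) = sqrt (2 * pi * (1 / sqrt d)\<^sup>2)"
      using assms by (simp add: power_divide)
    ultimately show ?thesis
      using assms unfolding normal_density_def by (simp only: exp_add) simp
  qed
  then have "(\<integral>\<^sup>+ t. ennreal (exp (- d * t\<^sup>2 / 2 + c * t)) \<partial>lborel)
     = (\<integral>\<^sup>+ t. ennreal ?K * ennreal (normal_density (c / d) (1 / sqrt d) t) \<partial>lborel)"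
    using assms by (simp add: ennreal_mult)
  also have "\<dots> = ennreal ?K * (\<integral>\<^sup>+ t. ennreal (normal_density (c / d) (1 / sqrt d) t) \<partial>lborel)"
    by (rule nn_integral_cmult) simp
  also have "(\<integral>\<^sup>+ t. ennreal (normal_density (c / d) (1 / sqrt d) t) \<partial>lborel) = 1"
    using assms by (subst nn_integral_eq_integral) (auto intro!: integrable_normal_density simp: integral_normal_density)
  finally show ?thesis by simp
qed

section \<open>Positive definite forms: elimination of one index at a time\<close>

definition posdef_on :: "nat set \<Rightarrow> (nat \<Rightarrow> nat \<Rightarrow> real) \<Rightarrow> bool" where
  "posdef_on S A \<longleftrightarrow> (\<forall>b. (\<exists>k\<in>S. b k \<noteq> 0) \<longrightarrow> 0 < (\<Sum>k\<in>S. \<Sum>l\<in>S. A k l * b k * b l))"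

lemma posdef_on_subset:
  assumes "posdef_on T A" "S \<subseteq> T" "finite T"
  shows "posdef_on S A"
  unfolding posdef_on_def
proof (intro allI impI)
  fix b :: "nat \<Rightarrow> real" assume b: "\<exists>k\<in>S. b k \<noteq> 0"
  define b' where "b' k = (if k \<in> S then b k else 0)" for k
  have "(\<Sum>k\<in>T. \<Sum>l\<in>T. A k l * b' k * b' l) = (\<Sum>k\<in>S. \<Sum>l\<in>S. A k l * b' k * b' l)"
  proof -
    have "(\<Sum>l\<in>T. A k l * b' k * b' l) = (\<Sum>l\<in>S. A k l * b' k * b' l)" for k
      by (rule sum.mono_neutral_right) (use assms in \<open>auto simp: b'_def\<close>)
    moreover have "(\<Sum>k\<in>T. \<Sum>l\<in>S. A k l * b' k * b' l) = (\<Sum>k\<in>S. \<Sum>l\<in>S. A k l * b' k * b' l)"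
      by (rule sum.mono_neutral_right) (use assms in \<open>auto simp: b'_def\<close>)
    ultimately show ?thesis by simp
  qed
  also have "\<dots> = (\<Sum>k\<in>S. \<Sum>l\<in>S. A k l * b k * b l)" by (simp add: b'_def)
  finally have eq: "(\<Sum>k\<in>T. \<Sum>l\<in>T. A k l * b' k * b' l) = (\<Sum>k\<in>S. \<Sum>l\<in>S. A k l * b k * b l)" .
  have "\<exists>k\<in>T. b' k \<noteq> 0" using b assms(2) by (auto simp: b'_def)
  then have "0 < (\<Sum>k\<in>T. \<Sum>l\<in>T. A k l * b' k * b' l)"
    using assms(1) unfolding posdef_on_def by blast
  then show "0 < (\<Sum>k\<in>S. \<Sum>l\<in>S. A k l * b k * b l)" unfolding eq .
qed

lemma quadratic_form_insert:
  fixes A :: "nat \<Rightarrow> nat \<Rightarrow> real"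
  assumes "finite S" "s \<notin> S" "\<And>k l. A k l = A l k"
  shows "(\<Sum>k\<in>insert s S. \<Sum>l\<in>insert s S. A k l * b k * b l)
    = A s s * (b s)\<^sup>2 + 2 * b s * (\<Sum>k\<in>S. A k s * b k) + (\<Sum>k\<in>S. \<Sum>l\<in>S. A k l * b k * b l)"
proof -
  have "(\<Sum>l\<in>S. A s l * b s * b l) = b s * (\<Sum>k\<in>S. A k s * b k)"
    using assms(3)[of s] by (simp add: sum_distrib_left algebra_simps)
  moreover have "(\<Sum>k\<in>S. A k s * b k * b s) = b s * (\<Sum>k\<in>S. A k s * b k)"
    by (simp add: sum_distrib_left algebra_simps)
  ultimately show ?thesis using assms(1,2) by (simp add: sum.distrib power2_eq_square algebra_simps)
qed

text \<open>The Schur complement is the value of the form at the vector with entry 1 at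
  \<open>s\<close> and \<open>- w\<close> on \<open>S\<close>, and this vector is nonzero.\<close>

lemma schur_pos:
  fixes A :: "nat \<Rightarrow> nat \<Rightarrow> real"
  assumes "finite S" "s \<notin> S" "\<And>k l. A k l = A l k" "posdef_on (insert s S) A"
    and w: "\<And>k. k \<in> S \<Longrightarrow> (\<Sum>l\<in>S. A k l * w l) = A k s"
  shows "A s s - (\<Sum>k\<in>S. A k s * w k) > 0"
proof -
  define b where "b k = (if k = s then 1 else - w k)" for k
  have 1: "(\<Sum>k\<in>S. A k s * b k) = - (\<Sum>k\<in>S. A k s * w k)"
    unfolding sum_negf[symmetric] by (rule sum.cong) (use assms(2) in \<open>auto simp: b_def\<close>)
  have "(\<Sum>k\<in>S. \<Sum>l\<in>S. A k l * b k * b l) = (\<Sum>k\<in>S. w k * (\<Sum>l\<in>S. A k l * w l))"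
    unfolding sum_distrib_left by (intro sum.cong refl) (use assms(2) in \<open>auto simp: b_def\<close>)
  also have "\<dots> = (\<Sum>k\<in>S. A k s * w k)" using w by (simp add: mult.commute)
  finally have "(\<Sum>k\<in>insert s S. \<Sum>l\<in>insert s S. A k l * b k * b l) = A s s - (\<Sum>k\<in>S. A k s * w k)"
    unfolding quadratic_form_insert[of S s A b, OF assms(1-3)] 1 by (simp add: b_def)
  moreover have "\<exists>k\<in>insert s S. b k \<noteq> 0" by (auto simp: b_def)
  ultimately show ?thesis using assms(4)[unfolded posdef_on_def, rule_format, of b] by simp
qed

text \<open>Block elimination: the enlarged system is solved by combining two solutions on
  \<open>S\<close>, one for \<open>c\<close> and one for the new column, and dividing by the Schur
  complement. Two right-hand sides occur, so \<open>c\<close> is generalised in the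
  induction.\<close>

lemma posdef_solvable:
  fixes A :: "nat \<Rightarrow> nat \<Rightarrow> real"
  assumes "finite S" "\<And>k l. A k l = A l k" "posdef_on S A"
  shows "\<exists>u. \<forall>k\<in>S. (\<Sum>l\<in>S. A k l * u l) = c k"
  using assms(1,3)
proof (induction S arbitrary: c rule: finite_induct)
  case (insert s S)
  have pd: "posdef_on S A" using insert posdef_on_subset by blast
  obtain w where w: "\<And>k. k \<in> S \<Longrightarrow> (\<Sum>l\<in>S. A k l * w l) = A k s"
    using insert.IH[OF pd, of "\<lambda>k. A k s"] by blast
  obtain u where u: "\<And>k. k \<in> S \<Longrightarrow> (\<Sum>l\<in>S. A k l * u l) = c k"
    using insert.IH[OF pd, of c] by blast
  define d where "d = A s s - (\<Sum>k\<in>S. A k s * w k)"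
  have d: "d > 0" unfolding d_def by (rule schur_pos) (use insert assms(2) w in auto)
  define us where "us = (c s - (\<Sum>l\<in>S. A s l * u l)) / d"
  define v where "v k = (if k = s then us else u k - us * w k)" for k
  have S: "(\<Sum>l\<in>S. A k l * v l) = (\<Sum>l\<in>S. A k l * u l) - us * (\<Sum>l\<in>S. A k l * w l)" for k
    unfolding sum_distrib_left sum_subtractf[symmetric]
    by (rule sum.cong) (use insert.hyps in \<open>auto simp: v_def algebra_simps\<close>)
  have "(\<Sum>l\<in>insert s S. A k l * v l) = c k" if "k \<in> insert s S" for k
  proof (cases "k = s")
    case True
    have "(\<Sum>l\<in>insert s S. A s l * v l) = us * (A s s - (\<Sum>l\<in>S. A s l * w l)) + (\<Sum>l\<in>S. A s l * u l)"
      using insert.hyps by (simp add: S) (simp add: v_def algebra_simps)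
    also have "(\<Sum>l\<in>S. A s l * w l) = (\<Sum>l\<in>S. A l s * w l)"
      by (intro sum.cong refl) (simp add: assms(2)[of s])
    also have "A s s - (\<Sum>l\<in>S. A l s * w l) = d" unfolding d_def ..
    finally show ?thesis using d True by (simp add: us_def)
  next
    case False
    then have "k \<in> S" using that by auto
    then show ?thesis using insert.hyps by (simp add: S u w) (simp add: v_def)
  qed
  then show ?case by blast
qed simp

lemma det_on_schur:
  fixes A :: "nat \<Rightarrow> nat \<Rightarrow> real"
  assumes "finite S" "s \<notin> S" "\<And>k l. A k l = A l k"
    and w: "\<And>k. k \<in> S \<Longrightarrow> (\<Sum>l\<in>S. A k l * w l) = A k s"
  shows "det_on (insert s S) A = (A s s - (\<Sum>k\<in>S. A k s * w k)) * det_on S A"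
proof (rule det_on_insert_row[OF assms(1,2), where w = w])
  fix l assume "l \<in> S"
  have "A s l = A l s" by (rule assms(3))
  also have "\<dots> = (\<Sum>k\<in>S. A l k * w k)" using w[OF \<open>l \<in> S\<close>] by simp
  also have "\<dots> = (\<Sum>k\<in>S. w k * A k l)" using assms(3)[of l] by (simp add: mult.commute)
  finally show "A s l = (\<Sum>k\<in>S. w k * A k l)" .
qed (simp add: mult.commute)

lemma posdef_det_pos:
  fixes A :: "nat \<Rightarrow> nat \<Rightarrow> real"
  assumes "finite S" "\<And>k l. A k l = A l k" "posdef_on S A"
  shows "det_on S A > 0"
  using assms(1,3)
proof (induction S rule: finite_induct)
  case empty
  then show ?case by (simp add: det_on_def)
next
  case (insert s S)
  have pd: "posdef_on S A" using insert posdef_on_subset by blast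
  obtain w where w: "\<And>k. k \<in> S \<Longrightarrow> (\<Sum>l\<in>S. A k l * w l) = A k s"
    using posdef_solvable[OF insert.hyps(1) assms(2) pd, of "\<lambda>k. A k s"] by blast
  have "A s s - (\<Sum>k\<in>S. A k s * w k) > 0" by (rule schur_pos) (use insert assms(2) w in auto)
  then show ?case using det_on_schur[OF insert.hyps assms(2) w] insert.IH[OF pd] by simp
qed

lemma borel_measurable_PiM_coord [measurable]:
  "i \<in> I \<Longrightarrow> (\<lambda>b. b i) \<in> borel_measurable (PiM I (\<lambda>_. lborel :: real measure))"
  using measurable_component_singleton[of i I "\<lambda>_. lborel :: real measure"] by simp

text \<open>The coordinates are relabelled by \<open>h\<close> because the coefficients of a graph are indexed
  by its edges.\<close>

lemma nn_integral_multivariate_gaussian: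
  fixes A :: "nat \<Rightarrow> nat \<Rightarrow> real" and h :: "nat \<Rightarrow> 'i"
  assumes "finite S" "\<And>k l. A k l = A l k" "posdef_on S A" "inj h"
    and "\<And>k. k \<in> S \<Longrightarrow> (\<Sum>l\<in>S. A k l * u l) = c k"
  shows "(\<integral>\<^sup>+ b. ennreal (exp (- (\<Sum>k\<in>S. \<Sum>l\<in>S. A k l * b (h k) * b (h l)) / 2 + (\<Sum>k\<in>S. c k * b (h k))))
            \<partial>PiM (h ` S) (\<lambda>_. lborel))
    = ennreal (sqrt ((2 * pi) ^ card S / det_on S A) * exp ((\<Sum>k\<in>S. c k * u k) / 2))"
  using assms(1,3,5)
proof (induction S arbitrary: c u rule: finite_induct)
  case empty
  interpret product_sigma_finite "\<lambda>_::'i. lborel :: real measure" by unfold_locales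
  show ?case unfolding image_empty by (subst nn_integral_empty) (simp_all add: det_on_def)
next
  case (insert s S c u)
  interpret product_sigma_finite "\<lambda>_::'i. lborel :: real measure" by unfold_locales
  have pd: "posdef_on S A" using insert posdef_on_subset by blast
  obtain w where w: "\<And>k. k \<in> S \<Longrightarrow> (\<Sum>l\<in>S. A k l * w l) = A k s"
    using posdef_solvable[OF insert.hyps(1) assms(2) pd, of "\<lambda>k. A k s"] by blast
  define d where "d = A s s - (\<Sum>k\<in>S. A k s * w k)"
  have d: "d > 0" unfolding d_def by (rule schur_pos) (use insert assms(2) w in auto)
  \<comment> \<open>With the new coordinate frozen at \<open>t\<close>, the system on
    \<open>S\<close> has right-hand side \<open>c k - t * A k s\<close> and solution
    \<open>v - t * w\<close>; \<open>v\<close> is the case \<open>t = 0\<close>.\<close>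
  define v where "v l = u l + u s * w l" for l
  have v: "(\<Sum>l\<in>S. A k l * v l) = c k" if "k \<in> S" for k
  proof -
    have "(\<Sum>l\<in>S. A k l * v l) = (\<Sum>l\<in>S. A k l * u l) + u s * (\<Sum>l\<in>S. A k l * w l)"
      unfolding v_def by (simp add: algebra_simps sum.distrib sum_distrib_left)
    also have "\<dots> = (\<Sum>l\<in>insert s S. A k l * u l)" using insert.hyps w[OF that] by simp
    finally show ?thesis using insert.prems(2)[of k] that by simp
  qed
  have hs: "h s \<notin> h ` S" using insert.hyps \<open>inj h\<close> by (auto dest: injD)
  have hS: "h k \<noteq> h s" if "k \<in> S" for k using that insert.hyps \<open>inj h\<close> by (auto dest: injD)
  have sym_dot: "(\<Sum>k\<in>S. c k * w k) = (\<Sum>k\<in>S. A k s * v k)"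
  proof -
    have "(\<Sum>k\<in>S. c k * w k) = (\<Sum>k\<in>S. (\<Sum>l\<in>S. A k l * v l) * w k)"
      by (rule sum.cong) (simp_all add: v)
    also have "\<dots> = (\<Sum>l\<in>S. \<Sum>k\<in>S. A k l * v l * w k)"
      unfolding sum_distrib_right by (rule sum.swap)
    also have "\<dots> = (\<Sum>l\<in>S. (\<Sum>k\<in>S. A l k * w k) * v l)"
      unfolding sum_distrib_right by (intro sum.cong refl) (simp add: assms(2) mult_ac)
    also have "\<dots> = (\<Sum>l\<in>S. A l s * v l)" by (simp add: w)
    finally show ?thesis .
  qed
  let ?F = "\<lambda>b. ennreal (exp (- (\<Sum>k\<in>insert s S. \<Sum>l\<in>insert s S. A k l * b (h k) * b (h l)) / 2 + (\<Sum>k\<in>insert s S. c k * b (h k))))"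
  let ?K = "sqrt ((2 * pi) ^ card S / det_on S A)"
  let ?cv = "\<Sum>k\<in>S. c k * v k"
  let ?e = "c s - (\<Sum>k\<in>S. A k s * v k)"
  have detS: "det_on S A > 0" by (rule posdef_det_pos[OF insert.hyps(1) assms(2) pd])
  have "integral\<^sup>N (PiM (h ` insert s S) (\<lambda>_. lborel)) ?F =
     (\<integral>\<^sup>+ t. (\<integral>\<^sup>+ b. ?F (b(h s := t)) \<partial>PiM (h ` S) (\<lambda>_. lborel)) \<partial>lborel)"
    unfolding image_insert
    by (rule product_nn_integral_insert_rev) (use insert.hyps hs in auto)
  also have "\<dots> = (\<integral>\<^sup>+ t. ennreal (?K * exp (?cv / 2)) * ennreal (exp (- d * t\<^sup>2 / 2 + ?e * t)) \<partial>lborel)"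
  proof (rule nn_integral_cong)
    fix t :: real
    have F: "?F (b(h s := t)) = ennreal (exp (- A s s * t\<^sup>2 / 2 + c s * t)) *
       ennreal (exp (- (\<Sum>k\<in>S. \<Sum>l\<in>S. A k l * b (h k) * b (h l)) / 2 + (\<Sum>k\<in>S. (c k - t * A k s) * b (h k))))" for b
    proof -
      have e1: "(\<Sum>k\<in>S. A k s * (b(h s := t)) (h k)) = (\<Sum>k\<in>S. A k s * b (h k))"
        "(\<Sum>k\<in>S. c k * (b(h s := t)) (h k)) = (\<Sum>k\<in>S. c k * b (h k))"
        "(\<Sum>k\<in>S. \<Sum>l\<in>S. A k l * (b(h s := t)) (h k) * (b(h s := t)) (h l)) = (\<Sum>k\<in>S. \<Sum>l\<in>S. A k l * b (h k) * b (h l))"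
        using hS by (auto intro!: sum.cong)
      have e2: "(\<Sum>k\<in>S. (c k - t * A k s) * b (h k)) = (\<Sum>k\<in>S. c k * b (h k)) - t * (\<Sum>k\<in>S. A k s * b (h k))"
        by (simp add: algebra_simps sum_subtractf sum_distrib_left)
      have e3: "(\<Sum>k\<in>insert s S. c k * (b(h s := t)) (h k)) = c s * t + (\<Sum>k\<in>S. c k * b (h k))"
        unfolding sum.insert[OF insert.hyps] e1 by simp
      show ?thesis
        unfolding quadratic_form_insert[of S s A "\<lambda>k. (b(h s := t)) (h k)", OF insert.hyps assms(2)]
          e1 e2 e3 ennreal_mult[symmetric, OF exp_ge_zero exp_ge_zero] exp_add[symmetric]
        by (simp add: field_simps power2_eq_square)
    qed
    have sol: "(\<Sum>l\<in>S. A k l * (v l - t * w l)) = c k - t * A k s" if "k \<in> S" for k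
      using v[OF that] w[OF that] by (simp add: algebra_simps sum_subtractf flip: sum_distrib_left)
    have "(\<integral>\<^sup>+ b. ?F (b(h s := t)) \<partial>PiM (h ` S) (\<lambda>_. lborel)) =
       ennreal (exp (- A s s * t\<^sup>2 / 2 + c s * t)) * ennreal (?K * exp ((\<Sum>k\<in>S. (c k - t * A k s) * (v k - t * w k)) / 2))"
      unfolding F using insert.IH[OF pd sol] insert.hyps by (subst nn_integral_cmult) auto
    also have "(\<Sum>k\<in>S. (c k - t * A k s) * (v k - t * w k)) =
        ?cv - t * (\<Sum>k\<in>S. c k * w k) - t * (\<Sum>k\<in>S. A k s * v k) + t\<^sup>2 * (\<Sum>k\<in>S. A k s * w k)"
      by (simp add: algebra_simps sum.distrib sum_subtractf sum_distrib_left power2_eq_square)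
    also have "(\<Sum>k\<in>S. A k s * w k) = A s s - d" by (simp add: d_def)
    also have "ennreal (exp (- A s s * t\<^sup>2 / 2 + c s * t)) * ennreal (?K * exp ((?cv - t * (\<Sum>k\<in>S. c k * w k) - t * (\<Sum>k\<in>S. A k s * v k) + t\<^sup>2 * (A s s - d)) / 2))
       = ennreal (?K * exp (?cv / 2)) * ennreal (exp (- d * t\<^sup>2 / 2 + ?e * t))"
    proof -
      have "exp (- A s s * t\<^sup>2 / 2 + c s * t) * exp ((?cv - t * (\<Sum>k\<in>S. c k * w k) - t * (\<Sum>k\<in>S. A k s * v k) + t\<^sup>2 * (A s s - d)) / 2)
         = exp (?cv / 2) * exp (- d * t\<^sup>2 / 2 + ?e * t)"
        unfolding exp_add[symmetric] sym_dot by (simp add: field_simps)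
      then show ?thesis using detS by (simp add: ennreal_mult'[symmetric] mult_ac)
    qed
    finally show "(\<integral>\<^sup>+ b. ?F (b(h s := t)) \<partial>PiM (h ` S) (\<lambda>_. lborel)) =
        ennreal (?K * exp (?cv / 2)) * ennreal (exp (- d * t\<^sup>2 / 2 + ?e * t))" .
  qed
  also have "\<dots> = ennreal (?K * exp (?cv / 2)) * ennreal (sqrt (2 * pi / d) * exp (?e\<^sup>2 / (2 * d)))"
    by (subst nn_integral_cmult) (use nn_integral_gaussian_linear[OF d, of ?e] in auto)
  also have "\<dots> = ennreal (sqrt ((2 * pi) ^ card (insert s S) / det_on (insert s S) A) * exp ((\<Sum>k\<in>insert s S. c k * u k) / 2))"
  proof -
    \<comment> \<open>\<open>?e / d\<close> is the centre of the remaining Gaussian in the new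
      coordinate, hence the component \<open>u s\<close> of the full solution. This turns the
      quadratic exponent into the pairing of \<open>c\<close> with \<open>u\<close>.\<close>
    have "?e = u s * d"
    proof -
      have "c s = (\<Sum>l\<in>insert s S. A s l * u l)" using insert.prems(2)[of s] by simp
      also have "\<dots> = A s s * u s + (\<Sum>l\<in>S. A s l * u l)" using insert.hyps by simp
      also have "(\<Sum>l\<in>S. A s l * u l) = (\<Sum>l\<in>S. A l s * u l)"
        by (intro sum.cong refl) (simp add: assms(2)[of s])
      finally show ?thesis unfolding d_def v_def
        by (simp add: algebra_simps sum.distrib sum_distrib_left)
    qed
    then have "?cv / 2 + ?e\<^sup>2 / (2 * d) = (?cv + u s * ?e) / 2"
      using d by (simp add: power2_eq_square field_simps)
    also have "?cv + u s * ?e = (\<Sum>k\<in>insert s S. c k * u k)"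
    proof -
      have "?cv = (\<Sum>k\<in>S. c k * u k) + u s * (\<Sum>k\<in>S. c k * w k)"
        unfolding v_def by (simp add: algebra_simps sum.distrib sum_distrib_left)
      then show ?thesis using insert.hyps sym_dot by (simp add: algebra_simps)
    qed
    finally have "exp (?cv / 2) * exp (?e\<^sup>2 / (2 * d)) = exp ((\<Sum>k\<in>insert s S. c k * u k) / 2)"
      by (simp add: exp_add[symmetric])
    moreover have "?K * sqrt (2 * pi / d) = sqrt ((2 * pi) ^ card (insert s S) / det_on (insert s S) A)"
      using insert.hyps det_on_schur[OF insert.hyps assms(2) w] d_def
      by (simp add: real_sqrt_mult[symmetric] mult_ac)
    moreover have "(?K * exp (?cv / 2)) * (sqrt (2 * pi / d) * exp (?e\<^sup>2 / (2 * d)))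
        = (?K * sqrt (2 * pi / d)) * (exp (?cv / 2) * exp (?e\<^sup>2 / (2 * d)))" by (simp only: mult_ac)
    ultimately show ?thesis using detS d by (subst ennreal_mult[symmetric]) auto
  qed
  finally show ?case .
qed

section \<open>The marginal likelihood\<close>

lemma gram_sym: "gram n x k l = gram n x l k"
  by (simp add: gram_def mult.commute)

lemma gram_quadratic_form:
  "(\<Sum>k\<in>S. \<Sum>l\<in>S. gram n x k l * b k * b l) = (\<Sum>i\<in>{1..n}. (\<Sum>k\<in>S. b k * x i k)\<^sup>2)"
proof -
  have "(\<Sum>k\<in>S. \<Sum>l\<in>S. gram n x k l * b k * b l) = (\<Sum>k\<in>S. \<Sum>l\<in>S. \<Sum>i\<in>{1..n}. (b k * x i k) * (b l * x i l))"
    by (simp add: gram_def sum_distrib_left sum_distrib_right mult_ac)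
  also have "\<dots> = (\<Sum>k\<in>S. \<Sum>i\<in>{1..n}. \<Sum>l\<in>S. (b k * x i k) * (b l * x i l))"
    by (intro sum.cong refl sum.swap)
  also have "\<dots> = (\<Sum>i\<in>{1..n}. \<Sum>k\<in>S. \<Sum>l\<in>S. (b k * x i k) * (b l * x i l))"
    by (rule sum.swap)
  also have "\<dots> = (\<Sum>i\<in>{1..n}. (\<Sum>k\<in>S. b k * x i k)\<^sup>2)"
    by (simp add: power2_eq_square sum_product)
  finally show ?thesis .
qed

definition rss :: "nat \<Rightarrow> (nat \<Rightarrow> nat \<Rightarrow> real) \<Rightarrow> nat set \<Rightarrow> nat \<Rightarrow> (nat \<Rightarrow> real) \<Rightarrow> real" where
  "rss n x S j b = (\<Sum>i\<in>{1..n}. (x i j - (\<Sum>k\<in>S. b k * x i k))\<^sup>2)"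

lemma rss_expand:
  "rss n x S j b = gram n x j j - 2 * (\<Sum>k\<in>S. gram n x k j * b k) + (\<Sum>k\<in>S. \<Sum>l\<in>S. gram n x k l * b k * b l)"
proof -
  have "rss n x S j b = (\<Sum>i\<in>{1..n}. x i j * x i j - 2 * (\<Sum>k\<in>S. x i k * x i j * b k) + (\<Sum>k\<in>S. b k * x i k)\<^sup>2)"
  proof -
    have "(\<Sum>k\<in>S. x i k * x i j * b k) = x i j * (\<Sum>k\<in>S. b k * x i k)" for i
      unfolding sum_distrib_left by (simp add: mult_ac)
    moreover have "(a - s)\<^sup>2 = a * a - 2 * (a * s) + s\<^sup>2" for a s :: real
      by (simp add: power2_eq_square algebra_simps)
    ultimately show ?thesis unfolding rss_def by simp
  qed
  also have "\<dots> = gram n x j j - 2 * (\<Sum>i\<in>{1..n}. \<Sum>k\<in>S. x i k * x i j * b k) + (\<Sum>i\<in>{1..n}. (\<Sum>k\<in>S. b k * x i k)\<^sup>2)"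
    by (simp add: sum.distrib sum_subtractf gram_def flip: sum_distrib_left)
  also have "(\<Sum>i\<in>{1..n}. \<Sum>k\<in>S. x i k * x i j * b k) = (\<Sum>k\<in>S. gram n x k j * b k)"
    by (subst sum.swap) (simp add: gram_def sum_distrib_right)
  finally show ?thesis by (simp add: gram_quadratic_form)
qed

text \<open>The precision of the g-prior is a multiple of the precision of the likelihood, so
  together they give \<open>r\<close> times the Gram matrix with
  \<open>r = (1 + 1 / g) / \<theta>\<close>. Its determinant cancels against the normalisation of
  the prior, leaving one factor \<open>1 / sqrt (1 + g)\<close> per coefficient, and the least
  squares solution is shrunk by \<open>g / (1 + g)\<close>.\<close>

lemma nn_integral_gprior_likelihood:
  fixes h :: "nat \<Rightarrow> 'i"
  assumes "finite S" "posdef_on S (gram n x)" "inj h" "g > 0" "\<theta> > 0"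
    and w: "\<And>k. k \<in> S \<Longrightarrow> (\<Sum>l\<in>S. gram n x k l * w l) = gram n x k j"
  shows "(\<integral>\<^sup>+ b. ennreal (gprior_dens g n x S (\<lambda>k. b (h k)) \<theta> *
             (\<Prod>i\<in>{1..n}. exp (- (x i j - (\<Sum>k\<in>S. b (h k) * x i k))\<^sup>2 / (2 * \<theta>)) / sqrt (2 * pi * \<theta>)))
            \<partial>PiM (h ` S) (\<lambda>_. lborel))
     = ennreal ((1 / sqrt (2 * pi * \<theta>)) ^ n * (1 / sqrt (1 + g)) ^ card S *
          exp (- (gram n x j j - g / (1 + g) * (\<Sum>k\<in>S. gram n x k j * w k)) / (2 * \<theta>)))"
proof -
  define r where "r = (1 + 1 / g) / \<theta>"
  have r: "r > 0" using assms by (simp add: r_def add_pos_pos)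
  define A where "A = (\<lambda>k l. r * gram n x k l)"
  define c where "c k = gram n x k j / \<theta>" for k
  define u where "u k = g / (1 + g) * w k" for k
  have symA: "A k l = A l k" for k l by (simp add: A_def gram_sym[of n x k l])
  have detg: "det_on S (gram n x) > 0" by (rule posdef_det_pos[OF assms(1) gram_sym assms(2)])
  have pdA: "posdef_on S A"
  proof -
    have "(\<Sum>k\<in>S. \<Sum>l\<in>S. A k l * b k * b l) = r * (\<Sum>k\<in>S. \<Sum>l\<in>S. gram n x k l * b k * b l)" for b
      unfolding A_def sum_distrib_left by (simp add: mult.assoc)
    then show ?thesis using assms(2) r unfolding posdef_on_def by simp
  qed
  have uA: "(\<Sum>l\<in>S. A k l * u l) = c k" if "k \<in> S" for k
  proof -
    have "(\<Sum>l\<in>S. A k l * u l) = r * (g / (1 + g)) * (\<Sum>l\<in>S. gram n x k l * w l)"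
      unfolding A_def u_def sum_distrib_left by (simp add: mult_ac)
    also have "r * (g / (1 + g)) = ((1 + g) / g) * (g / (1 + g)) / \<theta>" 
    proof -
      have "1 + 1 / g = (1 + g) / g" using assms(4) by (simp add: field_simps)
      then show ?thesis by (simp add: r_def)
    qed
    also have "\<dots> = 1 / \<theta>" using assms(4) by simp
    finally show ?thesis by (simp add: w[OF that] c_def)
  qed
  define K0 where "K0 = (2 * pi * g * \<theta>) powr (- real (card S) / 2) * sqrt (det_on S (gram n x)) *
      (1 / sqrt (2 * pi * \<theta>)) ^ n * exp (- gram n x j j / (2 * \<theta>))"
  have K0: "K0 \<ge> 0" using detg assms(5) by (simp add: K0_def)
  have integrand: "gprior_dens g n x S (\<lambda>k. b (h k)) \<theta> *
             (\<Prod>i\<in>{1..n}. exp (- (x i j - (\<Sum>k\<in>S. b (h k) * x i k))\<^sup>2 / (2 * \<theta>)) / sqrt (2 * pi * \<theta>))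
      = K0 * exp (- (\<Sum>k\<in>S. \<Sum>l\<in>S. A k l * b (h k) * b (h l)) / 2 + (\<Sum>k\<in>S. c k * b (h k)))" for b
  proof -
    define q where "q = (\<Sum>k\<in>S. \<Sum>l\<in>S. gram n x k l * b (h k) * b (h l))"
    define s where "s = (\<Sum>k\<in>S. gram n x k j * b (h k))"
    have "(\<Prod>i\<in>{1..n}. exp (- (x i j - (\<Sum>k\<in>S. b (h k) * x i k))\<^sup>2 / (2 * \<theta>)) / sqrt (2 * pi * \<theta>))
      = exp (- rss n x S j (\<lambda>k. b (h k)) / (2 * \<theta>)) * (1 / sqrt (2 * pi * \<theta>)) ^ n"
      by (simp add: rss_def prod_dividef exp_sum sum_negf[symmetric] sum_divide_distrib power_one_over field_simps)
    also have "rss n x S j (\<lambda>k. b (h k)) = gram n x j j - 2 * s + q"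
      by (simp add: rss_expand q_def s_def)
    finally have 1: "(\<Prod>i\<in>{1..n}. exp (- (x i j - (\<Sum>k\<in>S. b (h k) * x i k))\<^sup>2 / (2 * \<theta>)) / sqrt (2 * pi * \<theta>))
      = exp (- (gram n x j j - 2 * s + q) / (2 * \<theta>)) * (1 / sqrt (2 * pi * \<theta>)) ^ n" .
    have 2: "(\<Sum>i\<in>{1..n}. (\<Sum>k\<in>S. b (h k) * x i k)\<^sup>2) = q"
      unfolding q_def by (rule gram_quadratic_form[symmetric])
    have 3: "(\<Sum>k\<in>S. \<Sum>l\<in>S. A k l * b (h k) * b (h l)) = r * q"
      unfolding A_def q_def sum_distrib_left by (simp add: mult_ac)
    have 4: "(\<Sum>k\<in>S. c k * b (h k)) = s / \<theta>"
      by (simp add: c_def s_def sum_divide_distrib)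
    have 5: "- q / (2 * g * \<theta>) + - (gram n x j j - 2 * s + q) / (2 * \<theta>) = - gram n x j j / (2 * \<theta>) + (- (r * q) / 2 + s / \<theta>)"
      using assms(4,5) by (simp add: r_def field_simps)
    have E: "exp (- q / (2 * g * \<theta>)) * exp (- (gram n x j j - 2 * s + q) / (2 * \<theta>)) = exp (- gram n x j j / (2 * \<theta>)) * exp (- (r * q) / 2 + s / \<theta>)"
      unfolding exp_add[symmetric] 5 ..
    have "a * d * e1 * (e2 * m) = a * d * m * e3 * e4" if "e1 * e2 = e3 * e4" for a d e1 e2 e3 e4 m :: real
      using that by algebra
    from this[OF E] show ?thesis unfolding gprior_dens_def 1 2 3 4 K0_def .
  qed
  have "(\<integral>\<^sup>+ b. ennreal (K0 * exp (- (\<Sum>k\<in>S. \<Sum>l\<in>S. A k l * b (h k) * b (h l)) / 2 + (\<Sum>k\<in>S. c k * b (h k))))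
            \<partial>PiM (h ` S) (\<lambda>_. lborel))
     = ennreal K0 * (\<integral>\<^sup>+ b. ennreal (exp (- (\<Sum>k\<in>S. \<Sum>l\<in>S. A k l * b (h k) * b (h l)) / 2 + (\<Sum>k\<in>S. c k * b (h k))))
            \<partial>PiM (h ` S) (\<lambda>_. lborel))"
    using K0 by (subst nn_integral_cmult[symmetric]) (auto simp: ennreal_mult')
  also have "\<dots> = ennreal K0 * ennreal (sqrt ((2 * pi) ^ card S / det_on S A) * exp ((\<Sum>k\<in>S. c k * u k) / 2))"
    using nn_integral_multivariate_gaussian[OF assms(1) symA pdA assms(3) uA] by simp
  also have "\<dots> = ennreal (K0 * (sqrt ((2 * pi) ^ card S / det_on S A) * exp ((\<Sum>k\<in>S. c k * u k) / 2)))"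
    using K0 by (simp add: ennreal_mult')
  also have "K0 * (sqrt ((2 * pi) ^ card S / det_on S A) * exp ((\<Sum>k\<in>S. c k * u k) / 2)) =
     (1 / sqrt (2 * pi * \<theta>)) ^ n * (1 / sqrt (1 + g)) ^ card S *
          exp (- (gram n x j j - g / (1 + g) * (\<Sum>k\<in>S. gram n x k j * w k)) / (2 * \<theta>))"
  proof -
    let ?s = "card S"
    have 1: "(\<Sum>k\<in>S. c k * u k) = g / (1 + g) * (\<Sum>k\<in>S. gram n x k j * w k) / \<theta>"
      unfolding c_def u_def sum_distrib_left sum_divide_distrib by (simp add: mult_ac)
    have 2: "exp (- gram n x j j / (2 * \<theta>)) * exp ((\<Sum>k\<in>S. c k * u k) / 2)
       = exp (- (gram n x j j - g / (1 + g) * (\<Sum>k\<in>S. gram n x k j * w k)) / (2 * \<theta>))"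
    proof -
      have "- a / (2 * \<theta>) + f / \<theta> / 2 = - (a - f) / (2 * \<theta>)" for a f :: real
        using assms(5) by (simp add: field_simps)
      then show ?thesis unfolding 1 exp_add[symmetric] by (simp only:)
    qed
    have "(2 * pi * g * \<theta>) powr (- real ?s / 2) = 1 / sqrt ((2 * pi * g * \<theta>) ^ ?s)"
    proof -
      have "(2 * pi * g * \<theta>) powr (- real ?s / 2) = 1 / ((2 * pi * g * \<theta>) powr (real ?s)) powr (1/2)"
        by (simp add: powr_powr powr_minus_divide)
      then show ?thesis using assms(4,5) by (simp add: powr_half_sqrt powr_realpow)
    qed
    then have "(2 * pi * g * \<theta>) powr (- real ?s / 2) * sqrt (det_on S (gram n x)) * sqrt ((2 * pi) ^ ?s / det_on S A)
       = sqrt (det_on S (gram n x) * ((2 * pi) ^ ?s / (r ^ ?s * det_on S (gram n x))) / (2 * pi * g * \<theta>) ^ ?s)"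
      unfolding A_def det_on_scale[OF assms(1)] by (simp add: real_sqrt_mult real_sqrt_divide)
    also have "det_on S (gram n x) * ((2 * pi) ^ ?s / (r ^ ?s * det_on S (gram n x))) / (2 * pi * g * \<theta>) ^ ?s
       = (2 * pi / (r * (2 * pi * g * \<theta>))) ^ ?s"
      using detg by (simp add: power_divide power_mult_distrib)
    also have "2 * pi / (r * (2 * pi * g * \<theta>)) = 1 / (1 + g)"
    proof -
      have "r * (2 * pi * g * \<theta>) = 2 * pi * (1 + g)" using assms(4,5) by (simp add: r_def field_simps)
      then show ?thesis by simp
    qed
    also have "sqrt ((1 / (1 + g)) ^ ?s) = (1 / sqrt (1 + g)) ^ ?s"
      by (simp add: real_sqrt_power real_sqrt_divide)
    finally have D: "(2 * pi * g * \<theta>) powr (- real ?s / 2) * sqrt (det_on S (gram n x)) * sqrt ((2 * pi) ^ ?s / det_on S A)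
       = (1 / sqrt (1 + g)) ^ ?s" .
    have "a * d * m * e1 * (d' * e2) = m * t * e" if "a * d * d' = t" "e1 * e2 = e" for a d d' t e1 e2 e m :: real
      unfolding that[symmetric] by (simp only: mult_ac)
    from this[OF D 2] show ?thesis unfolding K0_def .
  qed
  finally show ?thesis unfolding integrand .
qed

text \<open>Tonelli for disjoint blocks of coordinates. The last assumption says that each factor
  sees only its own block, so it can be evaluated at merged points.\<close>

lemma (in product_sigma_finite) nn_integral_prod_blocks:
  fixes f :: "'j \<Rightarrow> ('i \<Rightarrow> 'a) \<Rightarrow> ennreal"
  assumes "finite J" "\<And>j. j \<in> J \<Longrightarrow> finite (I j)" "disjoint_family_on I J"
    and "\<And>j. j \<in> J \<Longrightarrow> f j \<in> borel_measurable (PiM (I j) M)"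
    and "\<And>j b b'. j \<in> J \<Longrightarrow> (\<And>i. i \<in> I j \<Longrightarrow> b i = b' i) \<Longrightarrow> f j b = f j b'"
  shows "(\<integral>\<^sup>+ b. (\<Prod>j\<in>J. f j b) \<partial>PiM (\<Union>j\<in>J. I j) M) = (\<Prod>j\<in>J. \<integral>\<^sup>+ b. f j b \<partial>PiM (I j) M)"
  using assms
proof (induction J rule: finite_induct)
  case empty
  show ?case unfolding prod.empty UN_empty by (subst nn_integral_empty) simp_all
next
  case (insert j J)
  let ?U = "\<Union>j\<in>J. I j"
  have disj: "I j \<inter> ?U = {}" using insert.prems(2) insert.hyps(2)
    unfolding disjoint_family_on_def by (metis (no_types, lifting) Int_UN_distrib SUP_bot_conv(2) insertCI)
  have fin: "finite (I j)" "finite ?U" using insert.hyps(1) insert.prems(1) by auto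
  \<comment> \<open>Measurability is given on the block alone; it extends to larger products because
    \<open>f k\<close> is unchanged by restricting its argument to the block.\<close>
  have meas: "f k \<in> borel_measurable (PiM T M)" if "k \<in> insert j J" "I k \<subseteq> T" for k T
  proof -
    have "(\<lambda>b. f k (restrict b (I k))) \<in> borel_measurable (PiM T M)"
      using measurable_compose[OF measurable_restrict_subset[OF that(2)] insert.prems(3)[OF that(1)]] .
    moreover have "f k (restrict b (I k)) = f k b" for b
      by (rule insert.prems(4)[OF that(1)]) auto
    ultimately show ?thesis by simp
  qed
  have IH: "(\<integral>\<^sup>+ b. (\<Prod>j\<in>J. f j b) \<partial>PiM ?U M) = (\<Prod>j\<in>J. \<integral>\<^sup>+ b. f j b \<partial>PiM (I j) M)"
  proof (rule insert.IH)
    show "disjoint_family_on I J"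
      using insert.prems(2) by (rule disjoint_family_on_mono[rotated]) auto
    show "f k b = f k b'" if "k \<in> J" "\<And>i. i \<in> I k \<Longrightarrow> b i = b' i" for k b b'
      using that by (intro insert.prems(4)) auto
  qed (use insert.prems(1,3) in auto)
  have "(\<integral>\<^sup>+ b. (\<Prod>j\<in>insert j J. f j b) \<partial>PiM (\<Union>j\<in>insert j J. I j) M)
     = (\<integral>\<^sup>+ b. f j b * (\<Prod>j\<in>J. f j b) \<partial>PiM (I j \<union> ?U) M)" using insert.hyps by simp
  also have "\<dots> = (\<integral>\<^sup>+ a. (\<integral>\<^sup>+ b. f j (merge (I j) ?U (a, b)) * (\<Prod>k\<in>J. f k (merge (I j) ?U (a, b))) \<partial>PiM ?U M) \<partial>PiM (I j) M)"
  proof (rule product_nn_integral_fold[OF disj fin])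
    show "(\<lambda>b. f j b * (\<Prod>j\<in>J. f j b)) \<in> borel_measurable (PiM (I j \<union> ?U) M)"
      by (intro borel_measurable_times_ennreal borel_measurable_prod_ennreal meas) auto
  qed
  also have "\<dots> = (\<integral>\<^sup>+ a. (\<integral>\<^sup>+ b. f j a * (\<Prod>k\<in>J. f k b) \<partial>PiM ?U M) \<partial>PiM (I j) M)"
  proof -
    have "f j (merge (I j) ?U (a, b)) = f j a" for a b
      by (rule insert.prems(4)) (auto simp: merge_def)
    moreover have "f k (merge (I j) ?U (a, b)) = f k b" if "k \<in> J" for a b k
      using that disj by (intro insert.prems(4)) (auto simp: merge_def)
    ultimately show ?thesis by simp
  qed
  also have "\<dots> = (\<integral>\<^sup>+ a. f j a * (\<integral>\<^sup>+ b. (\<Prod>k\<in>J. f k b) \<partial>PiM ?U M) \<partial>PiM (I j) M)"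
    by (intro nn_integral_cong nn_integral_cmult borel_measurable_prod_ennreal meas) auto
  also have "\<dots> = (\<integral>\<^sup>+ a. f j a \<partial>PiM (I j) M) * (\<integral>\<^sup>+ b. (\<Prod>k\<in>J. f k b) \<partial>PiM ?U M)"
    by (intro nn_integral_multc meas) auto
  finally show ?case using insert.hyps IH by simp
qed

section \<open>The integral over the variance, of inverse gamma type\<close>

definition scale_integral :: "nat \<Rightarrow> real \<Rightarrow> ennreal" where
  "scale_integral N Q = (\<integral>\<^sup>+ \<theta>. indicator {0<..} \<theta> *
      ennreal (1 / \<theta> * (1 / sqrt (2 * pi * \<theta>)) ^ N * exp (- Q / (2 * \<theta>))) \<partial>lborel)"

text \<open>Substitute \<open>Q * t\<close> for the variance: the Jeffreys measure is scale
  invariant, so only the Gaussian normalisations produce powers of \<open>Q\<close>. The value at 1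
  stays unevaluated; being finite and positive, it cancels in ratios of marginal
  likelihoods.\<close>

lemma scale_integral_scaling:
  assumes "Q > 0"
  shows "scale_integral N Q = ennreal ((1 / sqrt Q) ^ N) * scale_integral N 1"
proof -
  let ?f = "\<lambda>Q \<theta>. indicator {0<..} \<theta> * ennreal (1 / \<theta> * (1 / sqrt (2 * pi * \<theta>)) ^ N * exp (- Q / (2 * \<theta>)))"
  have "scale_integral N Q = ennreal \<bar>Q\<bar> * (\<integral>\<^sup>+ t. ?f Q (0 + Q * t) \<partial>lborel)"
    unfolding scale_integral_def by (rule nn_integral_real_affine) (use assms in auto)
  also have "\<dots> = (\<integral>\<^sup>+ t. ennreal Q * ?f Q (Q * t) \<partial>lborel)"
    using assms by (subst nn_integral_cmult) auto
  also have "\<dots> = (\<integral>\<^sup>+ t. ennreal ((1 / sqrt Q) ^ N) * ?f 1 t \<partial>lborel)"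
  proof (rule nn_integral_cong)
    fix t :: real
    show "ennreal Q * ?f Q (Q * t) = ennreal ((1 / sqrt Q) ^ N) * ?f 1 t"
    proof (cases "t > 0")
      case True
      have "sqrt (2 * pi * (Q * t)) = sqrt Q * sqrt (2 * pi * t)"
        unfolding real_sqrt_mult[symmetric] by (simp add: mult_ac)
      then have "Q * (1 / (Q * t) * (1 / sqrt (2 * pi * (Q * t))) ^ N * exp (- Q / (2 * (Q * t)))) =
          (1 / sqrt Q) ^ N * (1 / t * (1 / sqrt (2 * pi * t)) ^ N * exp (- 1 / (2 * t)))"
        using assms True by (simp add: power_mult_distrib power_divide)
      then show ?thesis using assms True
        by (simp add: ennreal_mult'[symmetric] zero_less_mult_iff)
    qed (use assms in \<open>simp add: zero_less_mult_iff\<close>)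
  qed
  also have "\<dots> = ennreal ((1 / sqrt Q) ^ N) * scale_integral N 1"
    unfolding scale_integral_def by (rule nn_integral_cmult) simp
  finally show ?thesis .
qed

text \<open>The integrand is dominated by a multiple of the Cauchy kernel. Above 1 two of the
  Gaussian factors supply the missing power of decay, whence \<open>N \<ge> 2\<close>; below 1 the
  exponential beats every negative power.\<close>

lemma scale_integral_finite:
  assumes "N \<ge> 2"
  shows "scale_integral N 1 < \<infinity>"
proof -
  \<comment> \<open>\<open>m\<close> counts the powers of \<open>1 / \<theta>\<close> to be beaten
    near 0 when each \<open>1 / sqrt (2 * pi * \<theta>)\<close> is bounded by
    \<open>1 / \<theta>\<close>. The constant \<open>D\<close> comes from raising exp u \<ge> u,
    with u = \<open>1 / (2 * m * \<theta>)\<close>, to the power \<open>m\<close>.\<close>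
  define m where "m = N + 1"
  define D :: real where "D = (2 * real m) ^ m"
  have D: "D \<ge> 1" unfolding D_def m_def by (rule one_le_power) simp
  have bound: "1 / \<theta> * (1 / sqrt (2 * pi * \<theta>)) ^ N * exp (- 1 / (2 * \<theta>)) \<le> 2 * D * (1 / (1 + \<theta>\<^sup>2))"
    if t: "\<theta> > 0" for \<theta> :: real
  proof (cases "\<theta> \<ge> 1")
    case True
    have two_pi: "2 * pi * \<theta> \<ge> \<theta>" using t pi_gt3 by (simp add: mult_le_cancel_right1)
    then have "2 * pi * \<theta> \<ge> 1" using True by linarith
    then have "1 / sqrt (2 * pi * \<theta>) \<le> 1" by simp
    then have "(1 / sqrt (2 * pi * \<theta>)) ^ N \<le> (1 / sqrt (2 * pi * \<theta>)) ^ 2"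
      using assms t by (intro power_decreasing) auto
    also have "\<dots> = 1 / (2 * pi * \<theta>)" using t by (simp add: power_divide)
    also have "\<dots> \<le> 1 / \<theta>" using two_pi t by (intro divide_left_mono) auto
    finally have "1 / \<theta> * (1 / sqrt (2 * pi * \<theta>)) ^ N * exp (- 1 / (2 * \<theta>)) \<le> 1 / \<theta> * (1 / \<theta>) * 1"
      using t by (intro mult_mono mult_nonneg_nonneg) auto
    also have "\<dots> = 2 * 1 * (1 / (\<theta>\<^sup>2 + \<theta>\<^sup>2))" using t by (simp add: power2_eq_square)
    also have "\<dots> \<le> 2 * D * (1 / (1 + \<theta>\<^sup>2))"
      using D True by (intro mult_mono divide_left_mono) (auto simp: one_le_power intro!: mult_pos_pos add_pos_pos)
    finally show ?thesis .
  next
    case False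
    have "\<theta>\<^sup>2 \<le> 2 * pi * \<theta>"
    proof -
      have "\<theta> * \<theta> \<le> (2 * pi) * \<theta>" using t False pi_gt3 by (intro mult_right_mono) auto
      then show ?thesis by (simp add: power2_eq_square)
    qed
    then have "\<theta> \<le> sqrt (2 * pi * \<theta>)" using t by (simp add: real_le_rsqrt)
    then have 1: "(1 / sqrt (2 * pi * \<theta>)) ^ N \<le> (1 / \<theta>) ^ N"
      using t by (intro power_mono divide_left_mono) auto
    have m: "real m > 0" by (simp add: m_def)
    have "1 / (2 * real m * \<theta>) \<le> exp (1 / (2 * real m * \<theta>))"
      using exp_ge_add_one_self[of "1 / (2 * real m * \<theta>)"] by linarith
    then have "(1 / (2 * real m * \<theta>)) ^ m \<le> exp (1 / (2 * real m * \<theta>)) ^ m"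
      using t m by (intro power_mono) auto
    also have "\<dots> = exp (1 / (2 * \<theta>))" using m by (simp add: exp_of_nat_mult[symmetric])
    finally have "(1 / (2 * real m * \<theta>)) ^ m \<le> exp (1 / (2 * \<theta>))" .
    then have "1 / exp (1 / (2 * \<theta>)) \<le> 1 / (1 / (2 * real m * \<theta>)) ^ m"
      using t m by (intro divide_left_mono) auto
    also have "\<dots> = D * \<theta> ^ m" by (simp add: D_def power_divide power_mult_distrib)
    finally have 2: "exp (- 1 / (2 * \<theta>)) \<le> D * \<theta> ^ m" by (simp add: exp_minus field_simps)
    have "1 / \<theta> * (1 / sqrt (2 * pi * \<theta>)) ^ N * exp (- 1 / (2 * \<theta>)) \<le> 1 / \<theta> * (1 / \<theta>) ^ N * (D * \<theta> ^ m)"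
      using t 1 2 by (intro mult_mono mult_nonneg_nonneg) auto
    also have "\<dots> = 2 * D * (1 / (1 + 1))" using t by (simp add: m_def power_divide)
    also have "\<dots> \<le> 2 * D * (1 / (1 + \<theta>\<^sup>2))"
      using D False t by (intro mult_left_mono divide_left_mono) (auto simp: power_le_one intro!: mult_pos_pos add_pos_pos)
    finally show ?thesis .
  qed
  have int: "integrable lborel (\<lambda>\<theta>::real. inverse (1 + \<theta>\<^sup>2))"
    using integrable_inverse_1_plus_square by (simp add: set_integrable_def)
  have "scale_integral N 1 \<le> (\<integral>\<^sup>+ \<theta>. ennreal (2 * D) * ennreal (inverse (1 + \<theta>\<^sup>2)) \<partial>lborel)"
    unfolding scale_integral_def
  proof (rule nn_integral_mono)
    fix \<theta> :: real
    show "indicator {0<..} \<theta> * ennreal (1 / \<theta> * (1 / sqrt (2 * pi * \<theta>)) ^ N * exp (- 1 / (2 * \<theta>)))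
       \<le> ennreal (2 * D) * ennreal (inverse (1 + \<theta>\<^sup>2))"
      using bound[of \<theta>] D
      by (cases "\<theta> > 0") (auto simp: ennreal_mult'[symmetric] divide_simps intro!: ennreal_leI)
  qed
  also have "\<dots> = ennreal (2 * D) * (\<integral>\<^sup>+ \<theta>. ennreal (inverse (1 + \<theta>\<^sup>2)) \<partial>lborel)"
    by (rule nn_integral_cmult) simp
  also have "\<dots> < \<infinity>"
    using int by (subst nn_integral_eq_integral) (auto simp: ennreal_mult'[symmetric] ennreal_mult_less_top)
  finally show ?thesis .
qed

lemma scale_integral_pos: "scale_integral N 1 > 0"
proof -
  let ?f = "\<lambda>\<theta>::real. indicator {0<..} \<theta> * ennreal (1 / \<theta> * (1 / sqrt (2 * pi * \<theta>)) ^ N * exp (- 1 / (2 * \<theta>)))"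
  have f: "?f \<theta> \<noteq> 0" if "\<theta> > 0" for \<theta> using that by auto
  have "\<not> (AE \<theta> in lborel. ?f \<theta> = 0)"
  proof
    assume "AE \<theta> in lborel. ?f \<theta> = 0"
    then have "AE \<theta> in lborel. \<theta> \<notin> {0<..<1::real}" by eventually_elim (use f in force)
    moreover have "(AE \<theta> in lborel. \<theta> \<notin> {0<..<1::real}) \<longleftrightarrow> emeasure lborel {0<..<1::real} = 0"
      by (rule AE_iff_measurable) auto
    ultimately show False by simp
  qed
  then have "scale_integral N 1 \<noteq> 0"
    unfolding scale_integral_def by (subst nn_integral_0_iff_AE) auto
  then show ?thesis by (simp add: zero_less_iff_neq_zero)
qed

text \<open>What remains in the exponent once the coefficients are integrated out. The argument
  \<open>w\<close> is to be a family of solutions of the normal equations, one for each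
  node.\<close>

definition gprior_quadratic ::
  "real \<Rightarrow> nat \<Rightarrow> nat \<Rightarrow> graph \<Rightarrow> (nat \<Rightarrow> nat \<Rightarrow> real) \<Rightarrow> (nat \<Rightarrow> nat \<Rightarrow> real) \<Rightarrow> real" where
  "gprior_quadratic g p n E x w =
     (\<Sum>j\<in>{1..p}. gram n x j j - g / (1 + g) * (\<Sum>k\<in>pa E j. gram n x k j * w j k))"

lemma pa_subset: "E \<in> DAGs p \<Longrightarrow> pa E j \<subseteq> {1..p}"
  by (auto simp: DAGs_def pa_def)

lemma finite_pa: "E \<in> DAGs p \<Longrightarrow> finite (pa E j)"
  by (rule finite_subset[OF pa_subset]) auto

lemma edges_by_target: "E \<in> DAGs p \<Longrightarrow> E = (\<Union>j\<in>{1..p}. (\<lambda>k. (k, j)) ` pa E j)"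
  by (auto simp: DAGs_def pa_def)

lemma card_edges: "E \<in> DAGs p \<Longrightarrow> card E = (\<Sum>j\<in>{1..p}. card (pa E j))"
proof -
  assume E: "E \<in> DAGs p"
  have "card E = card (\<Union>j\<in>{1..p}. (\<lambda>k. (k, j)) ` pa E j)" by (rule arg_cong[OF edges_by_target[OF E]])
  also have "\<dots> = (\<Sum>j\<in>{1..p}. card ((\<lambda>k. (k, j)) ` pa E j))"
    by (rule card_UN_disjoint) (use finite_pa[OF E] in auto)
  also have "\<dots> = (\<Sum>j\<in>{1..p}. card (pa E j))"
    by (intro sum.cong refl card_image) (auto simp: inj_on_def)
  finally show ?thesis .
qed

text \<open>Grouping the edges by their target splits the integrand into one block of coefficients
  per node, and the blocks integrate separately. The shrinkage factors of the nodes multiply up to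
  one factor per edge; the exponents add up to \<open>gprior_quadratic\<close>, which then passes
  through the integral over the variance.\<close>

lemma marg_lik_eq:
  assumes E: "E \<in> DAGs p" and g: "g > 0"
    and pd: "\<And>j. j \<in> {1..p} \<Longrightarrow> posdef_on (pa E j) (gram n x)"
    and w: "\<And>j k. j \<in> {1..p} \<Longrightarrow> k \<in> pa E j \<Longrightarrow> (\<Sum>l\<in>pa E j. gram n x k l * w j l) = gram n x k j"
    and Q: "gprior_quadratic g p n E x w > 0"
  shows "marg_lik g p n E x = (1 / sqrt (1 + g)) ^ card E *
     (1 / sqrt (gprior_quadratic g p n E x w)) ^ (n * p) * enn2real (scale_integral (n * p) 1)"
proof -
  interpret product_sigma_finite "\<lambda>_::nat \<times> nat. lborel :: real measure" by unfold_locales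
  define Qj where "Qj j = gram n x j j - g / (1 + g) * (\<Sum>k\<in>pa E j. gram n x k j * w j k)" for j
  define I where "I j = (\<lambda>k. (k, j)) ` pa E j" for j
  define f where "f \<theta> j b = gprior_dens g n x (pa E j) (\<lambda>k. b (k, j)) \<theta> *
      (\<Prod>i\<in>{1..n}. exp (- (x i j - (\<Sum>k\<in>pa E j. b (k, j) * x i k))\<^sup>2 / (2 * \<theta>)) / sqrt (2 * pi * \<theta>))" for \<theta> j and b :: "nat \<times> nat \<Rightarrow> real"
  have QQ: "gprior_quadratic g p n E x w = (\<Sum>j\<in>{1..p}. Qj j)"
    by (simp add: gprior_quadratic_def Qj_def)
  have inner: "(\<integral>\<^sup>+ b. ennreal ((\<Prod>j\<in>{1..p}. gprior_dens g n x (pa E j) (\<lambda>k. b (k, j)) \<theta>) * work_lik p n E x b \<theta>)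
           \<partial>(PiM E (\<lambda>_. lborel)))
     = ennreal ((1 / sqrt (1 + g)) ^ card E * ((1 / sqrt (2 * pi * \<theta>)) ^ (n * p) * exp (- gprior_quadratic g p n E x w / (2 * \<theta>))))"
    if th: "\<theta> > 0" for \<theta>
  proof -
    have nonneg: "f \<theta> j b \<ge> 0" if "j \<in> {1..p}" for j b
      using th posdef_det_pos[OF finite_pa[OF E] gram_sym pd[OF that]]
      by (auto simp: f_def gprior_dens_def intro!: mult_nonneg_nonneg prod_nonneg)
    have "(\<Prod>j\<in>{1..p}. gprior_dens g n x (pa E j) (\<lambda>k. b (k, j)) \<theta>) * work_lik p n E x b \<theta> = (\<Prod>j\<in>{1..p}. f \<theta> j b)" for b
      unfolding work_lik_def f_def prod.distrib by (subst prod.swap) (rule refl)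
    then have "(\<integral>\<^sup>+ b. ennreal ((\<Prod>j\<in>{1..p}. gprior_dens g n x (pa E j) (\<lambda>k. b (k, j)) \<theta>) * work_lik p n E x b \<theta>)
           \<partial>(PiM E (\<lambda>_. lborel))) = (\<integral>\<^sup>+ b. (\<Prod>j\<in>{1..p}. ennreal (f \<theta> j b)) \<partial>(PiM E (\<lambda>_. lborel)))"
      by (intro nn_integral_cong) (simp only: prod_ennreal nonneg)
    also have "\<dots> = (\<integral>\<^sup>+ b. (\<Prod>j\<in>{1..p}. ennreal (f \<theta> j b)) \<partial>(PiM (\<Union>j\<in>{1..p}. I j) (\<lambda>_. lborel)))"
      unfolding I_def edges_by_target[OF E, symmetric] ..
    also have "\<dots> = (\<Prod>j\<in>{1..p}. \<integral>\<^sup>+ b. ennreal (f \<theta> j b) \<partial>(PiM (I j) (\<lambda>_. lborel)))"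
    proof (rule nn_integral_prod_blocks)
      show "disjoint_family_on I {1..p}" by (auto simp: disjoint_family_on_def I_def)
      show "finite (I j)" for j using finite_pa[OF E] by (simp add: I_def)
      show "(\<lambda>b. ennreal (f \<theta> j b)) \<in> borel_measurable (PiM (I j) (\<lambda>_. lborel))" for j
      proof -
        have [measurable]: "k \<in> pa E j \<Longrightarrow> (\<lambda>b. b (k, j)) \<in> borel_measurable (PiM (I j) (\<lambda>_. lborel :: real measure))" for k
          by (rule borel_measurable_PiM_coord) (simp add: I_def)
        show ?thesis unfolding f_def gprior_dens_def by measurable
      qed
      show "ennreal (f \<theta> j b) = ennreal (f \<theta> j b')" if "\<And>i. i \<in> I j \<Longrightarrow> b i = b' i" for j b b'
      proof -
        have "b (k, j) = b' (k, j)" if "k \<in> pa E j" for k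
          using that \<open>\<And>i. i \<in> I j \<Longrightarrow> b i = b' i\<close> by (simp add: I_def)
        then show ?thesis unfolding f_def gprior_dens_def by (simp cong: sum.cong)
      qed
    qed simp
    also have "\<dots> = (\<Prod>j\<in>{1..p}. ennreal ((1 / sqrt (2 * pi * \<theta>)) ^ n * (1 / sqrt (1 + g)) ^ card (pa E j) * exp (- Qj j / (2 * \<theta>))))"
      unfolding f_def I_def Qj_def
      by (intro prod.cong refl nn_integral_gprior_likelihood finite_pa[OF E] pd g th w) (auto simp: inj_def)
    also have "\<dots> = ennreal (\<Prod>j\<in>{1..p}. (1 / sqrt (2 * pi * \<theta>)) ^ n * (1 / sqrt (1 + g)) ^ card (pa E j) * exp (- Qj j / (2 * \<theta>)))"
      using th g by (intro prod_ennreal) auto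
    also have "(\<Prod>j\<in>{1..p}. (1 / sqrt (2 * pi * \<theta>)) ^ n * (1 / sqrt (1 + g)) ^ card (pa E j) * exp (- Qj j / (2 * \<theta>)))
       = (1 / sqrt (1 + g)) ^ card E * ((1 / sqrt (2 * pi * \<theta>)) ^ (n * p) * exp (- gprior_quadratic g p n E x w / (2 * \<theta>)))"
    proof -
      have "(\<Prod>j\<in>{1..p}. exp (- Qj j / (2 * \<theta>))) = exp (- gprior_quadratic g p n E x w / (2 * \<theta>))"
        unfolding QQ by (simp add: exp_sum[symmetric] sum_negf sum_divide_distrib)
      moreover have "(\<Prod>j\<in>{1..p}. (1 / sqrt (1 + g)) ^ card (pa E j)) = (1 / sqrt (1 + g)) ^ card E"
        unfolding card_edges[OF E] by (rule power_sum[symmetric])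
      moreover have "(\<Prod>j\<in>{1..p}. (1 / sqrt (2 * pi * \<theta>)) ^ n) = (1 / sqrt (2 * pi * \<theta>)) ^ (n * p)"
        by (simp add: power_mult)
      ultimately show ?thesis by (simp only: prod.distrib mult_ac)
    qed
    finally show ?thesis .
  qed
  have "(\<integral>\<^sup>+ \<theta>. indicator {0<..} \<theta> * ennreal (1 / \<theta>) *
        (\<integral>\<^sup>+ b. ennreal ((\<Prod>j\<in>{1..p}. gprior_dens g n x (pa E j) (\<lambda>k. b (k, j)) \<theta>) * work_lik p n E x b \<theta>)
           \<partial>(PiM E (\<lambda>_. lborel))) \<partial>lborel)
     = (\<integral>\<^sup>+ \<theta>. ennreal ((1 / sqrt (1 + g)) ^ card E) * (indicator {0<..} \<theta> *
          ennreal (1 / \<theta> * (1 / sqrt (2 * pi * \<theta>)) ^ (n * p) * exp (- gprior_quadratic g p n E x w / (2 * \<theta>)))) \<partial>lborel)"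
  proof (rule nn_integral_cong)
    fix \<theta> :: real
    show "indicator {0<..} \<theta> * ennreal (1 / \<theta>) *
        (\<integral>\<^sup>+ b. ennreal ((\<Prod>j\<in>{1..p}. gprior_dens g n x (pa E j) (\<lambda>k. b (k, j)) \<theta>) * work_lik p n E x b \<theta>)
           \<partial>(PiM E (\<lambda>_. lborel)))
      = ennreal ((1 / sqrt (1 + g)) ^ card E) * (indicator {0<..} \<theta> *
          ennreal (1 / \<theta> * (1 / sqrt (2 * pi * \<theta>)) ^ (n * p) * exp (- gprior_quadratic g p n E x w / (2 * \<theta>))))"
    proof (cases "\<theta> > 0")
      case True
      have "ennreal (1 / \<theta>) * ennreal (a * (b * c)) = ennreal a * ennreal (1 / \<theta> * b * c)"
        if "a \<ge> 0" "b \<ge> 0" "c \<ge> 0" for a b c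
        using that True by (simp add: ennreal_mult'[symmetric] mult_ac)
      then show ?thesis unfolding inner[OF True] using True g by simp
    qed simp
  qed
  also have "\<dots> = ennreal ((1 / sqrt (1 + g)) ^ card E) * scale_integral (n * p) (gprior_quadratic g p n E x w)"
    unfolding scale_integral_def by (rule nn_integral_cmult) simp
  also have "\<dots> = ennreal ((1 / sqrt (1 + g)) ^ card E) * (ennreal ((1 / sqrt (gprior_quadratic g p n E x w)) ^ (n * p)) * scale_integral (n * p) 1)"
    by (simp add: scale_integral_scaling[OF Q])
  finally show ?thesis using g Q
    by (simp add: marg_lik_def enn2real_mult)
qed

(* As a measurability rule, its higher-order pattern matches far too many goals. *)
declare borel_measurable_PiM_coord [measurable del]

section \<open>Least squares and identifiability\<close>

text \<open>An infimum, in the same form as the summands of \<open>resid_risk\<close>, so that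
  sample and population versions can be compared term by term and bounds uniform in the coefficients
  carry over. Solutions of \<open>normal_eq\<close> attain it.\<close>

definition lsq :: "nat \<Rightarrow> (nat \<Rightarrow> nat \<Rightarrow> real) \<Rightarrow> nat set \<Rightarrow> nat \<Rightarrow> real" where
  "lsq n x S j = (INF b\<in>(UNIV :: (nat \<Rightarrow> real) set). rss n x S j b)"

lemma rss_nonneg: "rss n x S j b \<ge> 0"
  unfolding rss_def by (intro sum_nonneg) simp

lemma lsq_le: "lsq n x S j \<le> rss n x S j b"
  unfolding lsq_def by (rule cINF_lower) (auto intro!: bdd_belowI2[where m = 0] rss_nonneg)

definition normal_eq :: "nat \<Rightarrow> (nat \<Rightarrow> nat \<Rightarrow> real) \<Rightarrow> nat set \<Rightarrow> nat \<Rightarrow> (nat \<Rightarrow> real) \<Rightarrow> bool" where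
  "normal_eq n x S j w \<longleftrightarrow> (\<forall>k\<in>S. (\<Sum>l\<in>S. gram n x k l * w l) = gram n x k j)"

text \<open>Pythagoras: the normal equations make the residual at \<open>w\<close> orthogonal to all
  regressors, so moving to \<open>b\<close> adds the squared length of the fitted
  difference.\<close>

lemma rss_around_minimizer:
  assumes w: "normal_eq n x S j w"
  shows "rss n x S j b = gram n x j j - (\<Sum>k\<in>S. gram n x k j * w k) + (\<Sum>i\<in>{1..n}. (\<Sum>k\<in>S. (b k - w k) * x i k)\<^sup>2)"
proof -
  let ?G = "gram n x"
  have cross: "(\<Sum>k\<in>S. \<Sum>l\<in>S. ?G k l * c k * w l) = (\<Sum>k\<in>S. ?G k j * c k)" for c
  proof -
    have "(\<Sum>k\<in>S. \<Sum>l\<in>S. ?G k l * c k * w l) = (\<Sum>k\<in>S. (\<Sum>l\<in>S. ?G k l * w l) * c k)"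
      unfolding sum_distrib_right by (simp add: mult_ac)
    then show ?thesis using w by (simp add: normal_eq_def)
  qed
  have cross': "(\<Sum>k\<in>S. \<Sum>l\<in>S. ?G k l * w k * c l) = (\<Sum>k\<in>S. ?G k j * c k)" for c
    unfolding cross[symmetric] by (subst sum.swap) (simp add: gram_sym[of n x] mult_ac)
  have "(\<Sum>i\<in>{1..n}. (\<Sum>k\<in>S. (b k - w k) * x i k)\<^sup>2)
      = (\<Sum>k\<in>S. \<Sum>l\<in>S. ?G k l * (b k - w k) * (b l - w l))"
    by (rule gram_quadratic_form[symmetric])
  also have "\<dots> = (\<Sum>k\<in>S. \<Sum>l\<in>S. ?G k l * b k * b l) - (\<Sum>k\<in>S. \<Sum>l\<in>S. ?G k l * b k * w l)
     - (\<Sum>k\<in>S. \<Sum>l\<in>S. ?G k l * w k * b l) + (\<Sum>k\<in>S. \<Sum>l\<in>S. ?G k l * w k * w l)"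
    by (simp add: algebra_simps sum.distrib sum_subtractf)
  finally show ?thesis unfolding rss_expand cross cross' by simp
qed

lemma lsq_eq:
  assumes w: "normal_eq n x S j w"
  shows "lsq n x S j = gram n x j j - (\<Sum>k\<in>S. gram n x k j * w k)" (is "_ = ?d")
    and "rss n x S j w = lsq n x S j"
proof -
  have r: "rss n x S j w = ?d" unfolding rss_around_minimizer[OF w] by simp
  have "?d \<le> lsq n x S j" unfolding lsq_def
  proof (rule cINF_greatest)
    show "?d \<le> rss n x S j b" for b
      unfolding rss_around_minimizer[OF w, where b = b] by (simp add: sum_nonneg)
  qed simp
  with lsq_le[of n x S j w] r show "lsq n x S j = ?d" by simp
  with r show "rss n x S j w = lsq n x S j" by simp
qed

lemma normal_equations_solvable:
  assumes "finite S" "posdef_on S (gram n x)"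
  obtains w where "normal_eq n x S j w"
  using posdef_solvable[OF assms(1) gram_sym assms(2), of "\<lambda>k. gram n x k j"]
  unfolding normal_eq_def by blast

lemma rss_extend:
  assumes "S \<subseteq> T" "finite T"
  shows "rss n x T j (\<lambda>k. if k \<in> S then b k else 0) = rss n x S j b"
proof -
  have "(\<Sum>k\<in>T. (if k \<in> S then b k else 0) * x i k) = (\<Sum>k\<in>S. b k * x i k)" for i
  proof -
    have "(\<Sum>k\<in>T. (if k \<in> S then b k else 0) * x i k) = (\<Sum>k\<in>S. (if k \<in> S then b k else 0) * x i k)"
      by (rule sum.mono_neutral_right) (use assms in auto)
    then show ?thesis by simp
  qed
  then show ?thesis by (simp add: rss_def)
qed

lemma lsq_antimono: "S \<subseteq> T \<Longrightarrow> finite T \<Longrightarrow> lsq n x T j \<le> lsq n x S j"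
  unfolding lsq_def[of n x S] using lsq_le[of n x T j] rss_extend[of S T n x j]
  by (intro cINF_greatest) (simp, metis)

lemma lsq_pos:
  assumes "finite S" "j \<notin> S" "posdef_on (insert j S) (gram n x)"
  shows "lsq n x S j > 0"
proof -
  have pd: "posdef_on S (gram n x)" by (rule posdef_on_subset[OF assms(3)]) (use assms(1) in auto)
  obtain w where w: "normal_eq n x S j w"
    using normal_equations_solvable[OF assms(1) pd] .
  show ?thesis unfolding lsq_eq(1)[OF w] using w
    by (intro schur_pos[OF assms(1,2) gram_sym assms(3)]) (simp add: normal_eq_def)
qed

text \<open>A Gram determinant is base times squared height: the minimal residual sum of squares is
  the Schur complement of the added index.\<close>

lemma det_on_gram_insert:
  assumes "finite S" "j \<notin> S" "posdef_on (insert j S) (gram n x)"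
  shows "det_on (insert j S) (gram n x) = lsq n x S j * det_on S (gram n x)"
proof -
  have pd: "posdef_on S (gram n x)" by (rule posdef_on_subset[OF assms(3)]) (use assms(1) in auto)
  obtain w where w: "normal_eq n x S j w"
    using normal_equations_solvable[OF assms(1) pd] .
  show ?thesis unfolding lsq_eq(1)[OF w] using w
    by (intro det_on_schur[OF assms(1,2) gram_sym]) (simp add: normal_eq_def)
qed

text \<open>Formulated with reachability instead of single edges because \<open>V\<close> is
  arbitrary: in \<open>L_independent\<close> it is the support of a coefficient vector, and a path
  between two of its members may leave it.\<close>

lemma acyclic_has_sink:
  assumes "acyclic E" "finite E" "V \<noteq> {}"
  shows "\<exists>t\<in>V. \<forall>c\<in>V. (t, c) \<notin> E\<^sup>+"
proof -
  have "wf (E\<inverse>)" using assms(1,2) by (simp add: finite_acyclic_wf_converse)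
  then have "wf ((E\<^sup>+)\<inverse>)" using wf_trancl[of "E\<inverse>"] by (simp add: trancl_converse)
  then obtain t where "t \<in> V" "\<forall>c. (c, t) \<in> (E\<^sup>+)\<inverse> \<longrightarrow> c \<notin> V"
    using assms(3) unfolding wf_eq_minimal by (metis ex_in_conv)
  then show ?thesis by blast
qed

lemma DAGs_finite: "E \<in> DAGs p \<Longrightarrow> finite E"
  by (auto simp: DAGs_def intro: finite_subset)

lemma DAGs_acyclic: "E \<in> DAGs p \<Longrightarrow> acyclic E"
  by (simp add: DAGs_def)

lemma not_in_pa_self: "E \<in> DAGs p \<Longrightarrow> j \<notin> pa E j"
  by (auto simp: DAGs_def pa_def acyclic_def)

text \<open>Regressing on the parents instead of on all predecessors can only increase the residual.\<close>

lemma det_on_le_prod_lsq: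
  assumes E: "E \<in> DAGs p" and "V \<subseteq> {1..p}" "\<And>j. j \<in> V \<Longrightarrow> pa E j \<subseteq> V"
    and "posdef_on {1..p} (gram n x)"
  shows "det_on V (gram n x) \<le> (\<Prod>j\<in>V. lsq n x (pa E j) j)"
  using assms(2,3)
proof (induction "card V" arbitrary: V)
  case 0
  then have "V = {}" using finite_subset by fastforce
  then show ?case by (simp add: det_on_def)
next
  case (Suc m V)
  have fV: "finite V" using Suc.prems(1) finite_subset by blast
  have "V \<noteq> {}" using Suc.hyps(2) by auto
  from acyclic_has_sink[OF DAGs_acyclic[OF E] DAGs_finite[OF E] this]
  obtain t where t: "t \<in> V" "\<And>c. c \<in> V \<Longrightarrow> (t, c) \<notin> E\<^sup>+" by blast
  let ?S = "V - {t}"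
  have V: "V = insert t ?S" using t(1) by auto
  have pdV: "posdef_on V (gram n x)" by (rule posdef_on_subset[OF assms(4) Suc.prems(1)]) simp
  have pdS: "posdef_on ?S (gram n x)" by (rule posdef_on_subset[OF pdV]) (use fV in auto)
  have cl: "pa E j \<subseteq> ?S" if "j \<in> V" for j
    using Suc.prems(2)[OF that] t(2)[OF that] by (auto simp: pa_def)
  have IH: "det_on ?S (gram n x) \<le> (\<Prod>j\<in>?S. lsq n x (pa E j) j)"
    using Suc.hyps(2) fV t(1) Suc.prems(1) cl by (intro Suc.hyps(1)) auto
  have "det_on V (gram n x) = lsq n x ?S t * det_on ?S (gram n x)"
    using det_on_gram_insert[of ?S t n x] fV pdV V by simp
  also have "\<dots> \<le> lsq n x (pa E t) t * (\<Prod>j\<in>?S. lsq n x (pa E j) j)"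
  proof (rule mult_mono)
    show "lsq n x ?S t \<le> lsq n x (pa E t) t" using cl[OF t(1)] fV by (intro lsq_antimono) auto
    then show "0 \<le> lsq n x (pa E t) t" using lsq_pos[of ?S t n x] pdV fV V by simp
    show "0 \<le> det_on ?S (gram n x)"
      using posdef_det_pos[OF _ gram_sym pdS] fV by (simp add: less_imp_le)
  qed (rule IH)
  also have "\<dots> = (\<Prod>j\<in>V. lsq n x (pa E j) j)" using fV t(1) by (simp add: prod.remove)
  finally show ?case .
qed

section \<open>Population geometry of the true model and identifiability of its graph\<close>

locale linear_sem =
  fixes p :: nat and Gs :: graph and \<beta> :: "nat \<times> nat \<Rightarrow> real"
  assumes DAG: "Gs \<in> DAGs p"
begin

text \<open>\<open>L k a\<close> is the total effect of the noise at node \<open>a\<close> on the variable at node \<open>k\<close>.\<close>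

definition L :: "nat \<Rightarrow> nat \<Rightarrow> real" where
  "L = wfrec Gs (\<lambda>f k a. (if k = a then 1 else 0) + (\<Sum>l\<in>pa Gs k. \<beta> (l, k) * f l a))"

lemma wf_Gs: "wf Gs"
  using DAGs_finite[OF DAG] DAGs_acyclic[OF DAG] by (simp add: finite_acyclic_wf)

text \<open>The functional consults its argument only at parents, which precede the node in the
  well-founded relation given by a finite acyclic graph.\<close>

lemma L_rec: "L k a = (if k = a then 1 else 0) + (\<Sum>l\<in>pa Gs k. \<beta> (l, k) * L l a)"
proof -
  have "adm_wf Gs (\<lambda>f k a. (if k = a then 1 else 0) + (\<Sum>l\<in>pa Gs k. \<beta> (l, k) * f l a :: real))"
    unfolding adm_wf_def by (auto simp: pa_def intro!: ext sum.cong)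
  from wfrec_fixpoint[OF wf_Gs this] show ?thesis
    unfolding L_def[symmetric] by (metis (no_types, lifting))
qed

lemma L_support: "L k a \<noteq> 0 \<Longrightarrow> (a, k) \<in> Gs\<^sup>*"
proof (induction k rule: wf_induct_rule[OF wf_Gs])
  case (1 k)
  show ?case
  proof (cases "k = a")
    case False
    then have "(\<Sum>l\<in>pa Gs k. \<beta> (l, k) * L l a) \<noteq> 0" using 1(2) L_rec[of k a] by simp
    then obtain l where "l \<in> pa Gs k" "\<beta> (l, k) * L l a \<noteq> 0"
      by (rule sum.not_neutral_contains_not_neutral)
    then show ?thesis using 1(1)[of l] by (auto simp: pa_def)
  qed simp
qed

lemma L_zero: "k \<noteq> a \<Longrightarrow> (a, k) \<notin> Gs\<^sup>+ \<Longrightarrow> L k a = 0"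
  using L_support[of k a] by (auto simp: rtrancl_eq_or_trancl)

lemma L_diag: "L k k = 1"
proof -
  have "L l k = 0" if "l \<in> pa Gs k" for l
  proof (rule ccontr)
    assume "L l k \<noteq> 0"
    then have "(k, l) \<in> Gs\<^sup>*" by (rule L_support)
    moreover have "(l, k) \<in> Gs" using that by (simp add: pa_def)
    ultimately have "(k, k) \<in> Gs\<^sup>+" by (rule rtrancl_into_trancl1)
    then show False using DAGs_acyclic[OF DAG] by (simp add: acyclic_def)
  qed
  then show ?thesis using L_rec[of k k] by simp
qed

lemma L_solution:
  assumes "\<And>k. k \<in> {1..p} \<Longrightarrow> x k = (\<Sum>l\<in>pa Gs k. \<beta> (l, k) * x l) + e k"
  shows "k \<in> {1..p} \<Longrightarrow> x k = (\<Sum>a\<in>{1..p}. L k a * e a)"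
proof (induction k rule: wf_induct_rule[OF wf_Gs])
  case (1 k)
  have "(\<Sum>l\<in>pa Gs k. \<beta> (l, k) * x l) = (\<Sum>l\<in>pa Gs k. \<beta> (l, k) * (\<Sum>a\<in>{1..p}. L l a * e a))"
    using 1(1) pa_subset[OF DAG, of k] by (intro sum.cong refl) (auto simp: pa_def)
  also have "\<dots> = (\<Sum>a\<in>{1..p}. (\<Sum>l\<in>pa Gs k. \<beta> (l, k) * L l a) * e a)"
    unfolding sum_distrib_left sum_distrib_right by (subst sum.swap) (simp add: mult_ac)
  finally have "x k = (\<Sum>a\<in>{1..p}. (\<Sum>l\<in>pa Gs k. \<beta> (l, k) * L l a) * e a) + (\<Sum>a\<in>{1..p}. (if k = a then 1 else 0) * e a)"
    using assms[OF 1(2)] 1(2) by (simp add: if_distrib[of "\<lambda>c. c * _"] cong: if_cong)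
  also have "\<dots> = (\<Sum>a\<in>{1..p}. L k a * e a)"
    unfolding L_rec[of k] by (simp add: sum.distrib[symmetric] algebra_simps)
  finally show ?case .
qed

text \<open>The rows of \<open>y\<close> play the role of \<open>p\<close> observations: \<open>gram p y\<close> is the covariance matrix
  of the model with unit noise variance, so \<open>lsq p y\<close> gives population residual variances.\<close>

abbreviation y :: "nat \<Rightarrow> nat \<Rightarrow> real" where "y \<equiv> \<lambda>a k. L k a"

text \<open>Unit triangularity: pick a node \<open>t\<close> in the support of \<open>b\<close> from
  which no other node of the support is reached. The noise at \<open>t\<close> then enters the
  combination through \<open>t\<close> alone, with coefficient \<open>b t\<close>.\<close>

lemma L_independent:
  assumes "S \<subseteq> {1..p}" "k \<in> S" "b k \<noteq> 0"
  shows "\<exists>a\<in>{1..p}. (\<Sum>k\<in>S. b k * L k a) \<noteq> 0"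
proof -
  have "{k \<in> S. b k \<noteq> 0} \<noteq> {}" using assms by auto
  from acyclic_has_sink[OF DAGs_acyclic[OF DAG] DAGs_finite[OF DAG] this]
  obtain t where t: "t \<in> S" "b t \<noteq> 0" "\<forall>c\<in>{k \<in> S. b k \<noteq> 0}. (t, c) \<notin> Gs\<^sup>+" by blast
  have fin: "finite S" using assms(1) finite_subset by blast
  have "(\<Sum>k\<in>S. b k * L k t) = (\<Sum>k\<in>S. if k = t then b t else 0)"
    by (rule sum.cong) (use t(3) L_zero L_diag in auto)
  also have "\<dots> = b t" using t(1) fin by simp
  finally show ?thesis using t(1,2) assms(1) by (intro bexI[of _ t]) auto
qed

lemma posdef_y: "posdef_on {1..p} (gram p y)"
  unfolding posdef_on_def gram_quadratic_form
proof (intro allI impI)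
  fix b :: "nat \<Rightarrow> real" assume "\<exists>k\<in>{1..p}. b k \<noteq> 0"
  then obtain a where "a \<in> {1..p}" "(\<Sum>k\<in>{1..p}. b k * L k a) \<noteq> 0"
    using L_independent[of "{1..p}" _ b] by blast
  then show "0 < (\<Sum>i\<in>{1..p}. (\<Sum>k\<in>{1..p}. b k * L k i)\<^sup>2)"
    by (intro sum_pos2[of _ a]) auto
qed

text \<open>The noise at a node without descendants in \<open>V\<close> is orthogonal to all other
  variables of \<open>V\<close>. Hence the structural coefficients solve the normal equations on
  \<open>V - {t}\<close>, and the residual is that noise, of unit variance.\<close>

lemma sink_regression:
  assumes "V \<subseteq> {1..p}" "t \<in> V" "pa Gs t \<subseteq> V" "\<forall>c\<in>V. (t, c) \<notin> Gs\<^sup>+"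
  shows "normal_eq p y (V - {t}) t (\<lambda>l. if l \<in> pa Gs t then \<beta> (l, t) else 0)"
    and "lsq p y (V - {t}) t = 1"
proof -
  let ?S = "V - {t}" and ?w = "\<lambda>l. if l \<in> pa Gs t then \<beta> (l, t) else 0"
  have fin: "finite V" using assms(1) finite_subset by blast
  have resid: "(\<Sum>l\<in>?S. ?w l * L l a) = L t a - (if t = a then 1 else 0)" for a
  proof -
    have "(\<Sum>l\<in>?S. ?w l * L l a) = (\<Sum>l\<in>pa Gs t. ?w l * L l a)"
      by (rule sum.mono_neutral_right) (use fin assms(3) not_in_pa_self[OF DAG] in auto)
    then show ?thesis unfolding L_rec[of t a] by simp
  qed
  have dot: "(\<Sum>l\<in>?S. gram p y k l * ?w l) = gram p y k t - L k t" if "k \<in> V" for k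
  proof -
    have "(\<Sum>l\<in>?S. gram p y k l * ?w l) = (\<Sum>a\<in>{1..p}. L k a * (\<Sum>l\<in>?S. ?w l * L l a))"
      unfolding gram_def sum_distrib_left sum_distrib_right by (subst sum.swap) (simp add: mult_ac)
    also have "\<dots> = gram p y k t - (\<Sum>a\<in>{1..p}. if a = t then L k a else 0)"
      unfolding resid gram_def sum_subtractf[symmetric] by (intro sum.cong refl) (simp add: algebra_simps)
    also have "(\<Sum>a\<in>{1..p}. if a = t then L k a else 0) = L k t"
      using assms(1,2) by (subst sum.delta) auto
    finally show ?thesis .
  qed
  show w: "normal_eq p y ?S t ?w"
    unfolding normal_eq_def using dot L_zero assms(4) by auto
  show "lsq p y ?S t = 1"
  proof -
    have "(\<Sum>l\<in>?S. gram p y l t * ?w l) = (\<Sum>l\<in>?S. gram p y t l * ?w l)"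
      by (intro sum.cong refl arg_cong2[where f = "(*)"] gram_sym)
    also have "\<dots> = gram p y t t - 1" using dot[OF assms(2)] by (simp only: L_diag)
    finally show ?thesis unfolding lsq_eq(1)[OF w] by simp
  qed
qed

text \<open>Removing a sink of the true graph keeps the set closed under parents and divides the
  determinant by the residual variance of the sink, which is 1.\<close>

lemma det_y:
  assumes "V \<subseteq> {1..p}" "\<And>j. j \<in> V \<Longrightarrow> pa Gs j \<subseteq> V"
  shows "det_on V (gram p y) = 1"
  using assms
proof (induction "card V" arbitrary: V)
  case 0
  then have "V = {}" using finite_subset by fastforce
  then show ?case by (simp add: det_on_def)
next
  case (Suc m V)
  have fV: "finite V" using Suc.prems(1) finite_subset by blast
  have "V \<noteq> {}" using Suc.hyps(2) by auto
  from acyclic_has_sink[OF DAGs_acyclic[OF DAG] DAGs_finite[OF DAG] this]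
  obtain t where t: "t \<in> V" "\<And>c. c \<in> V \<Longrightarrow> (t, c) \<notin> Gs\<^sup>+" by blast
  let ?S = "V - {t}"
  have V: "V = insert t ?S" using t(1) by auto
  have pdV: "posdef_on V (gram p y)" by (rule posdef_on_subset[OF posdef_y Suc.prems(1)]) simp
  have cl: "pa Gs j \<subseteq> ?S" if "j \<in> V" for j
    using Suc.prems(2)[OF that] t(2)[OF that] by (auto simp: pa_def)
  have "det_on ?S (gram p y) = 1"
    using Suc.hyps(2) fV t(1) Suc.prems(1) cl by (intro Suc.hyps(1)) auto
  moreover have "lsq p y ?S t = 1"
    using sink_regression(2)[OF Suc.prems(1) t(1) Suc.prems(2)[OF t(1)]] t(2) by blast
  ultimately show ?case
    using det_on_gram_insert[of ?S t p y] fV pdV V by simp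
qed

text \<open>The noise at a child \<open>c\<close> carries information on the variable at \<open>t\<close>: the combination
  \<open>e\<^sub>t - \<beta> (t, c) e\<^sub>c\<close> of the noise vectors yields the predictor below.\<close>

lemma lsq_lt_if_child:
  assumes "V \<subseteq> {1..p}" "pa Gs t \<subseteq> V" "pa Gs c \<subseteq> V" "t \<in> V" "c \<in> V" "(t, c) \<in> Gs" "\<beta> (t, c) \<noteq> 0"
  shows "lsq p y (V - {t}) t < 1"
proof -
  let ?S = "V - {t}" and ?\<beta> = "\<beta> (t, c)"
  \<comment> \<open>Written in the observed variables, the combination contains the variable at
    \<open>t\<close> with coefficient \<open>q\<close>: 1 from its own equation and the square from
    the equation of \<open>c\<close>. After division by \<open>q\<close> the residual has variance
    \<open>q / q\<^sup>2\<close>, less than 1.\<close>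
  define q where "q = 1 + ?\<beta>\<^sup>2"
  have q: "q > 1" using assms(7) by (simp add: q_def)
  define b where "b k = ((if k \<in> pa Gs t then \<beta> (k, t) else 0) + (if k = c then ?\<beta> else 0)
      - ?\<beta> * (if k \<in> pa Gs c - {t} then \<beta> (k, c) else 0)) / q" for k
  have fin: "finite V" using assms(1) finite_subset by blast
  have tc: "t \<noteq> c" using assms(6) not_in_pa_self[OF DAG, of c] by (auto simp: pa_def)
  have resid: "L t a - (\<Sum>k\<in>?S. b k * L k a) = ((if t = a then 1 else 0) - ?\<beta> * (if c = a then 1 else 0)) / q" for a
  proof -
    have 1: "(\<Sum>k\<in>?S. (if k \<in> pa Gs t then \<beta> (k, t) else 0) * L k a) = L t a - (if t = a then 1 else 0)"
    proof -
      have "(\<Sum>k\<in>?S. (if k \<in> pa Gs t then \<beta> (k, t) else 0) * L k a) = (\<Sum>k\<in>pa Gs t. (if k \<in> pa Gs t then \<beta> (k, t) else 0) * L k a)"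
        by (rule sum.mono_neutral_right) (use fin assms(2) not_in_pa_self[OF DAG] in auto)
      then show ?thesis unfolding L_rec[of t a] by simp
    qed
    have 2: "(\<Sum>k\<in>?S. (if k = c then ?\<beta> else 0) * L k a) = ?\<beta> * L c a"
    proof -
      have "(\<Sum>k\<in>?S. (if k = c then ?\<beta> else 0) * L k a) = (\<Sum>k\<in>?S. if k = c then ?\<beta> * L c a else 0)"
        by (rule sum.cong) auto
      then show ?thesis using fin tc assms(5) by simp
    qed
    have 3: "(\<Sum>k\<in>?S. (if k \<in> pa Gs c - {t} then \<beta> (k, c) else 0) * L k a) = L c a - (if c = a then 1 else 0) - ?\<beta> * L t a"
    proof -
      have "(\<Sum>k\<in>?S. (if k \<in> pa Gs c - {t} then \<beta> (k, c) else 0) * L k a) = (\<Sum>k\<in>pa Gs c - {t}. (if k \<in> pa Gs c - {t} then \<beta> (k, c) else 0) * L k a)"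
        by (rule sum.mono_neutral_right) (use fin assms(3) in auto)
      also have "\<dots> = (\<Sum>k\<in>pa Gs c. \<beta> (k, c) * L k a) - ?\<beta> * L t a"
        using finite_pa[OF DAG, of c] assms(6) by (simp add: sum_diff1 pa_def)
      finally show ?thesis unfolding L_rec[of c a] by simp
    qed
    have "(\<Sum>k\<in>?S. b k * L k a) = ((\<Sum>k\<in>?S. (if k \<in> pa Gs t then \<beta> (k, t) else 0) * L k a)
       + (\<Sum>k\<in>?S. (if k = c then ?\<beta> else 0) * L k a)
       - ?\<beta> * (\<Sum>k\<in>?S. (if k \<in> pa Gs c - {t} then \<beta> (k, c) else 0) * L k a)) / q"
      unfolding sum_distrib_left sum.distrib[symmetric] sum_subtractf[symmetric] sum_divide_distrib
      by (intro sum.cong refl) (simp only: b_def left_diff_distrib distrib_right times_divide_eq_left mult.assoc)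
    also have "\<dots> = (q * L t a - (if t = a then 1 else 0) + ?\<beta> * (if c = a then 1 else 0)) / q"
    proof -
      have "(x - d) + ?\<beta> * z - ?\<beta> * (z - e - ?\<beta> * x) = (1 + ?\<beta>\<^sup>2) * x - d + ?\<beta> * e" for x d z e
        by (simp add: power2_eq_square algebra_simps)
      then show ?thesis unfolding 1 2 3 q_def by (simp only:)
    qed
    also have "\<dots> = L t a - ((if t = a then 1 else 0) - ?\<beta> * (if c = a then 1 else 0)) / q"
      using q by (simp add: diff_divide_distrib add_divide_distrib)
    finally show ?thesis by simp
  qed
  have "rss p y ?S t b = (\<Sum>a\<in>{1..p}. (if a = t then 1 / q\<^sup>2 else 0) + (if a = c then ?\<beta>\<^sup>2 / q\<^sup>2 else 0))"
    unfolding rss_def resid by (intro sum.cong refl) (use tc in \<open>auto simp: power_divide\<close>)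
  also have "\<dots> = 1 / q\<^sup>2 + ?\<beta>\<^sup>2 / q\<^sup>2"
    using assms(1,4,5) by (subst sum.distrib) (auto simp: sum.delta)
  also have "\<dots> = q / q\<^sup>2" by (simp add: q_def add_divide_distrib)
  also have "\<dots> < 1" using q by (simp add: power2_eq_square)
  finally show ?thesis using lsq_le[of p y ?S t b] by simp
qed

lemma lsq_y_pos: "E \<in> DAGs p \<Longrightarrow> j \<in> {1..p} \<Longrightarrow> lsq p y (pa E j) j > 0"
  using posdef_on_subset[OF posdef_y, of "insert j (pa E j)"] pa_subset[of E p j]
  by (intro lsq_pos finite_pa not_in_pa_self) auto

text \<open>A sink \<open>t\<close> of \<open>E\<close> is removed. The determinant on
  \<open>V\<close> is 1 and equals the residual of \<open>t\<close> given all of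
  \<open>V - {t}\<close> times the determinant on \<open>V - {t}\<close>; the latter is at most the
  product of the remaining residuals along \<open>E\<close>, hence at most 1. So the residual of
  \<open>t\<close> is at least 1, and by \<open>lsq_lt_if_child\<close> the node has no true child
  in \<open>V\<close>. It is thus a sink of both graphs, and \<open>V - {t}\<close> remains closed
  under both kinds of parents.\<close>

lemma parents_identified:
  assumes nz: "\<forall>e\<in>Gs. \<beta> e \<noteq> 0" and E: "E \<in> DAGs p"
    and "V \<subseteq> {1..p}" "\<And>j. j \<in> V \<Longrightarrow> pa Gs j \<subseteq> V" "\<And>j. j \<in> V \<Longrightarrow> pa E j \<subseteq> V"
    and "\<And>j. j \<in> V \<Longrightarrow> lsq p y (pa E j) j \<le> 1"
  shows "j \<in> V \<Longrightarrow> pa Gs j \<subseteq> pa E j"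
  using assms(3-)
proof (induction "card V" arbitrary: V j)
  case 0
  then show ?case using finite_subset by fastforce
next
  case (Suc m V)
  note sub = Suc.prems(2) and clG = Suc.prems(3) and clE = Suc.prems(4) and le1 = Suc.prems(5)
  have fV: "finite V" using sub finite_subset by blast
  have "V \<noteq> {}" using Suc.hyps(2) by auto
  from acyclic_has_sink[OF DAGs_acyclic[OF E] DAGs_finite[OF E] this]
  obtain t where t: "t \<in> V" "\<And>c. c \<in> V \<Longrightarrow> (t, c) \<notin> E\<^sup>+" by blast
  let ?S = "V - {t}"
  have V: "V = insert t ?S" using t(1) by auto
  have pdV: "posdef_on V (gram p y)" by (rule posdef_on_subset[OF posdef_y sub]) simp
  have pdS: "posdef_on ?S (gram p y)" by (rule posdef_on_subset[OF pdV]) (use fV in auto)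
  have clES: "pa E j \<subseteq> ?S" if "j \<in> V" for j
    using clE[OF that] t(2)[OF that] by (auto simp: pa_def)
  have "1 = lsq p y ?S t * det_on ?S (gram p y)"
    using det_on_gram_insert[of ?S t p y] det_y[OF sub clG] fV pdV V by simp
  also have "\<dots> \<le> lsq p y ?S t * 1"
  proof (rule mult_left_mono)
    have "det_on ?S (gram p y) \<le> (\<Prod>j\<in>?S. lsq p y (pa E j) j)"
      using sub clES by (intro det_on_le_prod_lsq[OF E _ _ posdef_y]) auto
    also have "\<dots> \<le> 1"
      using lsq_y_pos[OF E] sub le1 by (intro prod_le_1) (auto simp: less_imp_le subset_iff)
    finally show "det_on ?S (gram p y) \<le> 1" .
    show "0 \<le> lsq p y ?S t" using lsq_pos[of ?S t p y] fV pdV V by simp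
  qed
  finally have ge1: "lsq p y ?S t \<ge> 1" by simp
  have nochild: "(t, c) \<notin> Gs" if "c \<in> V" for c
    using lsq_lt_if_child[OF sub clG[OF t(1)] clG[OF that] t(1) that] ge1 nz by force
  have nodesc: "(t, c) \<notin> Gs\<^sup>+" if "c \<in> V" for c
  proof
    assume "(t, c) \<in> Gs\<^sup>+"
    then show False using that
    proof (induction rule: trancl_induct)
      case (base c) then show ?case using nochild by blast
    next
      case (step c d) then show ?case using clG[of d] by (auto simp: pa_def)
    qed
  qed
  have clGS: "pa Gs j \<subseteq> ?S" if "j \<in> V" for j
    using clG[OF that] nochild[OF that] by (auto simp: pa_def)
  show ?case
  proof (cases "j = t")
    case False
    show ?thesis
    proof (rule Suc.hyps(1)[of ?S])
      show "m = card ?S" using Suc.hyps(2) fV t(1) by simp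
    qed (use False Suc.prems clES clGS in auto)
  next
    case True
    let ?w = "\<lambda>l. if l \<in> pa Gs t then \<beta> (l, t) else 0"
    have "\<forall>c\<in>V. (t, c) \<notin> Gs\<^sup>+" using nodesc by blast
    note reg = sink_regression[OF sub t(1) clG[OF t(1)] this]
    have "posdef_on (pa E t) (gram p y)" by (rule posdef_on_subset[OF posdef_y pa_subset[OF E]]) simp
    from normal_equations_solvable[OF finite_pa[OF E] this, where j = t]
    obtain b where b: "normal_eq p y (pa E t) t b" by blast
    \<comment> \<open>Padded with zeros, the regression on \<open>pa E t\<close> has residual at
      most 1, the minimum over all regressors in \<open>V - {t}\<close>. Positive definiteness makes
      the minimiser unique, so \<open>b'\<close> agrees with the structural coefficients, and these
      are nonzero at the true parents.\<close>
    define b' where "b' k = (if k \<in> pa E t then b k else 0)" for k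
    have "rss p y ?S t b' = lsq p y (pa E t) t"
      unfolding b'_def using rss_extend[of "pa E t" ?S] clES[OF t(1)] fV lsq_eq(2)[OF b] by simp
    also have "\<dots> \<le> 1" using le1[OF t(1)] .
    finally have "(\<Sum>i\<in>{1..p}. (\<Sum>k\<in>?S. (b' k - ?w k) * L k i)\<^sup>2) \<le> 0"
      using reg(2) unfolding rss_around_minimizer[OF reg(1)] lsq_eq(1)[OF reg(1)] by simp
    then have zero: "\<not> (\<exists>k\<in>?S. b' k - ?w k \<noteq> 0)"
      using pdS[unfolded posdef_on_def gram_quadratic_form, rule_format, of "\<lambda>k. b' k - ?w k"] by fastforce
    have eq: "b' k = ?w k" if "k \<in> ?S" for k
    proof (rule ccontr)
      assume "b' k \<noteq> ?w k"
      then have "b' k - ?w k \<noteq> 0" by simp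
      with zero that show False by blast
    qed
    show ?thesis
    proof
      fix k assume k: "k \<in> pa Gs j"
      then have "?w k \<noteq> 0" using True nz by (auto simp: pa_def)
      moreover have "k \<in> ?S" using clGS[OF t(1)] k True by auto
      ultimately show "k \<in> pa E j" using eq[of k] True by (auto simp: b'_def split: if_splits)
    qed
  qed
qed

text \<open>Since the product of the residual variances along a DAG is at least 1, so is their mean
  (by \<open>ln r \<le> r - 1\<close>), and equality forces all of them to be 1.\<close>

lemma sum_lsq_ge:
  assumes E: "E \<in> DAGs p"
  shows "(\<Sum>j\<in>{1..p}. lsq p y (pa E j) j) \<ge> real p"
    and "(\<Sum>j\<in>{1..p}. lsq p y (pa E j) j) \<le> real p \<Longrightarrow> j \<in> {1..p} \<Longrightarrow> lsq p y (pa E j) j = 1"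
proof -
  let ?r = "\<lambda>j. lsq p y (pa E j) j"
  have "1 = det_on {1..p} (gram p y)" using pa_subset[OF DAG] by (subst det_y) auto
  also have "\<dots> \<le> (\<Prod>j\<in>{1..p}. ?r j)"
    using pa_subset[OF E] by (intro det_on_le_prod_lsq[OF E _ _ posdef_y]) auto
  finally have "0 \<le> ln (\<Prod>j\<in>{1..p}. ?r j)" by simp
  also have "\<dots> = (\<Sum>j\<in>{1..p}. ln (?r j))" using lsq_y_pos[OF E] by (intro ln_prod) force+
  finally have 0: "0 \<le> (\<Sum>j\<in>{1..p}. ln (?r j))" .
  have le: "ln (?r j) \<le> ?r j - 1" if "j \<in> {1..p}" for j
    using ln_le_minus_one[OF lsq_y_pos[OF E that]] .
  have s: "(\<Sum>j\<in>{1..p}. ?r j - 1) = (\<Sum>j\<in>{1..p}. ?r j) - real p" by (simp add: sum_subtractf)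
  have "(\<Sum>j\<in>{1..p}. ln (?r j)) \<le> (\<Sum>j\<in>{1..p}. ?r j - 1)" by (rule sum_mono) (use le in auto)
  with 0 s show "(\<Sum>j\<in>{1..p}. ?r j) \<ge> real p" by simp
  assume "(\<Sum>j\<in>{1..p}. ?r j) \<le> real p" and j: "j \<in> {1..p}"
  then have "(\<Sum>j\<in>{1..p}. ?r j - 1 - ln (?r j)) \<le> 0" using 0 s by (simp add: sum_subtractf)
  moreover have "(\<Sum>j\<in>{1..p}. ?r j - 1 - ln (?r j)) \<ge> 0" by (rule sum_nonneg) (use le in force)
  ultimately have "(\<Sum>j\<in>{1..p}. ?r j - 1 - ln (?r j)) = 0" by simp
  then have "?r j - 1 - ln (?r j) = 0"
    using le j by (subst (asm) sum_nonneg_eq_0_iff) force+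
  then show "?r j = 1" using ln_eq_minus_one[OF lsq_y_pos[OF E j]] by simp
qed

lemma sum_lsq_gt:
  assumes "\<forall>e\<in>Gs. \<beta> e \<noteq> 0" "E \<in> DAGs p" "\<not> Gs \<subseteq> E"
  shows "(\<Sum>j\<in>{1..p}. lsq p y (pa E j) j) > real p"
proof (rule ccontr)
  assume "\<not> ?thesis"
  then have "lsq p y (pa E j) j \<le> 1" if "j \<in> {1..p}" for j
    using sum_lsq_ge(2)[OF assms(2) _ that] by simp
  then have "pa Gs j \<subseteq> pa E j" if "j \<in> {1..p}" for j
    using parents_identified[OF assms(1,2) subset_refl, of j] pa_subset[OF DAG] pa_subset[OF assms(2)] that by blast
  then have "Gs \<subseteq> E" using DAG by (fastforce simp: DAGs_def pa_def)
  with assms(3) show False by simp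
qed

end

section \<open>Marginal likelihood ratios on concentrated data\<close>

lemma rss_empty: "rss n x {} j b = gram n x j j"
  by (simp add: rss_def gram_def power2_eq_square)

text \<open>The \<open>Q\<^sub>E\<close> of the overview: the average of raw and residual sums of
  squares with weights \<open>1 / (1 + g)\<close> and \<open>g / (1 + g)\<close>. In contrast to
  \<open>gprior_quadratic\<close> it does not refer to a choice of minimisers.\<close>

definition gprior_rss :: "real \<Rightarrow> nat \<Rightarrow> nat \<Rightarrow> (nat \<Rightarrow> nat \<Rightarrow> real) \<Rightarrow> graph \<Rightarrow> real" where
  "gprior_rss g p n x E = (\<Sum>j\<in>{1..p}. gram n x j j + g * lsq n x (pa E j) j) / (1 + g)"

lemma gram_diag_nonneg: "gram n x j j \<ge> 0"
  by (simp add: gram_def sum_nonneg)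

lemma marg_lik_gprior_rss:
  assumes E: "E \<in> DAGs p" and g: "g > 0" and p: "p \<ge> 1" and pd: "posdef_on {1..p} (gram n x)"
  shows "gprior_rss g p n x E > 0"
    and "marg_lik g p n E x = (1 / sqrt (1 + g)) ^ card E *
     (1 / sqrt (gprior_rss g p n x E)) ^ (n * p) * enn2real (scale_integral (n * p) 1)"
proof -
  have pdE: "posdef_on (pa E j) (gram n x)" for j
    by (rule posdef_on_subset[OF pd pa_subset[OF E]]) simp
  have "\<exists>w. normal_eq n x (pa E j) j w" for j
    using normal_equations_solvable[OF finite_pa[OF E] pdE] by metis
  then obtain w where w: "\<And>j. normal_eq n x (pa E j) j (w j)" by metis
  have eq: "gprior_quadratic g p n E x w = gprior_rss g p n x E"
    unfolding gprior_quadratic_def gprior_rss_def sum_divide_distrib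
  proof (rule sum.cong[OF refl])
    fix j
    have "gram n x j j - g / (1 + g) * s = (gram n x j j + g * (gram n x j j - s)) / (1 + g)" for s
      using g by (simp add: field_simps)
    then show "gram n x j j - g / (1 + g) * (\<Sum>k\<in>pa E j. gram n x k j * w j k)
        = (gram n x j j + g * lsq n x (pa E j) j) / (1 + g)"
      unfolding lsq_eq(1)[OF w] by simp
  qed
  have "lsq n x (pa E j) j > 0" if "j \<in> {1..p}" for j
    by (intro lsq_pos finite_pa[OF E] not_in_pa_self[OF E] posdef_on_subset[OF pd])
      (use pa_subset[OF E] that in auto)
  then have "(\<Sum>j\<in>{1..p}. gram n x j j + g * lsq n x (pa E j) j) > 0"
    using p g by (intro sum_pos) (auto intro!: add_nonneg_pos gram_diag_nonneg)
  then show pos: "gprior_rss g p n x E > 0" using g by (simp add: gprior_rss_def)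
  show "marg_lik g p n E x = (1 / sqrt (1 + g)) ^ card E *
     (1 / sqrt (gprior_rss g p n x E)) ^ (n * p) * enn2real (scale_integral (n * p) 1)"
    using marg_lik_eq[OF E g pdE, of w] w pos unfolding eq normal_eq_def by blast
qed

lemma sqrt_power_le_exp:
  assumes "r \<ge> (0::real)" "r \<le> exp s"
  shows "sqrt r ^ N \<le> exp (real N / 2 * s)"
proof -
  have "sqrt r \<le> sqrt (exp s)" using assms(2) by simp
  also have "sqrt (exp s) = exp (s / 2)"
    by (rule real_sqrt_unique) (simp_all add: exp_double[symmetric])
  finally have "sqrt r ^ N \<le> exp (s / 2) ^ N" using assms(1) by (intro power_mono) auto
  then show ?thesis by (simp add: exp_of_nat_mult[symmetric] mult_ac)
qed

text \<open>The variance integral depends on \<open>n * p\<close> only and cancels;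
  \<open>n \<ge> 2\<close> ensures that it is finite.\<close>

lemma marg_lik_ratio:
  assumes "E \<in> DAGs p" "E' \<in> DAGs p" "p \<ge> 1" "n \<ge> 2" "posdef_on {1..p} (gram n x)"
  shows "marg_lik (real n) p n E' x > 0"
    and "marg_lik (real n) p n E x / marg_lik (real n) p n E' x =
      (1 / sqrt (1 + real n)) ^ card E * sqrt (1 + real n) ^ card E' *
      sqrt (gprior_rss (real n) p n x E' / gprior_rss (real n) p n x E) ^ (n * p)"
proof -
  have n: "real n > 0" using assms(4) by simp
  have "n * p \<ge> 2" using assms(3,4) by (metis mult_le_mono nat_mult_1_right)
  then have K: "enn2real (scale_integral (n * p) 1) > 0"
    using scale_integral_finite[of "n * p"] scale_integral_pos[of "n * p"]
    by (simp add: enn2real_positive_iff)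
  note E = marg_lik_gprior_rss[OF assms(1) n assms(3,5)]
  note E' = marg_lik_gprior_rss[OF assms(2) n assms(3,5)]
  show "marg_lik (real n) p n E' x > 0"
    unfolding E'(2) using K E'(1) by (intro mult_pos_pos) auto
  show "marg_lik (real n) p n E x / marg_lik (real n) p n E' x =
      (1 / sqrt (1 + real n)) ^ card E * sqrt (1 + real n) ^ card E' *
      sqrt (gprior_rss (real n) p n x E' / gprior_rss (real n) p n x E) ^ (n * p)"
    unfolding E(2) E'(2) using K E(1) E'(1)
    by (simp add: real_sqrt_divide power_divide)
qed

text \<open>One realisation of the data, without probability: \<open>x\<close> and \<open>e\<close>
  are the observed values and the noise behind them, and \<open>\<eta>\<close> is the entrywise
  tolerance of the noise Gram matrix relative to \<open>n\<close>. The bound on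
  \<open>\<eta> * real p\<close> keeps that matrix well conditioned.\<close>

locale sem_data = linear_sem +
  fixes n :: nat and x e :: "nat \<Rightarrow> nat \<Rightarrow> real" and \<sigma>2 \<eta> :: real
  assumes n2: "n \<ge> 2" and p1: "p \<ge> 1" and \<sigma>2: "\<sigma>2 > 0"
    and \<eta>: "\<eta> \<ge> 0" "\<eta> * real p \<le> \<sigma>2 / 2"
    and sem: "\<And>i k. i \<in> {1..n} \<Longrightarrow> k \<in> {1..p} \<Longrightarrow> x i k = (\<Sum>l\<in>pa Gs k. \<beta> (l, k) * x i l) + e i k"
    and noise: "\<And>a b. a \<in> {1..p} \<Longrightarrow> b \<in> {1..p} \<Longrightarrow>
      \<bar>gram n e a b - (if a = b then real n * \<sigma>2 else 0)\<bar> \<le> \<eta> * real n"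
begin

text \<open>Lower and upper bounds for the spectrum of the noise Gram matrix divided by
  \<open>n\<close>.\<close>

definition "lo = \<sigma>2 - \<eta> * real p"
definition "hi = \<sigma>2 + \<eta> * real p"

lemma lo_ge: "lo \<ge> \<sigma>2 / 2" and lo_pos: "lo > 0" and hi_pos: "hi > 0" and n_pos: "real n > 0"
  using \<eta> \<sigma>2 n2 by (auto simp: lo_def hi_def add_pos_nonneg)

lemma x_noise: "i \<in> {1..n} \<Longrightarrow> k \<in> {1..p} \<Longrightarrow> x i k = (\<Sum>a\<in>{1..p}. L k a * e i a)"
  by (rule L_solution[where e = "e i"]) (use sem in auto)

lemma x_combination:
  assumes "i \<in> {1..n}" "S \<subseteq> {1..p}"
  shows "(\<Sum>k\<in>S. b k * x i k) = (\<Sum>a\<in>{1..p}. (\<Sum>k\<in>S. b k * L k a) * e i a)"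
proof -
  have "(\<Sum>k\<in>S. b k * x i k) = (\<Sum>k\<in>S. \<Sum>a\<in>{1..p}. b k * L k a * e i a)"
    using assms by (intro sum.cong refl) (auto simp: x_noise sum_distrib_left mult_ac)
  then show ?thesis unfolding sum_distrib_right by (subst sum.swap)
qed

text \<open>The entrywise errors are summed with the bound of a product by half the sum of the
  squares; each coefficient occurs against \<open>p\<close> others, which is the source of the
  factor \<open>\<eta> * real p\<close>.\<close>

lemma noise_form:
  "\<bar>(\<Sum>i\<in>{1..n}. (\<Sum>a\<in>{1..p}. c a * e i a)\<^sup>2) - real n * \<sigma>2 * (\<Sum>a\<in>{1..p}. (c a)\<^sup>2)\<bar>
    \<le> real n * (\<eta> * real p) * (\<Sum>a\<in>{1..p}. (c a)\<^sup>2)"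
proof -
  let ?I = "{1..p}"
  have "real n * \<sigma>2 * (\<Sum>a\<in>?I. (c a)\<^sup>2) = (\<Sum>a\<in>?I. \<Sum>b\<in>?I. (if a = b then real n * \<sigma>2 else 0) * c a * c b)"
  proof -
    have "(\<Sum>b\<in>?I. (if a = b then real n * \<sigma>2 else 0) * c a * c b) = real n * \<sigma>2 * (c a)\<^sup>2" if "a \<in> ?I" for a
    proof -
      have "(\<Sum>b\<in>?I. (if a = b then real n * \<sigma>2 else 0) * c a * c b) = (\<Sum>b\<in>?I. if b = a then real n * \<sigma>2 * (c a)\<^sup>2 else 0)"
        by (rule sum.cong) (auto simp: power2_eq_square)
      then show ?thesis using that by simp
    qed
    then show ?thesis by (simp add: sum_distrib_left)
  qed
  then have "(\<Sum>i\<in>{1..n}. (\<Sum>a\<in>?I. c a * e i a)\<^sup>2) - real n * \<sigma>2 * (\<Sum>a\<in>?I. (c a)\<^sup>2)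
     = (\<Sum>a\<in>?I. \<Sum>b\<in>?I. (gram n e a b - (if a = b then real n * \<sigma>2 else 0)) * c a * c b)"
    unfolding gram_quadratic_form[symmetric] by (simp add: left_diff_distrib sum_subtractf)
  also have "\<bar>\<dots>\<bar> \<le> (\<Sum>a\<in>?I. \<Sum>b\<in>?I. \<eta> * real n * (((c a)\<^sup>2 + (c b)\<^sup>2) / 2))"
  proof (intro order_trans[OF sum_abs] sum_mono)
    fix a b assume ab: "a \<in> ?I" "b \<in> ?I"
    have "0 \<le> (\<bar>c a\<bar> - \<bar>c b\<bar>)\<^sup>2" by simp
    then have "\<bar>c a\<bar> * \<bar>c b\<bar> \<le> ((c a)\<^sup>2 + (c b)\<^sup>2) / 2" by (simp add: power2_diff)
    then have "\<bar>gram n e a b - (if a = b then real n * \<sigma>2 else 0)\<bar> * (\<bar>c a\<bar> * \<bar>c b\<bar>) \<le> \<eta> * real n * (((c a)\<^sup>2 + (c b)\<^sup>2) / 2)"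
      using noise[OF ab] \<eta>(1) by (intro mult_mono) auto
    then show "\<bar>(gram n e a b - (if a = b then real n * \<sigma>2 else 0)) * c a * c b\<bar> \<le> \<eta> * real n * (((c a)\<^sup>2 + (c b)\<^sup>2) / 2)"
      unfolding abs_mult mult.assoc .
  qed
  also have "\<dots> = \<eta> * real n * (\<Sum>a\<in>?I. \<Sum>b\<in>?I. ((c a)\<^sup>2 + (c b)\<^sup>2) / 2)"
    by (simp only: sum_distrib_left)
  also have "(\<Sum>a\<in>?I. \<Sum>b\<in>?I. ((c a)\<^sup>2 + (c b)\<^sup>2) / 2) = real p * (\<Sum>a\<in>?I. (c a)\<^sup>2)"
    by (simp add: sum.distrib add_divide_distrib sum_divide_distrib[symmetric] sum_distrib_left[symmetric])
  finally show ?thesis by (simp only: mult_ac)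
qed

lemma noise_form_bounds:
  "real n * lo * (\<Sum>a\<in>{1..p}. (c a)\<^sup>2) \<le> (\<Sum>i\<in>{1..n}. (\<Sum>a\<in>{1..p}. c a * e i a)\<^sup>2)"
  "(\<Sum>i\<in>{1..n}. (\<Sum>a\<in>{1..p}. c a * e i a)\<^sup>2) \<le> real n * hi * (\<Sum>a\<in>{1..p}. (c a)\<^sup>2)"
  using noise_form[of c] unfolding lo_def hi_def by (simp_all add: algebra_simps abs_le_iff)

lemma posdef_gram: "posdef_on {1..p} (gram n x)"
  unfolding posdef_on_def gram_quadratic_form
proof (intro allI impI)
  fix b :: "nat \<Rightarrow> real" assume "\<exists>k\<in>{1..p}. b k \<noteq> 0"
  then obtain a where a: "a \<in> {1..p}" "(\<Sum>k\<in>{1..p}. b k * L k a) \<noteq> 0"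
    using L_independent[of "{1..p}" _ b] by blast
  then have "0 < (\<Sum>a\<in>{1..p}. (\<Sum>k\<in>{1..p}. b k * L k a)\<^sup>2)" by (intro sum_pos2[of _ a]) auto
  then have "0 < real n * lo * (\<Sum>a\<in>{1..p}. (\<Sum>k\<in>{1..p}. b k * L k a)\<^sup>2)" using lo_pos n_pos by simp
  also have "\<dots> \<le> (\<Sum>i\<in>{1..n}. (\<Sum>a\<in>{1..p}. (\<Sum>k\<in>{1..p}. b k * L k a) * e i a)\<^sup>2)"
    by (rule noise_form_bounds)
  also have "\<dots> = (\<Sum>i\<in>{1..n}. (\<Sum>k\<in>{1..p}. b k * x i k)\<^sup>2)"
    by (intro sum.cong refl) (simp only: x_combination[OF _ subset_refl])
  finally show "0 < (\<Sum>i\<in>{1..n}. (\<Sum>k\<in>{1..p}. b k * x i k)\<^sup>2)" .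
qed

lemma rss_noise:
  assumes "S \<subseteq> {1..p}" "j \<in> {1..p}"
  shows "rss n x S j b = (\<Sum>i\<in>{1..n}. (\<Sum>a\<in>{1..p}. (L j a - (\<Sum>k\<in>S. b k * L k a)) * e i a)\<^sup>2)"
  unfolding rss_def
  by (intro sum.cong refl)
    (simp only: x_combination[OF _ assms(1)] x_noise[OF _ assms(2)] left_diff_distrib sum_subtractf)

text \<open>The same linear combination of noise underlies both sides. The bounds are uniform in
  \<open>b\<close> and therefore pass to the infimum without control of the sample
  minimisers.\<close>

lemma rss_bounds:
  assumes "S \<subseteq> {1..p}" "j \<in> {1..p}"
  shows "real n * lo * rss p y S j b \<le> rss n x S j b" "rss n x S j b \<le> real n * hi * rss p y S j b"
  using noise_form_bounds[of "\<lambda>a. L j a - (\<Sum>k\<in>S. b k * L k a)"]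
  unfolding rss_noise[OF assms] rss_def[of p] by simp_all

lemma lsq_lower:
  assumes "S \<subseteq> {1..p}" "j \<in> {1..p}"
  shows "real n * lo * lsq p y S j \<le> lsq n x S j"
  unfolding lsq_def[of n x]
proof (rule cINF_greatest)
  fix b
  have "real n * lo * lsq p y S j \<le> real n * lo * rss p y S j b"
    using lo_pos by (intro mult_left_mono lsq_le) auto
  with rss_bounds(1)[OF assms, of b] show "real n * lo * lsq p y S j \<le> rss n x S j b" by simp
qed simp

text \<open>The true coefficients leave exactly the noise. An upper bound with this particular term
  is what is wanted, since the term reappears in \<open>lsq_superset_ge\<close> and drops out of the
  difference.\<close>

lemma lsq_true_le: "j \<in> {1..p} \<Longrightarrow> lsq n x (pa Gs j) j \<le> gram n e j j"
  using lsq_le[of n x "pa Gs j" j "\<lambda>k. \<beta> (k, j)"]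
  unfolding rss_def gram_def by (simp add: sem power2_eq_square)

text \<open>The coefficient of the noise at \<open>j\<close> in its parents in \<open>E\<close> vanishes, so only the empirical
  correlations of the noise at \<open>j\<close> with the other noise variables enter;
  \<open>- 2 c z + m c\<^sup>2 \<ge> - z\<^sup>2 / m\<close> then bounds the gain.\<close>

lemma lsq_superset_ge:
  assumes E: "E \<in> DAGs p" "Gs \<subseteq> E" and j: "j \<in> {1..p}"
  shows "gram n e j j - (\<Sum>a\<in>{1..p} - {j}. (gram n e a j)\<^sup>2) / (real n * lo) \<le> lsq n x (pa E j) j"
  unfolding lsq_def
proof (rule cINF_greatest)
  fix b
  let ?S = "pa E j" and ?I = "{1..p}" and ?m = "real n * lo"
  have sub: "pa Gs j \<subseteq> ?S" using E(2) by (auto simp: pa_def)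
  have m: "?m > 0" using lo_pos n_pos by simp
  \<comment> \<open>Deviation from the true coefficients, and in \<open>c\<close> its effect in
    terms of the noise: the residual becomes the noise at \<open>j\<close> minus the combination
    with weights \<open>c\<close>.\<close>
  define b' where "b' k = b k - (if k \<in> pa Gs j then \<beta> (k, j) else 0)" for k
  define c where "c a = (\<Sum>k\<in>?S. b' k * L k a)" for a
  have cj: "c j = 0" unfolding c_def
  proof (rule sum.neutral, intro ballI)
    fix k assume k: "k \<in> ?S"
    \<comment> \<open>A true path from \<open>j\<close> to its parent \<open>k\<close> in
      \<open>E\<close> would also be a path in the supergraph \<open>E\<close> and close a cycle
      there.\<close>
    have "(j, k) \<notin> Gs\<^sup>+"
    proof
      assume "(j, k) \<in> Gs\<^sup>+"
      then have "(j, k) \<in> E\<^sup>+" using E(2) by (rule trancl_mono)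
      moreover have "(k, j) \<in> E" using k by (simp add: pa_def)
      ultimately have "(j, j) \<in> E\<^sup>+" by (rule trancl.trancl_into_trancl)
      then show False using DAGs_acyclic[OF E(1)] by (simp add: acyclic_def)
    qed
    moreover have "k \<noteq> j" using k not_in_pa_self[OF E(1)] by auto
    ultimately show "b' k * L k j = 0" using L_zero[of k j] by simp
  qed
  have resid: "x i j - (\<Sum>k\<in>?S. b k * x i k) = e i j - (\<Sum>a\<in>?I. c a * e i a)" if i: "i \<in> {1..n}" for i
  proof -
    have "(\<Sum>k\<in>?S. (if k \<in> pa Gs j then \<beta> (k, j) else 0) * x i k) = (\<Sum>k\<in>pa Gs j. (if k \<in> pa Gs j then \<beta> (k, j) else 0) * x i k)"
      by (rule sum.mono_neutral_right) (use sub finite_pa[OF E(1)] in auto)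
    then have "(\<Sum>k\<in>?S. b' k * x i k) = (\<Sum>k\<in>?S. b k * x i k) - (\<Sum>k\<in>pa Gs j. \<beta> (k, j) * x i k)"
      by (simp add: b'_def left_diff_distrib sum_subtractf)
    then show ?thesis
      using sem[OF i j] x_combination[OF i pa_subset[OF E(1)], of b' j] by (simp add: c_def)
  qed
  have "rss n x ?S j b = (\<Sum>i\<in>{1..n}. e i j * e i j - 2 * (\<Sum>a\<in>?I. c a * (e i a * e i j)) + (\<Sum>a\<in>?I. c a * e i a)\<^sup>2)"
    unfolding rss_def
  proof (rule sum.cong[OF refl])
    fix i assume "i \<in> {1..n}"
    have "(\<Sum>a\<in>?I. c a * (e i a * e i j)) = e i j * (\<Sum>a\<in>?I. c a * e i a)"
      unfolding sum_distrib_left by (simp only: mult_ac)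
    moreover have "(s - t)\<^sup>2 = s * s - 2 * (s * t) + t\<^sup>2" for s t :: real
      by (simp add: power2_eq_square algebra_simps)
    ultimately show "(x i j - (\<Sum>k\<in>?S. b k * x i k))\<^sup>2
        = e i j * e i j - 2 * (\<Sum>a\<in>?I. c a * (e i a * e i j)) + (\<Sum>a\<in>?I. c a * e i a)\<^sup>2"
      by (simp only: resid[OF \<open>i \<in> {1..n}\<close>])
  qed
  also have "\<dots> = gram n e j j - 2 * (\<Sum>a\<in>?I. c a * gram n e a j) + (\<Sum>i\<in>{1..n}. (\<Sum>a\<in>?I. c a * e i a)\<^sup>2)"
  proof -
    have "(\<Sum>i\<in>{1..n}. \<Sum>a\<in>?I. c a * (e i a * e i j)) = (\<Sum>a\<in>?I. c a * gram n e a j)"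
      unfolding gram_def sum_distrib_left by (rule sum.swap)
    then show ?thesis by (simp add: sum.distrib sum_subtractf gram_def sum_distrib_left[symmetric])
  qed
  finally have "gram n e j j - 2 * (\<Sum>a\<in>?I. c a * gram n e a j) + ?m * (\<Sum>a\<in>?I. (c a)\<^sup>2) \<le> rss n x ?S j b"
    using noise_form_bounds(1)[of c] by simp
  also have "gram n e j j - 2 * (\<Sum>a\<in>?I. c a * gram n e a j) + ?m * (\<Sum>a\<in>?I. (c a)\<^sup>2)
     = gram n e j j + (\<Sum>a\<in>?I. - 2 * c a * gram n e a j + ?m * (c a)\<^sup>2)"
    unfolding sum.distrib sum_distrib_left by (simp add: sum_negf[symmetric] mult_ac)
  also have "(\<Sum>a\<in>?I. - 2 * c a * gram n e a j + ?m * (c a)\<^sup>2) = (\<Sum>a\<in>?I - {j}. - 2 * c a * gram n e a j + ?m * (c a)\<^sup>2)"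
    using j cj by (simp add: sum.remove)
  finally have lower: "gram n e j j + (\<Sum>a\<in>?I - {j}. - 2 * c a * gram n e a j + ?m * (c a)\<^sup>2) \<le> rss n x ?S j b" .
  have "(\<Sum>a\<in>?I - {j}. - 2 * c a * gram n e a j + ?m * (c a)\<^sup>2) \<ge> (\<Sum>a\<in>?I - {j}. - ((gram n e a j)\<^sup>2 / ?m))"
  proof (rule sum_mono)
    fix a
    have "0 \<le> (?m * c a - gram n e a j)\<^sup>2 / ?m" using m by simp
    also have "\<dots> = ?m * (c a)\<^sup>2 - 2 * c a * gram n e a j + (gram n e a j)\<^sup>2 / ?m"
    proof -
      have "(m * u - z)\<^sup>2 / m = m * u\<^sup>2 - 2 * u * z + z\<^sup>2 / m" if "m > 0" for m u z :: real
        using that by (simp add: power2_eq_square field_simps)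
      from this[OF m] show ?thesis .
    qed
    finally show "- ((gram n e a j)\<^sup>2 / ?m) \<le> - 2 * c a * gram n e a j + ?m * (c a)\<^sup>2" by simp
  qed
  with lower show "gram n e j j - (\<Sum>a\<in>?I - {j}. (gram n e a j)\<^sup>2) / ?m \<le> rss n x ?S j b"
    by (simp add: sum_negf sum_divide_distrib)
qed simp

lemma gprior_rss_lower:
  assumes E: "E \<in> DAGs p"
  shows "real n * (real n * lo * (\<Sum>j\<in>{1..p}. lsq p y (pa E j) j)) / (1 + real n) \<le> gprior_rss (real n) p n x E"
proof -
  have "real n * (real n * lo * (\<Sum>j\<in>{1..p}. lsq p y (pa E j) j)) = (\<Sum>j\<in>{1..p}. 0 + real n * (real n * lo * lsq p y (pa E j) j))"
    by (simp add: sum_distrib_left)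
  also have "\<dots> \<le> (\<Sum>j\<in>{1..p}. gram n x j j + real n * lsq n x (pa E j) j)"
    by (intro sum_mono add_mono mult_left_mono lsq_lower pa_subset[OF E] gram_diag_nonneg) auto
  finally show ?thesis unfolding gprior_rss_def by (intro divide_right_mono) auto
qed

text \<open>The gain is bounded while \<open>gprior_rss\<close> grows linearly in \<open>n\<close>,
  so the ratio of the two quadratic terms is 1 + O(1/n) and its power \<open>n * p / 2\<close> stays
  bounded.\<close>

lemma marg_ratio_superset:
  assumes E: "E \<in> DAGs p" "Gs \<subset> E"
    and cross: "\<And>a b. a \<in> {1..p} \<Longrightarrow> b \<in> {1..p} \<Longrightarrow> a \<noteq> b \<Longrightarrow> \<bar>gram n e a b\<bar> \<le> K * sqrt (real n)"
  shows "marg_lik (real n) p n E x / marg_lik (real n) p n Gs x \<le> exp (2 * (real p)\<^sup>2 * K\<^sup>2 / \<sigma>2\<^sup>2) / sqrt (real n)"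
proof -
  let ?Q = "gprior_rss (real n) p n x" and ?s = "real n / (1 + real n)"
  have Qpos: "?Q E > 0" "?Q Gs > 0"
    using marg_lik_gprior_rss(1)[OF _ n_pos p1 posdef_gram] E(1) DAG by auto
  have D: "lsq n x (pa Gs j) j - lsq n x (pa E j) j \<le> real p * K\<^sup>2 / lo" if j: "j \<in> {1..p}" for j
  proof -
    have "(\<Sum>a\<in>{1..p} - {j}. (gram n e a j)\<^sup>2) \<le> (\<Sum>a\<in>{1..p} - {j}. K\<^sup>2 * real n)"
    proof (rule sum_mono)
      fix a assume "a \<in> {1..p} - {j}"
      then have "\<bar>gram n e a j\<bar>\<^sup>2 \<le> (K * sqrt (real n))\<^sup>2" using cross[of a j] j by (intro power_mono) auto
      then show "(gram n e a j)\<^sup>2 \<le> K\<^sup>2 * real n" by (simp add: power_mult_distrib)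
    qed
    also have "\<dots> \<le> real p * (K\<^sup>2 * real n)"
      using j by (simp add: mult_right_mono)
    finally have "(\<Sum>a\<in>{1..p} - {j}. (gram n e a j)\<^sup>2) / (real n * lo) \<le> real p * (K\<^sup>2 * real n) / (real n * lo)"
      using lo_pos by (intro divide_right_mono) auto
    also have "\<dots> = real p * K\<^sup>2 / lo" using n_pos by simp
    finally show ?thesis using lsq_superset_ge[OF E(1) _ j] lsq_true_le[OF j] E(2) by force
  qed
  have "?Q Gs - ?Q E = ?s * (\<Sum>j\<in>{1..p}. lsq n x (pa Gs j) j - lsq n x (pa E j) j)"
    unfolding gprior_rss_def
    by (simp add: sum.distrib sum_subtractf sum_distrib_left[symmetric] diff_divide_distrib[symmetric] right_diff_distrib)
  also have "\<dots> \<le> ?s * (\<Sum>j\<in>{1..p}. real p * K\<^sup>2 / lo)"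
    using D by (intro mult_left_mono sum_mono) auto
  finally have diff: "?Q Gs - ?Q E \<le> ?s * ((real p)\<^sup>2 * K\<^sup>2 / lo)" by (simp add: power2_eq_square)
  have "?s * (real n * lo * real p) \<le> ?s * (real n * lo * (\<Sum>j\<in>{1..p}. lsq p y (pa E j) j))"
    using lo_pos sum_lsq_ge(1)[OF E(1)] by (intro mult_left_mono) auto
  also have "\<dots> \<le> ?Q E" using gprior_rss_lower[OF E(1)] by simp
  finally have low: "?s * (real n * lo * real p) \<le> ?Q E" .
  have spos: "?s > 0" using n_pos by simp
  have "?Q Gs / ?Q E = 1 + (?Q Gs - ?Q E) / ?Q E" using Qpos by (simp add: diff_divide_distrib)
  also have "\<dots> \<le> 1 + (?s * ((real p)\<^sup>2 * K\<^sup>2 / lo)) / (?s * (real n * lo * real p))"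
  proof -
    have "(?Q Gs - ?Q E) / ?Q E \<le> (?s * ((real p)\<^sup>2 * K\<^sup>2 / lo)) / ?Q E"
      using diff Qpos by (intro divide_right_mono) auto
    also have "\<dots> \<le> (?s * ((real p)\<^sup>2 * K\<^sup>2 / lo)) / (?s * (real n * lo * real p))"
      using low Qpos lo_pos n_pos p1 spos by (intro divide_left_mono mult_nonneg_nonneg mult_pos_pos) auto
    finally show ?thesis by simp
  qed
  also have "(?s * ((real p)\<^sup>2 * K\<^sup>2 / lo)) / (?s * (real n * lo * real p)) = real p * K\<^sup>2 / (real n * lo\<^sup>2)"
    using spos lo_pos p1 by (simp add: power2_eq_square)
  also have "1 + real p * K\<^sup>2 / (real n * lo\<^sup>2) \<le> exp (real p * K\<^sup>2 / (real n * lo\<^sup>2))"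
    by (rule exp_ge_add_one_self)
  finally have "?Q Gs / ?Q E \<le> exp (real p * K\<^sup>2 / (real n * lo\<^sup>2))" .
  then have "sqrt (?Q Gs / ?Q E) ^ (n * p) \<le> exp (real (n * p) / 2 * (real p * K\<^sup>2 / (real n * lo\<^sup>2)))"
    using Qpos by (intro sqrt_power_le_exp) auto
  \<comment> \<open>The \<open>n\<close> of the exponent cancels the rate of the ratio. Replacing
    \<open>lo\<close> by its lower bound \<open>\<sigma>2 / 2\<close> yields the constant 2 of the
    statement.\<close>
  also have "real (n * p) / 2 * (real p * K\<^sup>2 / (real n * lo\<^sup>2)) = (real p)\<^sup>2 * K\<^sup>2 / (2 * lo\<^sup>2)"
    using n_pos by (simp add: power2_eq_square)
  also have "\<dots> \<le> (real p)\<^sup>2 * K\<^sup>2 / (2 * (\<sigma>2 / 2)\<^sup>2)"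
    using lo_ge lo_pos \<sigma>2 by (intro divide_left_mono mult_left_mono power_mono mult_pos_pos mult_nonneg_nonneg) auto
  also have "\<dots> = 2 * (real p)\<^sup>2 * K\<^sup>2 / \<sigma>2\<^sup>2" by (simp add: power_divide)
  finally have pw: "sqrt (?Q Gs / ?Q E) ^ (n * p) \<le> exp (2 * (real p)\<^sup>2 * K\<^sup>2 / \<sigma>2\<^sup>2)" by simp
  \<comment> \<open>One additional edge leaves one uncancelled factor
    \<open>1 / sqrt (1 + real n)\<close>; any further factors are at most 1.\<close>
  have "card Gs < card E" using E DAGs_finite psubset_card_mono by blast
  then obtain d where d: "card E = card Gs + Suc d" by (metis add_Suc_right less_imp_Suc_add)
  have "(1 / sqrt (1 + real n)) ^ card E * sqrt (1 + real n) ^ card Gs = (1 / sqrt (1 + real n)) ^ Suc d"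
    unfolding d power_add by (simp add: power_divide)
  also have "\<dots> \<le> (1 / sqrt (1 + real n)) ^ 1" by (rule power_decreasing) auto
  also have "\<dots> \<le> 1 / sqrt (real n)" using n_pos by (simp add: frac_le)
  finally have "(1 / sqrt (1 + real n)) ^ card E * sqrt (1 + real n) ^ card Gs \<le> 1 / sqrt (real n)" .
  then have "(1 / sqrt (1 + real n)) ^ card E * sqrt (1 + real n) ^ card Gs * sqrt (?Q Gs / ?Q E) ^ (n * p)
     \<le> 1 / sqrt (real n) * exp (2 * (real p)\<^sup>2 * K\<^sup>2 / \<sigma>2\<^sup>2)"
    using pw Qpos by (intro mult_mono) auto
  then show ?thesis unfolding marg_lik_ratio(2)[OF E(1) DAG p1 n2 posdef_gram] by simp
qed

text \<open>The ratio of the quadratic terms is split into three factors: \<open>hi / lo\<close> for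
  the fluctuation of the noise, one for the unshrunk second moments of relative size 1/n, and the
  inverse risk ratio, which is at most \<open>exp (- \<delta>)\<close>. Each of the first two costs
  \<open>exp (\<epsilon> / 2)\<close>. The edge penalty of \<open>E\<close> is bounded by 1, so that
  of the true graph remains as a power of \<open>1 + real n\<close>.\<close>

lemma marg_ratio_general:
  assumes E: "E \<in> DAGs p"
    and eps: "8 * \<eta> * real p \<le> \<epsilon> * \<sigma>2" "2 * (\<Sum>j\<in>{1..p}. gram p y j j) \<le> \<epsilon> * (real n * real p)"
    and \<delta>: "\<delta> \<le> ln ((\<Sum>j\<in>{1..p}. lsq p y (pa E j) j) / real p)"
  shows "marg_lik (real n) p n E x / marg_lik (real n) p n Gs x
     \<le> exp (- (real n * real p / 2) * (\<delta> - \<epsilon>)) * (1 + real n) powr (real (card Gs) / 2)"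
proof -
  let ?Q = "gprior_rss (real n) p n x" and ?R = "\<Sum>j\<in>{1..p}. lsq p y (pa E j) j"
    and ?\<Lambda> = "\<Sum>j\<in>{1..p}. gram p y j j"
  have Qpos: "?Q E > 0" "?Q Gs > 0"
    using marg_lik_gprior_rss(1)[OF _ n_pos p1 posdef_gram] E DAG by auto
  have p0: "real p > 0" using p1 by simp
  have R: "?R \<ge> real p" by (rule sum_lsq_ge(1)[OF E])
  have "(\<Sum>j\<in>{1..p}. gram n x j j + real n * lsq n x (pa Gs j) j)
     \<le> (\<Sum>j\<in>{1..p}. real n * hi * gram p y j j + real n * (real n * hi))"
  proof (intro sum_mono add_mono mult_left_mono)
    fix j assume j: "j \<in> {1..p}"
    show "gram n x j j \<le> real n * hi * gram p y j j"
      using rss_bounds(2)[of "{}" j] j unfolding rss_empty by simp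
    have "gram n e j j \<le> real n * \<sigma>2 + \<eta> * real n" using noise[OF j j] by simp
    also have "\<dots> \<le> real n * \<sigma>2 + \<eta> * real n * real p"
      using mult_left_mono[of 1 "real p" "\<eta> * real n"] \<eta>(1) p1 by simp
    also have "\<dots> = real n * hi" by (simp add: hi_def algebra_simps)
    finally show "lsq n x (pa Gs j) j \<le> real n * hi" using lsq_true_le[OF j] by simp
  qed simp
  also have "\<dots> = real n * hi * (?\<Lambda> + real n * real p)"
    by (simp add: sum.distrib sum_distrib_left[symmetric] algebra_simps)
  finally have up: "?Q Gs \<le> real n * hi * (?\<Lambda> + real n * real p) / (1 + real n)"
    unfolding gprior_rss_def by (intro divide_right_mono) auto
  have "?Q Gs / ?Q E \<le> (real n * hi * (?\<Lambda> + real n * real p) / (1 + real n)) / (real n * (real n * lo * ?R) / (1 + real n))"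
    using up gprior_rss_lower[OF E] Qpos n_pos lo_pos R p0 by (intro frac_le) auto
  also have "\<dots> = hi / lo * ((?\<Lambda> + real n * real p) / (real n * real p)) * (real p / ?R)"
  proof -
    have "(N * h * A / c) / (N * (N * l * r) / c) = h / l * (A / (N * P)) * (P / r)"
      if "N > 0" "c > 0" "l > 0" "r > 0" "P > 0" for N h A c l r P :: real
      using that by simp
    then show ?thesis using n_pos p0 lo_pos R by simp
  qed
  also have "\<dots> \<le> exp (\<epsilon> / 2) * exp (\<epsilon> / 2) * exp (- \<delta>)"
  proof (intro mult_mono mult_nonneg_nonneg)
    \<comment> \<open>The 8 in the first condition on \<open>\<epsilon>\<close> is a product of
      three twos: this difference, the bound \<open>lo \<ge> \<sigma>2 / 2\<close>, and the budget
      \<open>\<epsilon> / 2\<close>.\<close>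
    have "hi = lo + 2 * (\<eta> * real p)" by (simp add: hi_def lo_def)
    then have "hi / lo = 1 + 2 * (\<eta> * real p) / lo" using lo_pos by (simp add: add_divide_distrib)
    also have "\<dots> \<le> 1 + 2 * (\<eta> * real p) / (\<sigma>2 / 2)"
      using lo_ge lo_pos \<sigma>2 \<eta>(1) by (intro add_left_mono divide_left_mono) auto
    also have "\<dots> \<le> 1 + \<epsilon> / 2" using eps(1) \<sigma>2 by (simp add: field_simps)
    also have "\<dots> \<le> exp (\<epsilon> / 2)" by (rule exp_ge_add_one_self)
    finally show "hi / lo \<le> exp (\<epsilon> / 2)" .
    have "(?\<Lambda> + real n * real p) / (real n * real p) = 1 + ?\<Lambda> / (real n * real p)"
      using n_pos p0 by (simp add: add_divide_distrib)
    also have "\<dots> \<le> 1 + \<epsilon> / 2" using eps(2) n_pos p0 by (simp add: divide_le_eq)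
    also have "\<dots> \<le> exp (\<epsilon> / 2)" by (rule exp_ge_add_one_self)
    finally show "(?\<Lambda> + real n * real p) / (real n * real p) \<le> exp (\<epsilon> / 2)" .
    have "exp \<delta> \<le> ?R / real p" using \<delta> R p0 by (metis divide_pos_pos exp_le_cancel_iff exp_ln less_le_trans)
    then have "inverse (?R / real p) \<le> inverse (exp \<delta>)" by (intro le_imp_inverse_le) auto
    then show "real p / ?R \<le> exp (- \<delta>)" by (simp add: exp_minus)
    show "0 \<le> (?\<Lambda> + real n * real p) / (real n * real p)"
      by (intro divide_nonneg_nonneg add_nonneg_nonneg sum_nonneg gram_diag_nonneg) auto
  qed (use lo_pos hi_pos R p0 in auto)
  also have "\<dots> = exp (- (\<delta> - \<epsilon>))" by (simp add: exp_add[symmetric])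
  finally have "sqrt (?Q Gs / ?Q E) ^ (n * p) \<le> exp (real (n * p) / 2 * (- (\<delta> - \<epsilon>)))"
    using Qpos by (intro sqrt_power_le_exp) auto
  also have "real (n * p) / 2 * (- (\<delta> - \<epsilon>)) = - (real n * real p / 2) * (\<delta> - \<epsilon>)"
    by (simp only: of_nat_mult)
  finally have pw: "sqrt (?Q Gs / ?Q E) ^ (n * p) \<le> exp (- (real n * real p / 2) * (\<delta> - \<epsilon>))" .
  have "(1 / sqrt (1 + real n)) ^ card E * sqrt (1 + real n) ^ card Gs \<le> 1 * sqrt (1 + real n) ^ card Gs"
    by (intro mult_right_mono power_le_one) auto
  also have "1 * sqrt (1 + real n) ^ card Gs = (1 + real n) powr (real (card Gs) / 2)"
  proof -
    have "sqrt (1 + real n) ^ card Gs = ((1 + real n) powr (1/2)) powr (real (card Gs))"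
      by (simp add: powr_realpow powr_half_sqrt)
    then show ?thesis by (simp add: powr_powr)
  qed
  finally have "(1 / sqrt (1 + real n)) ^ card E * sqrt (1 + real n) ^ card Gs * sqrt (?Q Gs / ?Q E) ^ (n * p)
     \<le> (1 + real n) powr (real (card Gs) / 2) * exp (- (real n * real p / 2) * (\<delta> - \<epsilon>))"
    using pw Qpos by (intro mult_mono) auto
  then show ?thesis unfolding marg_lik_ratio(2)[OF E DAG p1 n2 posdef_gram] by (simp only: mult.commute)
qed

end

section \<open>Laws of large numbers\<close>

context prob_space begin

lemma indep_vars_pair:
  assumes "indep_vars (\<lambda>_. borel) X I" "i \<in> I" "j \<in> I" "i \<noteq> j"
  shows "indep_var borel (X i :: 'a \<Rightarrow> real) borel (X j)"
proof -
  have "indep_var (PiM {i} (\<lambda>_. borel)) (\<lambda>\<omega>. restrict (\<lambda>i. X i \<omega>) {i}) (PiM {j} (\<lambda>_. borel)) (\<lambda>\<omega>. restrict (\<lambda>i. X i \<omega>) {j})"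
    using assms by (intro indep_var_restrict[OF assms(1)]) auto
  from indep_var_compose[OF this measurable_component_singleton[of i] measurable_component_singleton[of j]]
  show ?thesis by (simp add: comp_def)
qed

lemma integrable_mult_of_squares:
  fixes f g :: "'a \<Rightarrow> real"
  assumes [measurable]: "f \<in> borel_measurable M" "g \<in> borel_measurable M"
    and "integrable M (\<lambda>\<omega>. (f \<omega>)\<^sup>2)" "integrable M (\<lambda>\<omega>. (g \<omega>)\<^sup>2)"
  shows "integrable M (\<lambda>\<omega>. f \<omega> * g \<omega>)"
proof (rule Bochner_Integration.integrable_bound)
  show "integrable M (\<lambda>\<omega>. (f \<omega>)\<^sup>2 + (g \<omega>)\<^sup>2)"
    using assms(3,4) by (rule Bochner_Integration.integrable_add)
  have "norm (u * v) \<le> norm (u\<^sup>2 + v\<^sup>2)" for u v :: real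
  proof -
    have "2 * \<bar>u * v\<bar> \<le> u\<^sup>2 + v\<^sup>2"
      using sum_squares_bound[of "\<bar>u\<bar>" "\<bar>v\<bar>"] by (simp add: abs_mult)
    then show ?thesis by simp
  qed
  then show "AE \<omega> in M. norm (f \<omega> * g \<omega>) \<le> norm ((f \<omega>)\<^sup>2 + (g \<omega>)\<^sup>2)" by (intro AE_I2)
qed measurable

text \<open>Chebyshev's inequality, in a form that serves both the truncated variables in the weak
  law and the products of distinct noise variables.\<close>

lemma prob_uncorrelated_sum_ge:
  fixes Z :: "'i \<Rightarrow> 'a \<Rightarrow> real"
  assumes "finite I" and [measurable]: "\<And>i. i \<in> I \<Longrightarrow> Z i \<in> borel_measurable M"
    and int: "\<And>i. i \<in> I \<Longrightarrow> integrable M (\<lambda>\<omega>. (Z i \<omega>)\<^sup>2)"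
    and bound: "\<And>i. i \<in> I \<Longrightarrow> expectation (\<lambda>\<omega>. (Z i \<omega>)\<^sup>2) \<le> V"
    and uncor: "\<And>i j. i \<in> I \<Longrightarrow> j \<in> I \<Longrightarrow> i \<noteq> j \<Longrightarrow> expectation (\<lambda>\<omega>. Z i \<omega> * Z j \<omega>) = 0"
    and t: "t > 0"
  shows "prob {\<omega> \<in> space M. \<bar>\<Sum>i\<in>I. Z i \<omega>\<bar> \<ge> t} \<le> real (card I) * V / t\<^sup>2"
proof -
  have int2: "integrable M (\<lambda>\<omega>. Z i \<omega> * Z j \<omega>)" if "i \<in> I" "j \<in> I" for i j
    using that int by (intro integrable_mult_of_squares) auto
  have sq: "(\<Sum>i\<in>I. Z i \<omega>)\<^sup>2 = (\<Sum>i\<in>I. \<Sum>j\<in>I. Z i \<omega> * Z j \<omega>)" for \<omega>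
    by (simp add: power2_eq_square sum_product)
  have "expectation (\<lambda>\<omega>. (\<Sum>i\<in>I. Z i \<omega>)\<^sup>2) = (\<Sum>i\<in>I. \<Sum>j\<in>I. expectation (\<lambda>\<omega>. Z i \<omega> * Z j \<omega>))"
    unfolding sq using int2 by (simp add: Bochner_Integration.integral_sum Bochner_Integration.integrable_sum)
  also have "\<dots> = (\<Sum>i\<in>I. expectation (\<lambda>\<omega>. (Z i \<omega>)\<^sup>2))"
  proof (rule sum.cong[OF refl])
    fix i assume i: "i \<in> I"
    have "(\<Sum>j\<in>I. expectation (\<lambda>\<omega>. Z i \<omega> * Z j \<omega>)) = (\<Sum>j\<in>I. if j = i then expectation (\<lambda>\<omega>. (Z i \<omega>)\<^sup>2) else 0)"
      using uncor[OF i] by (intro sum.cong refl) (auto simp: power2_eq_square)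
    then show "(\<Sum>j\<in>I. expectation (\<lambda>\<omega>. Z i \<omega> * Z j \<omega>)) = expectation (\<lambda>\<omega>. (Z i \<omega>)\<^sup>2)"
      using i assms(1) by simp
  qed
  also have "\<dots> \<le> real (card I) * V" using bound by (simp add: sum_bounded_above)
  finally have E: "expectation (\<lambda>\<omega>. (\<Sum>i\<in>I. Z i \<omega>)\<^sup>2) \<le> real (card I) * V" .
  have "t \<le> \<bar>s\<bar> \<longleftrightarrow> t\<^sup>2 \<le> s\<^sup>2" for s :: real
    using t abs_le_square_iff[of t s] by simp
  then have "prob {\<omega> \<in> space M. \<bar>\<Sum>i\<in>I. Z i \<omega>\<bar> \<ge> t} = prob {\<omega> \<in> space M. (\<Sum>i\<in>I. Z i \<omega>)\<^sup>2 \<ge> t\<^sup>2}" by simp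
  also have "\<dots> \<le> expectation (\<lambda>\<omega>. (\<Sum>i\<in>I. Z i \<omega>)\<^sup>2) / t\<^sup>2"
  proof (rule integral_Markov_inequality_measure[where A = "{}"])
    show "integrable M (\<lambda>\<omega>. (\<Sum>i\<in>I. Z i \<omega>)\<^sup>2)"
      unfolding sq using int2 by (intro Bochner_Integration.integrable_sum) auto
  qed (use t in auto)
  also have "\<dots> \<le> real (card I) * V / t\<^sup>2" using E by (intro divide_right_mono) auto
  finally show ?thesis .
qed

text \<open>Only first moments are available here (the summands will be squared noise variables), hence the
  truncation: at a fixed level the truncated part has a second moment and the rest is small in mean.\<close>

lemma weak_law_of_large_numbers:
  fixes Y :: "nat \<Rightarrow> 'a \<Rightarrow> real"
  assumes meas: "\<And>i. i \<ge> 1 \<Longrightarrow> Y i \<in> borel_measurable M" and int: "integrable M (Y 1)"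
    and indep: "\<And>i j. i \<ge> 1 \<Longrightarrow> j \<ge> 1 \<Longrightarrow> i \<noteq> j \<Longrightarrow> indep_var borel (Y i) borel (Y j)"
    and distr: "\<And>i. i \<ge> 1 \<Longrightarrow> distr M borel (Y i) = distr M borel (Y 1)"
    and pos: "\<eta> > 0" "\<delta> > 0"
  shows "\<exists>N. \<forall>n\<ge>N. prob {\<omega> \<in> space M. \<bar>(\<Sum>i\<in>{1..n}. Y i \<omega>) - real n * expectation (Y 1)\<bar> > \<eta> * real n} \<le> \<delta>"
proof -
  define T where "T m v = (if \<bar>v\<bar> \<le> real m then v else 0)" for m :: nat and v :: real
  have T[measurable]: "T m \<in> borel_measurable borel" for m unfolding T_def by measurable
  have transfer: "expectation (\<lambda>\<omega>. f (Y i \<omega>)) = expectation (\<lambda>\<omega>. f (Y 1 \<omega>))"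
    if "i \<ge> 1" "f \<in> borel_measurable borel" for i and f :: "real \<Rightarrow> real"
    using integral_distr[OF meas[OF that(1)] that(2)] integral_distr[OF meas[of 1] that(2)] distr[OF that(1)] by simp
  have transfer_int: "integrable M (\<lambda>\<omega>. f (Y i \<omega>)) \<longleftrightarrow> integrable M (\<lambda>\<omega>. f (Y 1 \<omega>))"
    if "i \<ge> 1" "f \<in> borel_measurable borel" for i and f :: "real \<Rightarrow> real"
    using integrable_distr_eq[OF meas[OF that(1)] that(2)] integrable_distr_eq[OF meas[of 1] that(2)] distr[OF that(1)] by simp
  have meas1[measurable]: "Y 1 \<in> borel_measurable M" using meas by simp
  have "(\<lambda>m. expectation (\<lambda>\<omega>. \<bar>Y 1 \<omega> - T m (Y 1 \<omega>)\<bar>)) \<longlonglongrightarrow> expectation (\<lambda>\<omega>. 0)"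
  proof (rule integral_dominated_convergence[where w = "\<lambda>\<omega>. \<bar>Y 1 \<omega>\<bar>"])
    show "AE \<omega> in M. (\<lambda>m. \<bar>Y 1 \<omega> - T m (Y 1 \<omega>)\<bar>) \<longlonglongrightarrow> 0"
    proof (intro AE_I2 tendsto_eventually)
      fix \<omega>
      obtain m0 :: nat where "\<bar>Y 1 \<omega>\<bar> \<le> real m0" using real_arch_simple by blast
      then have "\<forall>m\<ge>m0. \<bar>Y 1 \<omega> - T m (Y 1 \<omega>)\<bar> = 0" by (auto simp: T_def)
      then show "\<forall>\<^sub>F m in sequentially. \<bar>Y 1 \<omega> - T m (Y 1 \<omega>)\<bar> = 0" unfolding eventually_sequentially by blast
    qed
  qed (use int in \<open>auto simp: T_def\<close>)
  then have "(\<lambda>m. expectation (\<lambda>\<omega>. \<bar>Y 1 \<omega> - T m (Y 1 \<omega>)\<bar>)) \<longlonglongrightarrow> 0" by simp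
  \<comment> \<open>The first bound limits the bias of the truncated mean to a quarter of the
    allowed deviation, the second makes Markov's inequality for the tails give probability at most
    \<open>\<delta> / 2\<close>.\<close>
  moreover have "min (\<eta> / 4) (\<eta> * \<delta> / 8) > 0" using pos by simp
  ultimately have "\<forall>\<^sub>F m in sequentially. expectation (\<lambda>\<omega>. \<bar>Y 1 \<omega> - T m (Y 1 \<omega>)\<bar>) < min (\<eta> / 4) (\<eta> * \<delta> / 8)"
    by (rule order_tendstoD)
  then obtain m where m: "expectation (\<lambda>\<omega>. \<bar>Y 1 \<omega> - T m (Y 1 \<omega>)\<bar>) < min (\<eta> / 4) (\<eta> * \<delta> / 8)"
    unfolding eventually_sequentially by blast
  define \<tau> where "\<tau> = expectation (\<lambda>\<omega>. \<bar>Y 1 \<omega> - T m (Y 1 \<omega>)\<bar>)"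
  define \<nu> where "\<nu> = expectation (\<lambda>\<omega>. T m (Y 1 \<omega>))"
  have Tb: "\<bar>T m v\<bar> \<le> real m" for v by (simp add: T_def)
  have T_int: "integrable M (\<lambda>\<omega>. T m (Y i \<omega>))" if "i \<ge> 1" for i
    using meas[OF that] Tb by (intro integrable_const_bound[where B = "real m"]) auto
  have "\<bar>expectation (Y 1) - \<nu>\<bar> = \<bar>expectation (\<lambda>\<omega>. Y 1 \<omega> - T m (Y 1 \<omega>))\<bar>"
    unfolding \<nu>_def using int T_int[of 1] by (subst Bochner_Integration.integral_diff) auto
  also have "\<dots> \<le> \<tau>" unfolding \<tau>_def by (rule integral_abs_bound)
  finally have mean: "\<bar>expectation (Y 1) - \<nu>\<bar> \<le> \<tau>" .
  define U where "U i \<omega> = T m (Y i \<omega>) - \<nu>" for i \<omega>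
  have \<nu>b: "\<bar>\<nu>\<bar> \<le> real m"
  proof -
    have "\<bar>\<nu>\<bar> \<le> expectation (\<lambda>\<omega>. \<bar>T m (Y 1 \<omega>)\<bar>)" unfolding \<nu>_def by (rule integral_abs_bound)
    also have "\<dots> \<le> expectation (\<lambda>\<omega>. real m)" using T_int[of 1] Tb by (intro integral_mono) auto
    finally show ?thesis by (simp add: prob_space)
  qed
  have Ub: "\<bar>U i \<omega>\<bar> \<le> 2 * real m" for i \<omega> using Tb[of "Y i \<omega>"] \<nu>b unfolding U_def by linarith
  have Usq: "(U i \<omega>)\<^sup>2 \<le> (2 * real m)\<^sup>2" for i \<omega> using power_mono[OF Ub[of i \<omega>], of 2] by simp
  have Um[measurable]: "U i \<in> borel_measurable M" if "i \<ge> 1" for i using meas[OF that] unfolding U_def by measurable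
  have U_int: "integrable M (U i)" if "i \<ge> 1" for i using T_int[OF that] by (simp add: U_def[abs_def])
  have U_mean: "expectation (U i) = 0" if "i \<ge> 1" for i
    using T_int[OF that] transfer[OF that T[of m]] by (simp add: U_def[abs_def] \<nu>_def prob_space)
  have U_uncor: "expectation (\<lambda>\<omega>. U i \<omega> * U j \<omega>) = 0" if "i \<ge> 1" "j \<ge> 1" "i \<noteq> j" for i j
  proof -
    have "indep_var borel ((\<lambda>v. T m v - \<nu>) \<circ> Y i) borel ((\<lambda>v. T m v - \<nu>) \<circ> Y j)"
      by (rule indep_var_compose[OF indep[OF that]]) measurable
    then have "indep_var borel (U i) borel (U j)" by (simp add: U_def[abs_def] comp_def)
    from indep_var_lebesgue_integral[OF this U_int[OF that(1)] U_int[OF that(2)]]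
    show ?thesis using U_mean that by simp
  qed
  have U_sq_int: "integrable M (\<lambda>\<omega>. (U i \<omega>)\<^sup>2)" if "i \<ge> 1" for i
    using Um[OF that] Usq by (intro integrable_const_bound[where B = "(2 * real m)\<^sup>2"]) auto
  have U_sq: "expectation (\<lambda>\<omega>. (U i \<omega>)\<^sup>2) \<le> (2 * real m)\<^sup>2" if "i \<ge> 1" for i
  proof -
    have "expectation (\<lambda>\<omega>. (U i \<omega>)\<^sup>2) \<le> expectation (\<lambda>\<omega>. (2 * real m)\<^sup>2)"
      using U_sq_int[OF that] Usq by (intro integral_mono) auto
    then show ?thesis by (simp add: prob_space)
  qed
  \<comment> \<open>Makes Chebyshev's bound for the centred truncated sum, at a quarter of the
    deviation, at most \<open>\<delta> / 2\<close>.\<close>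
  obtain N :: nat where N: "8 * (2 * real m)\<^sup>2 * 4 / (\<eta>\<^sup>2 * \<delta>) \<le> real N" using real_arch_simple by blast
  show ?thesis
  proof (intro exI allI impI)
    fix n assume n: "n \<ge> Suc N"
    then have n0: "real n > 0" by simp
    let ?t = "\<eta> * real n / 4"
    have t: "?t > 0" using pos n0 by simp
    let ?A = "{\<omega> \<in> space M. \<bar>\<Sum>i\<in>{1..n}. U i \<omega>\<bar> \<ge> ?t}"
    let ?R = "\<lambda>\<omega>. \<Sum>i\<in>{1..n}. \<bar>Y i \<omega> - T m (Y i \<omega>)\<bar>"
    let ?B = "{\<omega> \<in> space M. ?R \<omega> \<ge> ?t}"
    have mY: "(\<lambda>\<omega>. \<Sum>i\<in>{1..n}. f (Y i \<omega>)) \<in> borel_measurable M" if "f \<in> borel_measurable borel" for f :: "real \<Rightarrow> real"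
      using meas that by (intro borel_measurable_sum) auto
    have A: "prob ?A \<le> real (card {1..n}) * (2 * real m)\<^sup>2 / ?t\<^sup>2"
      using U_sq_int U_sq U_uncor Um t by (intro prob_uncorrelated_sum_ge) auto
    also have "\<dots> = 16 * (2 * real m)\<^sup>2 / (\<eta>\<^sup>2 * real n)"
      using n0 by (simp add: power_divide power_mult_distrib power2_eq_square)
    also have "\<dots> \<le> \<delta> / 2"
    proof -
      have "32 * (2 * real m)\<^sup>2 / (\<eta>\<^sup>2 * \<delta>) \<le> real n" using N n by simp
      then show ?thesis using pos n0 by (simp add: field_simps)
    qed
    finally have A: "prob ?A \<le> \<delta> / 2" .
    have dev_int: "integrable M (\<lambda>\<omega>. \<bar>Y i \<omega> - T m (Y i \<omega>)\<bar>)" if "i \<ge> 1" for i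
      using int T_int[of 1] by (subst transfer_int[OF that, of "\<lambda>v. \<bar>v - T m v\<bar>"]) auto
    have dev: "expectation (\<lambda>\<omega>. \<bar>Y i \<omega> - T m (Y i \<omega>)\<bar>) = \<tau>" if "i \<ge> 1" for i
      unfolding \<tau>_def by (rule transfer[OF that, of "\<lambda>v. \<bar>v - T m v\<bar>"]) measurable
    have "prob ?B \<le> expectation ?R / ?t"
      using t dev_int by (intro integral_Markov_inequality_measure[where A = "{}"])
        (auto intro!: Bochner_Integration.integrable_sum sum_nonneg)
    also have "expectation ?R = real n * \<tau>"
      using dev_int dev by (simp add: Bochner_Integration.integral_sum)
    also have "real n * \<tau> / ?t = 4 * \<tau> / \<eta>" using n0 by simp
    also have "\<dots> \<le> \<delta> / 2" using m pos unfolding \<tau>_def[symmetric] by (simp add: field_simps)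
    finally have B: "prob ?B \<le> \<delta> / 2" .
    have [measurable]: "(\<lambda>\<omega>. \<Sum>i\<in>{1..n}. U i \<omega>) \<in> borel_measurable M"
      unfolding U_def by (rule mY) measurable
    have [measurable]: "?R \<in> borel_measurable M" by (rule mY) measurable
    have events: "?A \<in> events" "?B \<in> events" by measurable
    show "prob {\<omega> \<in> space M. \<bar>(\<Sum>i\<in>{1..n}. Y i \<omega>) - real n * expectation (Y 1)\<bar> > \<eta> * real n} \<le> \<delta>"
      (is "prob ?C \<le> \<delta>")
    proof -
      have "?C \<subseteq> ?A \<union> ?B"
      proof (intro subsetI, rule ccontr)
        fix \<omega> assume \<omega>: "\<omega> \<in> ?C" "\<omega> \<notin> ?A \<union> ?B"
        \<comment> \<open>Truncated part, tails and bias: each is at most \<open>?t\<close>, and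
          three of these do not reach the deviation \<open>4 * ?t\<close>.\<close>
        have "(\<Sum>i\<in>{1..n}. Y i \<omega>) - real n * expectation (Y 1)
           = (\<Sum>i\<in>{1..n}. U i \<omega>) + (\<Sum>i\<in>{1..n}. Y i \<omega> - T m (Y i \<omega>)) + real n * (\<nu> - expectation (Y 1))"
          by (simp add: U_def sum_subtractf algebra_simps)
        moreover have "\<bar>\<Sum>i\<in>{1..n}. Y i \<omega> - T m (Y i \<omega>)\<bar> \<le> ?R \<omega>" by (rule sum_abs)
        moreover have "\<bar>real n * (\<nu> - expectation (Y 1))\<bar> \<le> real n * (\<eta> / 4)"
          unfolding abs_mult abs_minus_commute[of \<nu>]
          using mean m n0 unfolding \<tau>_def[symmetric] by (intro mult_mono) auto
        moreover have "\<bar>\<Sum>i\<in>{1..n}. U i \<omega>\<bar> < ?t" "?R \<omega> < ?t"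
          "\<bar>(\<Sum>i\<in>{1..n}. Y i \<omega>) - real n * expectation (Y 1)\<bar> > 4 * ?t"
          using \<omega> by auto
        moreover have "real n * (\<eta> / 4) = ?t" by simp
        ultimately show False using t by linarith
      qed
      then have "prob ?C \<le> prob (?A \<union> ?B)" using events by (intro finite_measure_mono) auto
      also have "\<dots> \<le> prob ?A + prob ?B" using events by (rule measure_Un_le)
      finally show ?thesis using A B by simp
    qed
  qed
qed

end

section \<open>The noise model\<close>

locale noise_model = prob_space M for M :: "'a measure" +
  fixes p :: nat and \<epsilon> :: "nat \<Rightarrow> nat \<Rightarrow> 'a \<Rightarrow> real" and \<sigma>2 :: real
  assumes indep: "indep_vars (\<lambda>_. borel) (\<lambda>(i, j). \<epsilon> i j) ({1..} \<times> {1..p})"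
    and ident: "\<And>i j. i \<ge> 1 \<Longrightarrow> j \<in> {1..p} \<Longrightarrow> distr M borel (\<epsilon> i j) = distr M borel (\<epsilon> 1 j)"
    and meas: "\<And>i j. i \<ge> 1 \<Longrightarrow> j \<in> {1..p} \<Longrightarrow> \<epsilon> i j \<in> borel_measurable M"
    and sq_int: "\<And>i j. i \<ge> 1 \<Longrightarrow> j \<in> {1..p} \<Longrightarrow> integrable M (\<lambda>\<omega>. (\<epsilon> i j \<omega>)\<^sup>2)"
    and mean: "\<And>i j. i \<ge> 1 \<Longrightarrow> j \<in> {1..p} \<Longrightarrow> expectation (\<epsilon> i j) = 0"
    and var: "\<And>i j. i \<ge> 1 \<Longrightarrow> j \<in> {1..p} \<Longrightarrow> expectation (\<lambda>\<omega>. (\<epsilon> i j \<omega>)\<^sup>2) = \<sigma>2"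
    and pos: "\<sigma>2 > 0"
begin

lemma noise_integrable: "i \<ge> 1 \<Longrightarrow> j \<in> {1..p} \<Longrightarrow> integrable M (\<epsilon> i j)"
  by (rule square_integrable_imp_integrable[OF meas sq_int])

lemma noise_pair_indep:
  assumes "i \<ge> 1" "j \<in> {1..p}" "i' \<ge> 1" "j' \<in> {1..p}" "(i, j) \<noteq> (i', j')"
  shows "indep_var borel (\<epsilon> i j) borel (\<epsilon> i' j')"
  using indep_vars_pair[OF indep, of "(i, j)" "(i', j')"] assms by simp

lemma noise_mult_integrable:
  assumes "i \<ge> 1" "j \<in> {1..p}" "i' \<ge> 1" "j' \<in> {1..p}"
  shows "integrable M (\<lambda>\<omega>. \<epsilon> i j \<omega> * \<epsilon> i' j' \<omega>)"
  using assms by (intro integrable_mult_of_squares meas sq_int)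

lemma noise_cov:
  assumes "i \<ge> 1" "a \<in> {1..p}" "b \<in> {1..p}"
  shows "expectation (\<lambda>\<omega>. \<epsilon> i a \<omega> * \<epsilon> i b \<omega>) = (if a = b then \<sigma>2 else 0)"
proof (cases "a = b")
  case True
  then show ?thesis using var[OF assms(1,2)] by (simp add: power2_eq_square)
next
  case False
  have "indep_var borel (\<epsilon> i a) borel (\<epsilon> i b)" using False assms by (intro noise_pair_indep) auto
  from indep_var_lebesgue_integral[OF this noise_integrable noise_integrable]
  show ?thesis using assms False mean by simp
qed

text \<open>The exact population counterpart of \<open>noise_form\<close>; it identifies expected
  squared residuals with \<open>rss p y\<close>.\<close>

lemma second_moment_combination:
  assumes "i \<ge> 1"
  shows "expectation (\<lambda>\<omega>. (\<Sum>a\<in>{1..p}. c a * \<epsilon> i a \<omega>)\<^sup>2) = \<sigma>2 * (\<Sum>a\<in>{1..p}. (c a)\<^sup>2)"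
proof -
  have "(\<Sum>a\<in>{1..p}. c a * \<epsilon> i a \<omega>)\<^sup>2 = (\<Sum>a\<in>{1..p}. \<Sum>b\<in>{1..p}. c a * c b * (\<epsilon> i a \<omega> * \<epsilon> i b \<omega>))" for \<omega>
    by (simp add: power2_eq_square sum_product mult_ac)
  note sq = this
  have int: "integrable M (\<lambda>\<omega>. c a * c b * (\<epsilon> i a \<omega> * \<epsilon> i b \<omega>))"
    if "a \<in> {1..p}" "b \<in> {1..p}" for a b
    by (rule integrable_mult_right) (rule noise_mult_integrable[OF assms that(1) assms that(2)])
  have "expectation (\<lambda>\<omega>. \<Sum>a\<in>{1..p}. \<Sum>b\<in>{1..p}. c a * c b * (\<epsilon> i a \<omega> * \<epsilon> i b \<omega>))
     = (\<Sum>a\<in>{1..p}. expectation (\<lambda>\<omega>. \<Sum>b\<in>{1..p}. c a * c b * (\<epsilon> i a \<omega> * \<epsilon> i b \<omega>)))"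
    by (intro Bochner_Integration.integral_sum Bochner_Integration.integrable_sum int)
  also have "\<dots> = (\<Sum>a\<in>{1..p}. \<Sum>b\<in>{1..p}. expectation (\<lambda>\<omega>. c a * c b * (\<epsilon> i a \<omega> * \<epsilon> i b \<omega>)))"
    by (rule sum.cong[OF refl], rule Bochner_Integration.integral_sum, rule int)
  finally have "expectation (\<lambda>\<omega>. \<Sum>a\<in>{1..p}. \<Sum>b\<in>{1..p}. c a * c b * (\<epsilon> i a \<omega> * \<epsilon> i b \<omega>))
     = (\<Sum>a\<in>{1..p}. \<Sum>b\<in>{1..p}. c a * c b * expectation (\<lambda>\<omega>. \<epsilon> i a \<omega> * \<epsilon> i b \<omega>))" by simp
  then have "expectation (\<lambda>\<omega>. (\<Sum>a\<in>{1..p}. c a * \<epsilon> i a \<omega>)\<^sup>2)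
     = (\<Sum>a\<in>{1..p}. \<Sum>b\<in>{1..p}. c a * c b * expectation (\<lambda>\<omega>. \<epsilon> i a \<omega> * \<epsilon> i b \<omega>))"
    unfolding sq .
  also have "\<dots> = (\<Sum>a\<in>{1..p}. \<Sum>b\<in>{1..p}. if b = a then \<sigma>2 * (c a)\<^sup>2 else 0)"
    by (intro sum.cong refl) (auto simp: noise_cov[OF assms] power2_eq_square)
  also have "\<dots> = \<sigma>2 * (\<Sum>a\<in>{1..p}. (c a)\<^sup>2)" by (simp add: sum_distrib_left)
  finally show ?thesis .
qed

text \<open>Independence of the two squares gives the product a second moment without fourth moments
  of the noise. This is what makes Chebyshev available off the diagonal.\<close>

lemma noise_product_second_moment:
  assumes "i \<ge> 1" "a \<in> {1..p}" "b \<in> {1..p}" "a \<noteq> b"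
  shows "integrable M (\<lambda>\<omega>. (\<epsilon> i a \<omega> * \<epsilon> i b \<omega>)\<^sup>2)"
    and "expectation (\<lambda>\<omega>. (\<epsilon> i a \<omega> * \<epsilon> i b \<omega>)\<^sup>2) = \<sigma>2\<^sup>2"
proof -
  have "indep_var borel (\<epsilon> i a) borel (\<epsilon> i b)" using assms by (intro noise_pair_indep) auto
  then have "indep_var borel ((\<lambda>v. v\<^sup>2) \<circ> \<epsilon> i a) borel ((\<lambda>v. v\<^sup>2) \<circ> \<epsilon> i b)"
    by (rule indep_var_compose) measurable
  then have ind: "indep_var borel (\<lambda>\<omega>. (\<epsilon> i a \<omega>)\<^sup>2) borel (\<lambda>\<omega>. (\<epsilon> i b \<omega>)\<^sup>2)" by (simp add: comp_def)
  show "integrable M (\<lambda>\<omega>. (\<epsilon> i a \<omega> * \<epsilon> i b \<omega>)\<^sup>2)"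
    using indep_var_integrable[OF ind sq_int sq_int] assms by (simp add: power_mult_distrib)
  show "expectation (\<lambda>\<omega>. (\<epsilon> i a \<omega> * \<epsilon> i b \<omega>)\<^sup>2) = \<sigma>2\<^sup>2"
    using indep_var_lebesgue_integral[OF ind sq_int sq_int] assms var
    by (simp add: power_mult_distrib power2_eq_square[of \<sigma>2])
qed

text \<open>The four variables have distinct indices, hence are jointly independent and
  centred.\<close>

lemma noise_products_uncorrelated:
  assumes "i \<ge> 1" "i' \<ge> 1" "i \<noteq> i'" "a \<in> {1..p}" "b \<in> {1..p}" "a \<noteq> b"
  shows "expectation (\<lambda>\<omega>. (\<epsilon> i a \<omega> * \<epsilon> i b \<omega>) * (\<epsilon> i' a \<omega> * \<epsilon> i' b \<omega>)) = 0"
proof -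
  let ?I = "{(i, a), (i, b), (i', a), (i', b)}" and ?X = "\<lambda>(i, j). \<epsilon> i j"
  have "indep_vars (\<lambda>_. borel) ?X ?I" by (rule indep_vars_subset[OF indep]) (use assms in auto)
  then have "expectation (\<lambda>\<omega>. \<Prod>k\<in>?I. ?X k \<omega>) = (\<Prod>k\<in>?I. expectation (?X k))"
    by (intro indep_vars_lebesgue_integral) (use assms noise_integrable in auto)
  also have "\<dots> = 0" using assms mean by simp
  finally show ?thesis using assms by (simp add: mult_ac)
qed

text \<open>Chebyshev off the diagonal, the weak law on it, and a union bound over the pairs of
  nodes. \<open>K\<close> may depend on \<open>\<delta>\<close> but not on \<open>n\<close>, as
  boundedness in probability demands.\<close>

lemma noise_gram_concentrates:
  assumes "\<eta> > 0" "\<delta> > 0" "p \<ge> 1"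
  shows "\<exists>K N. \<forall>n\<ge>N. \<exists>S\<in>events. prob S \<ge> 1 - \<delta> \<and> S \<subseteq> space M \<and>
     (\<forall>\<omega>\<in>S. \<forall>a\<in>{1..p}. \<forall>b\<in>{1..p}.
        \<bar>gram n (\<lambda>i a. \<epsilon> i a \<omega>) a b - (if a = b then real n * \<sigma>2 else 0)\<bar> \<le> \<eta> * real n \<and>
        (a \<noteq> b \<longrightarrow> \<bar>gram n (\<lambda>i a. \<epsilon> i a \<omega>) a b\<bar> \<le> K * sqrt (real n)))"
proof -
  \<comment> \<open>The share of each of the \<open>p\<close> squared pairs in the failure
    probability.\<close>
  define d where "d = \<delta> / (real p)\<^sup>2"
  have d: "d > 0" using assms by (simp add: d_def)
  \<comment> \<open>Chosen so that Chebyshev's bound, the square of \<open>\<sigma>2 / K\<close>,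
    equals \<open>d\<close>.\<close>
  define K where "K = \<sigma>2 / sqrt d"
  have K: "K > 0" using d pos by (simp add: K_def)
  let ?G = "\<lambda>n \<omega>. gram n (\<lambda>i a. \<epsilon> i a \<omega>)"
  have gm[measurable]: "(\<lambda>\<omega>. ?G n \<omega> a b) \<in> borel_measurable M" if "a \<in> {1..p}" "b \<in> {1..p}" for n a b
    unfolding gram_def using meas that by (intro borel_measurable_sum borel_measurable_times) auto
  have off: "prob {\<omega> \<in> space M. \<bar>?G n \<omega> a b\<bar> \<ge> K * sqrt (real n)} \<le> d"
    if n: "n \<ge> 1" and ab: "a \<in> {1..p}" "b \<in> {1..p}" "a \<noteq> b" for n a b
  proof -
    have "prob {\<omega> \<in> space M. \<bar>\<Sum>i\<in>{1..n}. \<epsilon> i a \<omega> * \<epsilon> i b \<omega>\<bar> \<ge> K * sqrt (real n)}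
       \<le> real (card {1..n}) * \<sigma>2\<^sup>2 / (K * sqrt (real n))\<^sup>2"
      using noise_product_second_moment[OF _ ab] noise_products_uncorrelated[OF _ _ _ ab] meas ab K n
      by (intro prob_uncorrelated_sum_ge) (auto intro!: borel_measurable_times)
    also have "\<dots> = \<sigma>2\<^sup>2 / K\<^sup>2" using n by (simp add: power_mult_distrib)
    also have "\<dots> = d" using d pos by (simp add: K_def power_divide)
    finally show ?thesis unfolding gram_def .
  qed
  have diag: "\<exists>N. \<forall>n\<ge>N. prob {\<omega> \<in> space M. \<bar>?G n \<omega> a a - real n * \<sigma>2\<bar> > \<eta> * real n} \<le> d"
    if a: "a \<in> {1..p}" for a
  proof -
    have "\<exists>N. \<forall>n\<ge>N. prob {\<omega> \<in> space M. \<bar>(\<Sum>i\<in>{1..n}. (\<epsilon> i a \<omega>)\<^sup>2) - real n * expectation (\<lambda>\<omega>. (\<epsilon> 1 a \<omega>)\<^sup>2)\<bar> > \<eta> * real n} \<le> d"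
    proof (rule weak_law_of_large_numbers)
      show "(\<lambda>\<omega>. (\<epsilon> i a \<omega>)\<^sup>2) \<in> borel_measurable M" if "i \<ge> 1" for i
        using meas[OF that a] by measurable
      show "integrable M (\<lambda>\<omega>. (\<epsilon> 1 a \<omega>)\<^sup>2)" using sq_int a by simp
      show "indep_var borel (\<lambda>\<omega>. (\<epsilon> i a \<omega>)\<^sup>2) borel (\<lambda>\<omega>. (\<epsilon> j a \<omega>)\<^sup>2)" if "i \<ge> 1" "j \<ge> 1" "i \<noteq> j" for i j
      proof -
        have "indep_var borel (\<epsilon> i a) borel (\<epsilon> j a)" using that a by (intro noise_pair_indep) auto
        then have "indep_var borel ((\<lambda>v. v\<^sup>2) \<circ> \<epsilon> i a) borel ((\<lambda>v. v\<^sup>2) \<circ> \<epsilon> j a)"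
          by (rule indep_var_compose) measurable
        then show ?thesis by (simp add: comp_def)
      qed
      show "distr M borel (\<lambda>\<omega>. (\<epsilon> i a \<omega>)\<^sup>2) = distr M borel (\<lambda>\<omega>. (\<epsilon> 1 a \<omega>)\<^sup>2)" if "i \<ge> 1" for i
      proof -
        have "distr M borel (\<lambda>\<omega>. (\<epsilon> i a \<omega>)\<^sup>2) = distr (distr M borel (\<epsilon> i a)) borel (\<lambda>v. v\<^sup>2)" if "i \<ge> 1" for i
          using meas[OF that a] by (subst distr_distr) (auto simp: comp_def)
        then show ?thesis using ident[OF that a] that by simp
      qed
    qed (use assms d in auto)
    then show ?thesis using var[of 1 a] a by (simp add: gram_def power2_eq_square)
  qed
  have "\<forall>a\<in>{1..p}. \<exists>N. \<forall>n\<ge>N. prob {\<omega> \<in> space M. \<bar>?G n \<omega> a a - real n * \<sigma>2\<bar> > \<eta> * real n} \<le> d"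
    by (intro ballI diag)
  from bchoice[OF this] obtain Nd where Nd: "\<And>a n. a \<in> {1..p} \<Longrightarrow> n \<ge> Nd a \<Longrightarrow>
      prob {\<omega> \<in> space M. \<bar>?G n \<omega> a a - real n * \<sigma>2\<bar> > \<eta> * real n} \<le> d"
    by blast
  \<comment> \<open>From here on \<open>K * sqrt (real n)\<close> is at most
    \<open>\<eta> * real n\<close>, so the off-diagonal event also delivers the common
    tolerance.\<close>
  obtain N0 :: nat where N0: "(K / \<eta>)\<^sup>2 \<le> real N0" using real_arch_simple by blast
  define N where "N = max (Suc N0) (Max (Nd ` {1..p}))"
  show ?thesis
  proof (intro exI[of _ K] exI[of _ N] allI impI)
    fix n assume n: "n \<ge> N"
    have n1: "n \<ge> 1" "n \<ge> N0" using n by (auto simp: N_def)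
    have nd: "n \<ge> Nd a" if "a \<in> {1..p}" for a
    proof -
      have "Nd a \<le> Max (Nd ` {1..p})" using that by (intro Max_ge) auto
      then show ?thesis using n by (simp add: N_def)
    qed
    define bad where "bad = (\<lambda>(a, b). if a = b then {\<omega> \<in> space M. \<bar>?G n \<omega> a a - real n * \<sigma>2\<bar> > \<eta> * real n}
        else {\<omega> \<in> space M. \<bar>?G n \<omega> a b\<bar> \<ge> K * sqrt (real n)})"
    have bad_meas: "bad k \<in> events" if "k \<in> {1..p} \<times> {1..p}" for k
      using that gm by (auto simp: bad_def)
    have bad_prob: "prob (bad k) \<le> d" if "k \<in> {1..p} \<times> {1..p}" for k
      using that Nd nd off[OF n1(1)] by (auto simp: bad_def)
    let ?B = "\<Union>k\<in>{1..p} \<times> {1..p}. bad k"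
    have B: "?B \<in> events" using bad_meas by (intro sets.finite_UN) auto
    have "prob ?B \<le> (\<Sum>k\<in>{1..p} \<times> {1..p}. prob (bad k))"
      using bad_meas by (intro measure_UNION_le) auto
    also have "\<dots> \<le> real (card ({1..p} \<times> {1..p})) * d" using bad_prob by (intro sum_bounded_above) auto
    also have "\<dots> = \<delta>" using assms by (simp add: d_def card_cartesian_product power2_eq_square)
    finally have pB: "prob ?B \<le> \<delta>" .
    have Kn: "K * sqrt (real n) \<le> \<eta> * real n"
    proof -
      have "(K / \<eta>)\<^sup>2 \<le> real n" using N0 n1(2) by (meson of_nat_mono order_trans)
      then have "K / \<eta> \<le> sqrt (real n)" by (rule real_le_rsqrt)
      then have "K \<le> \<eta> * sqrt (real n)" using assms(1) by (simp add: divide_le_eq mult.commute)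
      then have "K * sqrt (real n) \<le> \<eta> * sqrt (real n) * sqrt (real n)" by (rule mult_right_mono) simp
      then show ?thesis by (simp add: mult.assoc)
    qed
    show "\<exists>S\<in>events. prob S \<ge> 1 - \<delta> \<and> S \<subseteq> space M \<and>
     (\<forall>\<omega>\<in>S. \<forall>a\<in>{1..p}. \<forall>b\<in>{1..p}.
        \<bar>?G n \<omega> a b - (if a = b then real n * \<sigma>2 else 0)\<bar> \<le> \<eta> * real n \<and>
        (a \<noteq> b \<longrightarrow> \<bar>?G n \<omega> a b\<bar> \<le> K * sqrt (real n)))"
    proof (intro bexI[of _ "space M - ?B"] conjI ballI)
      show "prob (space M - ?B) \<ge> 1 - \<delta>" using prob_compl[OF B] pB by simp
      show "space M - ?B \<in> events" using B by auto
      fix \<omega> a b assume \<omega>: "\<omega> \<in> space M - ?B" and ab: "a \<in> {1..p}" "b \<in> {1..p}"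
      have nb: "\<omega> \<notin> bad (a, b)" using \<omega> ab by blast
      then show "\<bar>?G n \<omega> a b - (if a = b then real n * \<sigma>2 else 0)\<bar> \<le> \<eta> * real n"
        using \<omega> Kn by (auto simp: bad_def split: if_splits)
      show "a \<noteq> b \<longrightarrow> \<bar>?G n \<omega> a b\<bar> \<le> K * sqrt (real n)"
        using nb \<omega> by (auto simp: bad_def)
    qed auto
  qed
qed

end

section \<open>Residual risk as a population least squares problem\<close>

lemma INF_cmult_real:
  fixes f :: "'b \<Rightarrow> real"
  assumes "c > 0" "bdd_below (range f)"
  shows "(INF b. c * f b) = c * (INF b. f b)"
proof (rule antisym)
  have bdd: "bdd_below (range (\<lambda>b. c * f b))"
  proof -
    obtain m where "\<And>b. m \<le> f b" using assms(2) by (auto simp: bdd_below_def)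
    then show ?thesis using assms(1) by (intro bdd_belowI2[where m = "c * m"]) simp
  qed
  have "(INF b. c * f b) / c \<le> (INF b. f b)"
  proof (rule cINF_greatest)
    fix b
    have "(INF b. c * f b) \<le> c * f b" by (rule cINF_lower[OF bdd]) simp
    then show "(INF b. c * f b) / c \<le> f b" using assms(1) by (simp add: divide_le_eq mult.commute)
  qed simp
  then show "(INF b. c * f b) \<le> c * (INF b. f b)" using assms(1) by (simp add: divide_le_eq mult.commute)
  show "c * (INF b. f b) \<le> (INF b. c * f b)"
  proof (rule cINF_greatest)
    show "c * (INF b. f b) \<le> c * f b" for b
      using assms(1) cINF_lower[OF assms(2), of b] by simp
  qed simp
qed

text \<open>The noise variables of the first observation are orthogonal with squared norm
  \<open>\<sigma>2\<close>, so the mean square of a residual is \<open>\<sigma>2\<close> times the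
  sum of squares of its noise coefficients. The latter is \<open>rss p y\<close>, and the infima
  correspond.\<close>

lemma resid_risk_eq:
  assumes "noise_model M p \<epsilon> \<sigma>2" "linear_sem p Gs" "E \<in> DAGs p"
    and X: "\<And>j \<omega>. j \<in> {1..p} \<Longrightarrow> \<omega> \<in> space M \<Longrightarrow> X j \<omega> = (\<Sum>k\<in>pa Gs j. \<beta> (k, j) * X k \<omega>) + \<epsilon> 1 j \<omega>"
  shows "resid_risk M p X E = \<sigma>2 * (\<Sum>j\<in>{1..p}. lsq p (\<lambda>a k. linear_sem.L Gs \<beta> k a) (pa E j) j)"
proof -
  interpret noise_model M p \<epsilon> \<sigma>2 by fact
  interpret linear_sem p Gs \<beta> by fact
  have Xe: "X k \<omega> = (\<Sum>a\<in>{1..p}. L k a * \<epsilon> 1 a \<omega>)" if "k \<in> {1..p}" "\<omega> \<in> space M" for k \<omega>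
    by (rule L_solution[where x = "\<lambda>k. X k \<omega>"]) (use X that in auto)
  have "(\<integral>\<omega>. (X j \<omega> - (\<Sum>k\<in>pa E j. b k * X k \<omega>))\<^sup>2 \<partial>M) = \<sigma>2 * rss p y (pa E j) j b"
    if j: "j \<in> {1..p}" for j b
  proof -
    have "X j \<omega> - (\<Sum>k\<in>pa E j. b k * X k \<omega>) = (\<Sum>a\<in>{1..p}. (L j a - (\<Sum>k\<in>pa E j. b k * L k a)) * \<epsilon> 1 a \<omega>)"
      if \<omega>: "\<omega> \<in> space M" for \<omega>
    proof -
      have "(\<Sum>k\<in>pa E j. b k * X k \<omega>) = (\<Sum>k\<in>pa E j. \<Sum>a\<in>{1..p}. b k * L k a * \<epsilon> 1 a \<omega>)"
      proof (rule sum.cong[OF refl])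
        fix k assume "k \<in> pa E j"
        then have "k \<in> {1..p}" using pa_subset[OF assms(3)] by blast
        then show "b k * X k \<omega> = (\<Sum>a\<in>{1..p}. b k * L k a * \<epsilon> 1 a \<omega>)"
          unfolding Xe[OF \<open>k \<in> {1..p}\<close> \<omega>] sum_distrib_left by (simp only: mult.assoc)
      qed
      also have "\<dots> = (\<Sum>a\<in>{1..p}. (\<Sum>k\<in>pa E j. b k * L k a) * \<epsilon> 1 a \<omega>)"
        unfolding sum_distrib_right by (rule sum.swap)
      finally show ?thesis using Xe[OF j \<omega>] by (simp add: left_diff_distrib sum_subtractf)
    qed
    then have "(\<integral>\<omega>. (X j \<omega> - (\<Sum>k\<in>pa E j. b k * X k \<omega>))\<^sup>2 \<partial>M)
        = (\<integral>\<omega>. (\<Sum>a\<in>{1..p}. (L j a - (\<Sum>k\<in>pa E j. b k * L k a)) * \<epsilon> 1 a \<omega>)\<^sup>2 \<partial>M)"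
      by (intro Bochner_Integration.integral_cong refl) simp
    then show ?thesis unfolding second_moment_combination[OF order_refl] rss_def .
  qed
  then have "resid_risk M p X E = (\<Sum>j\<in>{1..p}. INF b. \<sigma>2 * rss p y (pa E j) j b)"
    unfolding resid_risk_def by simp
  also have "\<dots> = (\<Sum>j\<in>{1..p}. \<sigma>2 * lsq p y (pa E j) j)"
    unfolding lsq_def using pos by (intro sum.cong refl INF_cmult_real) (auto intro!: bdd_belowI2[where m = 0] rss_nonneg)
  finally show ?thesis by (simp add: sum_distrib_left)
qed

section \<open>Posterior concentration\<close>

lemma wpa1_mono:
  assumes "wpa1 M P" "\<And>n \<omega>. n \<ge> m \<Longrightarrow> \<omega> \<in> space M \<Longrightarrow> P n \<omega> \<Longrightarrow> Q n \<omega>"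
  shows "wpa1 M Q"
  unfolding wpa1_def
proof (intro allI impI)
  fix \<delta> :: real assume "\<delta> > 0"
  then obtain N where N: "\<forall>n\<ge>N. \<exists>S\<in>sets M. measure M S \<ge> 1 - \<delta> \<and> (\<forall>\<omega>\<in>S. P n \<omega>)"
    using assms(1) unfolding wpa1_def by blast
  show "\<exists>N. \<forall>n\<ge>N. \<exists>S\<in>sets M. measure M S \<ge> 1 - \<delta> \<and> (\<forall>\<omega>\<in>S. Q n \<omega>)"
  proof (intro exI[of _ "max N m"] allI impI)
    fix n assume n: "n \<ge> max N m"
    then obtain S where S: "S \<in> sets M" "measure M S \<ge> 1 - \<delta>" "\<forall>\<omega>\<in>S. P n \<omega>" using N by auto
    then have "\<forall>\<omega>\<in>S. Q n \<omega>" using assms(2) n sets.sets_into_space by fastforce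
    then show "\<exists>S\<in>sets M. measure M S \<ge> 1 - \<delta> \<and> (\<forall>\<omega>\<in>S. Q n \<omega>)" using S by blast
  qed
qed

lemma (in prob_space) wpa1_conj:
  assumes "wpa1 M P" "wpa1 M Q"
  shows "wpa1 M (\<lambda>n \<omega>. P n \<omega> \<and> Q n \<omega>)"
  unfolding wpa1_def
proof (intro allI impI)
  fix \<delta> :: real assume "\<delta> > 0"
  then have d: "\<delta> / 2 > 0" by simp
  obtain N1 where N1: "\<forall>n\<ge>N1. \<exists>S\<in>sets M. measure M S \<ge> 1 - \<delta> / 2 \<and> (\<forall>\<omega>\<in>S. P n \<omega>)"
    using assms(1) d unfolding wpa1_def by blast
  obtain N2 where N2: "\<forall>n\<ge>N2. \<exists>S\<in>sets M. measure M S \<ge> 1 - \<delta> / 2 \<and> (\<forall>\<omega>\<in>S. Q n \<omega>)"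
    using assms(2) d unfolding wpa1_def by blast
  show "\<exists>N. \<forall>n\<ge>N. \<exists>S\<in>sets M. measure M S \<ge> 1 - \<delta> \<and> (\<forall>\<omega>\<in>S. P n \<omega> \<and> Q n \<omega>)"
  proof (intro exI[of _ "max N1 N2"] allI impI)
    fix n assume n: "n \<ge> max N1 N2"
    obtain S where S: "S \<in> events" "prob S \<ge> 1 - \<delta> / 2" "\<forall>\<omega>\<in>S. P n \<omega>" using N1 n by auto
    obtain T where T: "T \<in> events" "prob T \<ge> 1 - \<delta> / 2" "\<forall>\<omega>\<in>T. Q n \<omega>" using N2 n by auto
    have "prob (S \<union> T) = prob S + prob T - prob (S \<inter> T)"
      using S(1) T(1) by (intro measure_Un3) (auto simp: fmeasurable_eq_sets)
    then have "prob (S \<inter> T) \<ge> 1 - \<delta>" using prob_le_1[of "S \<union> T"] S(2) T(2) by linarith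
    then show "\<exists>S\<in>events. prob S \<ge> 1 - \<delta> \<and> (\<forall>\<omega>\<in>S. P n \<omega> \<and> Q n \<omega>)"
      using S T by (intro bexI[of _ "S \<inter> T"]) auto
  qed
qed

lemma tendsto_zero_in_prob_iff_wpa1:
  "tendsto_zero_in_prob M B \<longleftrightarrow> (\<forall>e>0. wpa1 M (\<lambda>n \<omega>. \<bar>B n \<omega>\<bar> \<le> e))"
  unfolding tendsto_zero_in_prob_def wpa1_def by blast

text \<open>\<open>A\<close> is the positive part of the logarithm of
  \<open>sqrt (real n) * F n \<omega>\<close>. Cutting at 0 keeps it bounded where \<open>F\<close>
  is tiny or zero and only enlarges the upper bound.\<close>

lemma exp_bounded_in_prob_rate:
  assumes nonneg: "\<And>n \<omega>. F n \<omega> \<ge> 0"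
    and rate: "\<And>\<delta>. \<delta> > 0 \<Longrightarrow> \<exists>K N. \<forall>n\<ge>N. \<exists>S\<in>sets M. measure M S \<ge> 1 - \<delta> \<and> (\<forall>\<omega>\<in>S. F n \<omega> \<le> K / sqrt (real n))"
  obtains A where "bounded_in_prob M A" "\<And>n \<omega>. n \<ge> 1 \<Longrightarrow> F n \<omega> \<le> exp (A n \<omega>) / sqrt (real n)"
proof
  let ?A = "\<lambda>n \<omega>. max 0 (ln (sqrt (real n) * F n \<omega>))"
  show "F n \<omega> \<le> exp (?A n \<omega>) / sqrt (real n)" if n: "n \<ge> 1" for n \<omega>
  proof (cases "F n \<omega> > 0")
    case True
    then have p: "sqrt (real n) * F n \<omega> > 0" using n by simp
    then have "sqrt (real n) * F n \<omega> = exp (ln (sqrt (real n) * F n \<omega>))" by simp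
    also have "\<dots> \<le> exp (?A n \<omega>)" by simp
    finally show ?thesis using n by (simp add: le_divide_eq mult.commute)
  next
    case False
    then have "F n \<omega> = 0" using nonneg[of n \<omega>] by simp
    then show ?thesis by simp
  qed
  show "bounded_in_prob M ?A"
    unfolding bounded_in_prob_def
  proof (intro allI impI)
    fix \<delta> :: real assume "\<delta> > 0"
    from rate[OF this] obtain K N where N: "\<forall>n\<ge>N. \<exists>S\<in>sets M. measure M S \<ge> 1 - \<delta> \<and> (\<forall>\<omega>\<in>S. F n \<omega> \<le> K / sqrt (real n))" by blast
    \<comment> \<open>The absolute value covers constants below 1, whose logarithm is negative
      whereas \<open>?A\<close> is nonnegative.\<close>
    have "\<bar>?A n \<omega>\<bar> \<le> \<bar>ln K\<bar>" if "n \<ge> 1" "F n \<omega> \<le> K / sqrt (real n)" for n \<omega>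
    proof (cases "F n \<omega> > 0")
      case True
      then have p: "sqrt (real n) * F n \<omega> > 0" using that(1) by simp
      have "sqrt (real n) * F n \<omega> \<le> K" using that by (simp add: le_divide_eq mult.commute)
      then have "ln (sqrt (real n) * F n \<omega>) \<le> ln K" using p by simp
      then show ?thesis by simp
    next
      case False
      then have "F n \<omega> = 0" using nonneg[of n \<omega>] by simp
      then show ?thesis by simp
    qed
    then show "\<exists>K N. \<forall>n\<ge>N. \<exists>S\<in>sets M. measure M S \<ge> 1 - \<delta> \<and> (\<forall>\<omega>\<in>S. \<bar>?A n \<omega>\<bar> \<le> K)"
      using N by (intro exI[of _ "\<bar>ln K\<bar>"] exI[of _ "max N 1"]) (meson max.bounded_iff)
  qed
qed

text \<open>\<open>B\<close> is obtained by solving the claimed bound for the error in the exponent.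
  It is capped at 0, because a value of \<open>F\<close> far below the bound would otherwise make it
  large, and set to 0 where \<open>F\<close> vanishes. Rates for every fixed \<open>e\<close> then
  say that it tends to 0.\<close>

lemma exp_small_in_prob_rate:
  fixes \<delta> P \<kappa> :: real
  assumes nonneg: "\<And>n \<omega>. F n \<omega> \<ge> 0" and P: "P > 0"
    and rate: "\<And>e. e > 0 \<Longrightarrow> wpa1 M (\<lambda>n \<omega>. F n \<omega> \<le> exp (- (real n * P / 2) * (\<delta> - e)) * (1 + real n) powr \<kappa>)"
  obtains B where "tendsto_zero_in_prob M B"
    "\<And>n \<omega>. n \<ge> 1 \<Longrightarrow> F n \<omega> \<le> exp (- (real n * P / 2) * (\<delta> + B n \<omega>)) * (1 + real n) powr \<kappa>"
proof
  let ?l = "\<lambda>n \<omega>. ln (F n \<omega> / (1 + real n) powr \<kappa>)"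
  let ?B = "\<lambda>n \<omega>. if F n \<omega> > 0 then min 0 (- ?l n \<omega> / (real n * P / 2) - \<delta>) else 0"
  show "F n \<omega> \<le> exp (- (real n * P / 2) * (\<delta> + ?B n \<omega>)) * (1 + real n) powr \<kappa>" if n: "n \<ge> 1" for n \<omega>
  proof (cases "F n \<omega> > 0")
    case True
    have h: "real n * P / 2 > 0" using n P by simp
    have pw: "(1 + real n) powr \<kappa> > 0" by simp
    have "(real n * P / 2) * (\<delta> + ?B n \<omega>) \<le> (real n * P / 2) * (- ?l n \<omega> / (real n * P / 2))"
      using h True by (intro mult_left_mono) auto
    also have "\<dots> = - ?l n \<omega>" using n P by simp
    finally have "exp (?l n \<omega>) \<le> exp (- (real n * P / 2) * (\<delta> + ?B n \<omega>))" by simp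
    then have "F n \<omega> / (1 + real n) powr \<kappa> \<le> exp (- (real n * P / 2) * (\<delta> + ?B n \<omega>))"
      using True pw by simp
    then show ?thesis using pw by (simp add: divide_le_eq)
  next
    case False
    then have "F n \<omega> = 0" using nonneg[of n \<omega>] by simp
    then show ?thesis by simp
  qed
  show "tendsto_zero_in_prob M ?B"
    unfolding tendsto_zero_in_prob_iff_wpa1
  proof (intro allI impI)
    fix e :: real assume e: "e > 0"
    show "wpa1 M (\<lambda>n \<omega>. \<bar>?B n \<omega>\<bar> \<le> e)"
    proof (rule wpa1_mono[OF rate[OF e], where m = 1])
      fix n :: nat and \<omega> assume n: "n \<ge> 1" and le: "F n \<omega> \<le> exp (- (real n * P / 2) * (\<delta> - e)) * (1 + real n) powr \<kappa>"
      have h: "real n * P / 2 > 0" using n P by simp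
      have pw: "(1 + real n) powr \<kappa> > 0" by simp
      show "\<bar>?B n \<omega>\<bar> \<le> e"
      proof (cases "F n \<omega> > 0")
        case True
        have "F n \<omega> / (1 + real n) powr \<kappa> \<le> exp (- (real n * P / 2) * (\<delta> - e))"
          using le pw by (simp add: divide_le_eq)
        then have "?l n \<omega> \<le> ln (exp (- (real n * P / 2) * (\<delta> - e)))"
          using True pw by (intro ln_le_cancel_iff[THEN iffD2]) auto
        then have "?l n \<omega> \<le> - (real n * P / 2) * (\<delta> - e)" by (simp only: ln_exp)
        then have "(real n * P / 2) * (\<delta> - e) \<le> - ?l n \<omega>" by simp
        then have "\<delta> - e \<le> - ?l n \<omega> / (real n * P / 2)" by (simp only: pos_le_divide_eq[OF h] mult.commute[of "\<delta> - e"])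
        then have "- e \<le> min 0 (- ?l n \<omega> / (real n * P / 2) - \<delta>)" using e by simp
        moreover have "\<bar>min 0 v\<bar> \<le> e" if "- e \<le> min 0 v" for v :: real using that by linarith
        ultimately show ?thesis using True by simp
      qed (use e in simp)
    qed
  qed
qed

lemma exp_powr_tendsto_0:
  fixes c \<kappa> :: real
  assumes "c > 0"
  shows "(\<lambda>n. exp (- c * real n) * (1 + real n) powr \<kappa>) \<longlonglongrightarrow> 0"
  using assms by real_asymp

text \<open>Shrinking the total weight to \<open>f a\<close> turns the remaining mass into a sum of
  ratios against one element, in which common constants cancel.\<close>

lemma weight_fraction_bounds:
  fixes f :: "'b \<Rightarrow> real"
  assumes "finite D" "a \<in> D" "\<And>b. b \<in> D \<Longrightarrow> f b \<ge> 0" "f a > 0"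
  shows "f a / sum f D \<le> 1" and "1 - f a / sum f D \<le> (\<Sum>b\<in>D - {a}. f b / f a)"
proof -
  have D: "sum f D = f a + sum f (D - {a})" using assms by (simp add: sum.remove)
  have r: "sum f (D - {a}) \<ge> 0" using assms by (intro sum_nonneg) auto
  show "f a / sum f D \<le> 1" using D r assms(4) by simp
  have "1 - f a / sum f D = sum f (D - {a}) / sum f D" using D r assms(4) by (simp add: field_simps)
  also have "\<dots> \<le> sum f (D - {a}) / f a" using D r assms(4) by (intro divide_left_mono) auto
  finally show "1 - f a / sum f D \<le> (\<Sum>b\<in>D - {a}. f b / f a)" by (simp add: sum_divide_distrib)
qed

lemma finite_DAGs: "finite (DAGs p)"
  by (rule finite_subset[of _ "Pow ({1..p} \<times> {1..p})"]) (auto simp: DAGs_def)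

text \<open>An additional edge would join a pair that is already adjacent, in the opposite
  direction, and form a 2-cycle.\<close>

lemma complete_DAG_maximal:
  assumes "complete_DAG p G" "E \<in> DAGs p" "G \<subseteq> E"
  shows "E = G"
proof (rule ccontr)
  assume "E \<noteq> G"
  then obtain k j where kj: "(k, j) \<in> E" "(k, j) \<notin> G" using assms(3) by auto
  have "k \<in> {1..p}" "j \<in> {1..p}" "k \<noteq> j"
    using kj(1) assms(2) not_in_pa_self[OF assms(2), of j] by (auto simp: DAGs_def pa_def)
  then have "(j, k) \<in> E" using assms(1,3) kj(2) unfolding complete_DAG_def by blast
  with kj(1) have "(k, k) \<in> E\<^sup>+" by (meson trancl.simps)
  then show False using DAGs_acyclic[OF assms(2)] by (simp add: acyclic_def)
qed

theorem theorem2: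
  fixes M :: "'a measure" and p :: nat and Gs :: graph and \<beta> :: "nat \<times> nat \<Rightarrow> real"
    and \<epsilon> X :: "nat \<Rightarrow> nat \<Rightarrow> 'a \<Rightarrow> real" and \<sigma>2 :: real
    and pri :: "graph \<Rightarrow> real" and C :: real
  assumes "prob_space M" and "p \<ge> 1"
    and "Gs \<in> DAGs p"
    and "\<forall>e\<in>Gs. \<beta> e \<noteq> 0"
    and "prob_space.indep_vars M (\<lambda>_. borel) (\<lambda>(i, j). \<epsilon> i j) ({1..} \<times> {1..p})"
    and "\<forall>i\<ge>1. \<forall>j\<in>{1..p}. distr M borel (\<epsilon> i j) = distr M borel (\<epsilon> 1 j)"
    and "\<forall>i\<ge>1. \<forall>j\<in>{1..p}. \<epsilon> i j \<in> borel_measurable M \<and> integrable M (\<lambda>\<omega>. (\<epsilon> i j \<omega>)\<^sup>2)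
           \<and> (\<integral>\<omega>. \<epsilon> i j \<omega> \<partial>M) = 0
           \<and> (\<integral>\<omega>. (\<epsilon> i j \<omega> - (\<integral>\<omega>'. \<epsilon> i j \<omega>' \<partial>M))\<^sup>2 \<partial>M) = \<sigma>2"
    and "\<sigma>2 > 0"
    and "\<forall>i\<ge>1. \<forall>j\<in>{1..p}. X i j \<in> borel_measurable M"
    and "\<forall>i\<ge>1. \<forall>j\<in>{1..p}. \<forall>\<omega>\<in>space M.
           X i j \<omega> = (\<Sum>k\<in>pa Gs j. \<beta> (k, j) * X i k \<omega>) + \<epsilon> i j \<omega>"
    and "\<forall>G\<in>DAGs p. pri G > 0" and "(\<Sum>G\<in>DAGs p. pri G) = 1"
    and "C > 0" and "\<forall>G\<in>DAGs p. \<forall>G'\<in>DAGs p. pri G / pri G' \<le> C"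
  shows
    "let post = (\<lambda>n \<omega>. posterior pri (real n) p n (\<lambda>i j. X i j \<omega>) Gs);
         Bad = {G \<in> DAGs p. \<not> Gs \<subseteq> G};
         \<delta> = Min ((\<lambda>G. ln (resid_risk M p (X 1) G)) ` Bad) - ln (real p * \<sigma>2);
         T2 = (\<lambda>(B :: nat \<Rightarrow> 'a \<Rightarrow> real) n \<omega>. if Bad = {} then 0 else
                 exp (- (real n * real p / 2) * (\<delta> + B n \<omega>)) * (1 + real n) powr (real (card Gs) / 2))
     in (Bad \<noteq> {} \<longrightarrow> \<delta> > 0)
      \<and> (\<exists>A B. bounded_in_prob M A \<and> tendsto_zero_in_prob M B \<and>
           wpa1 M (\<lambda>n \<omega>. 1 - post n \<omega> \<le> exp (A n \<omega>) / sqrt (real n) + T2 B n \<omega>))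
      \<and> (complete_DAG p Gs \<longrightarrow> (\<exists>B. tendsto_zero_in_prob M B \<and>
           wpa1 M (\<lambda>n \<omega>. 1 - post n \<omega> \<le> T2 B n \<omega>)))
      \<and> tendsto_zero_in_prob M (\<lambda>n \<omega>. post n \<omega> - 1)"
proof -
  interpret noise_model M p \<epsilon> \<sigma>2
  proof (intro noise_model.intro noise_model_axioms.intro)
    show "prob_space M" by fact
    show "prob_space.indep_vars M (\<lambda>_. borel) (\<lambda>(i, j). \<epsilon> i j) ({1..} \<times> {1..p})" by fact
    show "distr M borel (\<epsilon> i j) = distr M borel (\<epsilon> 1 j)" if "i \<ge> 1" "j \<in> {1..p}" for i j
      using assms(6) that by blast
    fix i j assume ij: "i \<ge> (1::nat)" "j \<in> {1..p}"
    note a = assms(7)[rule_format, OF ij]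
    show "\<epsilon> i j \<in> borel_measurable M" "integrable M (\<lambda>\<omega>. (\<epsilon> i j \<omega>)\<^sup>2)"
      and zero: "(\<integral>\<omega>. \<epsilon> i j \<omega> \<partial>M) = 0"
      using a by blast+
    show "(\<integral>\<omega>. (\<epsilon> i j \<omega>)\<^sup>2 \<partial>M) = \<sigma>2"
      using a[THEN conjunct2, THEN conjunct2, THEN conjunct2] unfolding zero by simp
  qed fact
  interpret linear_sem p Gs \<beta> by unfold_locales fact
  have p0: "real p > 0" using \<open>p \<ge> 1\<close> by simp
  define x where "x \<omega> = (\<lambda>i j. X i j \<omega>)" for \<omega>
  define e where "e \<omega> = (\<lambda>i a. \<epsilon> i a \<omega>)" for \<omega>
  define m where "m n \<omega> E = marg_lik (real n) p n E (x \<omega>) * pri E" for n \<omega> E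
  define post where "post n \<omega> = posterior pri (real n) p n (\<lambda>i j. X i j \<omega>) Gs" for n \<omega>
  define Bad where "Bad = {G \<in> DAGs p. \<not> Gs \<subseteq> G}"
  define Supersets where "Supersets = {G \<in> DAGs p. Gs \<subset> G}"
  define \<delta> where "\<delta> = Min ((\<lambda>G. ln (resid_risk M p (X 1) G)) ` Bad) - ln (real p * \<sigma>2)"
  define \<kappa> where "\<kappa> = real (card Gs) / 2"
  define SG where "SG n \<omega> = (\<Sum>E\<in>Supersets. m n \<omega> E / m n \<omega> Gs)" for n \<omega>
  define SB where "SB n \<omega> = (\<Sum>E\<in>Bad. m n \<omega> E / m n \<omega> Gs)" for n \<omega>
  \<comment> \<open>Number of graphs times the worst prior ratio: the price of passing from single
    marginal likelihood ratios to posterior sums.\<close>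
  define c where "c = real (card (DAGs p)) * C"
  have finB: "finite Bad" and finS: "finite Supersets" using finite_DAGs by (auto simp: Bad_def Supersets_def)
  have pri: "pri E > 0" if "E \<in> DAGs p" for E using assms(11) that by blast
  have m_nonneg: "m n \<omega> E \<ge> 0" if "E \<in> DAGs p" for n \<omega> E
    using pri[OF that] by (simp add: m_def marg_lik_def)
  have SG_nonneg: "SG n \<omega> \<ge> 0" for n \<omega>
    unfolding SG_def by (intro sum_nonneg divide_nonneg_nonneg m_nonneg) (auto simp: Supersets_def DAG)
  have SB_nonneg: "SB n \<omega> \<ge> 0" for n \<omega>
    unfolding SB_def by (intro sum_nonneg divide_nonneg_nonneg m_nonneg) (auto simp: Bad_def DAG)
  have weights_le: "(\<Sum>E\<in>T. m n \<omega> E / m n \<omega> Gs) \<le> c * r"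
    if T: "T \<subseteq> DAGs p" and r: "r \<ge> 0" "\<And>E. E \<in> T \<Longrightarrow> marg_lik (real n) p n E (x \<omega>) / marg_lik (real n) p n Gs (x \<omega>) \<le> r" for T r n \<omega>
  proof -
    have "(\<Sum>E\<in>T. m n \<omega> E / m n \<omega> Gs) \<le> (\<Sum>E\<in>T. r * C)"
    proof (rule sum_mono)
      fix E assume E: "E \<in> T"
      have "m n \<omega> E / m n \<omega> Gs = (marg_lik (real n) p n E (x \<omega>) / marg_lik (real n) p n Gs (x \<omega>)) * (pri E / pri Gs)"
        by (simp add: m_def)
      also have "\<dots> \<le> r * C"
        using r E T assms(14) DAG pri by (intro mult_mono divide_nonneg_nonneg) (auto simp: less_imp_le subset_iff)
      finally show "m n \<omega> E / m n \<omega> Gs \<le> r * C" .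
    qed
    also have "\<dots> = real (card T) * (r * C)" by simp
    also have "\<dots> \<le> real (card (DAGs p)) * (r * C)"
      using T r(1) \<open>C > 0\<close> card_mono[OF finite_DAGs T] by (intro mult_right_mono) auto
    finally show ?thesis by (simp add: c_def mult_ac)
  qed
  have c0: "c \<ge> 0" using \<open>C > 0\<close> by (simp add: c_def)
  \<comment> \<open>One event supplies both the tolerance \<open>\<eta>\<close> and the bound on the
    cross moments, so a single outcome can be fed into the deterministic estimates. The threshold is
    at least 2, as \<open>sem_data\<close> demands.\<close>
  have event: "\<exists>K N. \<forall>n\<ge>N. \<exists>S\<in>events. prob S \<ge> 1 - d \<and>
      (\<forall>\<omega>\<in>S. sem_data p Gs \<beta> n (x \<omega>) (e \<omega>) \<sigma>2 \<eta> \<and>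
        (\<forall>a\<in>{1..p}. \<forall>b\<in>{1..p}. a \<noteq> b \<longrightarrow> \<bar>gram n (e \<omega>) a b\<bar> \<le> K * sqrt (real n)))"
    if d: "d > 0" and \<eta>: "\<eta> > 0" "\<eta> * real p \<le> \<sigma>2 / 2" for d \<eta>
  proof -
    from noise_gram_concentrates[OF \<eta>(1) d \<open>p \<ge> 1\<close>, folded e_def]
    obtain K N where N: "\<forall>n\<ge>N. \<exists>S\<in>events. prob S \<ge> 1 - d \<and> S \<subseteq> space M \<and>
       (\<forall>\<omega>\<in>S. \<forall>a\<in>{1..p}. \<forall>b\<in>{1..p}.
        \<bar>gram n (e \<omega>) a b - (if a = b then real n * \<sigma>2 else 0)\<bar> \<le> \<eta> * real n \<and>
        (a \<noteq> b \<longrightarrow> \<bar>gram n (e \<omega>) a b\<bar> \<le> K * sqrt (real n)))" by blast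
    show ?thesis
    proof (intro exI[of _ K] exI[of _ "max N 2"] allI impI)
      fix n assume n: "n \<ge> max N 2"
      then obtain S where S: "S \<in> events" "prob S \<ge> 1 - d" "S \<subseteq> space M"
        "\<And>\<omega> a b. \<omega> \<in> S \<Longrightarrow> a \<in> {1..p} \<Longrightarrow> b \<in> {1..p} \<Longrightarrow>
          \<bar>gram n (e \<omega>) a b - (if a = b then real n * \<sigma>2 else 0)\<bar> \<le> \<eta> * real n \<and>
          (a \<noteq> b \<longrightarrow> \<bar>gram n (e \<omega>) a b\<bar> \<le> K * sqrt (real n))"
        using N by (metis (no_types, lifting) max.bounded_iff)
      have "sem_data p Gs \<beta> n (x \<omega>) (e \<omega>) \<sigma>2 \<eta>" if \<omega>: "\<omega> \<in> S" for \<omega>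
      proof unfold_locales
        show "x \<omega> i k = (\<Sum>l\<in>pa Gs k. \<beta> (l, k) * x \<omega> i l) + e \<omega> i k" if "i \<in> {1..n}" "k \<in> {1..p}" for i k
          using assms(10) that \<omega> S(3) by (auto simp: x_def e_def)
        show "\<bar>gram n (e \<omega>) a b - (if a = b then real n * \<sigma>2 else 0)\<bar> \<le> \<eta> * real n" if "a \<in> {1..p}" "b \<in> {1..p}" for a b
          using S(4)[OF \<omega> that] by blast
      qed (use n \<open>p \<ge> 1\<close> \<eta> pos in auto)
      then show "\<exists>S\<in>events. prob S \<ge> 1 - d \<and>
      (\<forall>\<omega>\<in>S. sem_data p Gs \<beta> n (x \<omega>) (e \<omega>) \<sigma>2 \<eta> \<and>
        (\<forall>a\<in>{1..p}. \<forall>b\<in>{1..p}. a \<noteq> b \<longrightarrow> \<bar>gram n (e \<omega>) a b\<bar> \<le> K * sqrt (real n)))"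
        using S by (intro bexI[of _ S]) auto
    qed
  qed
  \<comment> \<open>The largest tolerance that \<open>sem_data\<close> admits, for the places where
    no accuracy is asked for.\<close>
  define \<eta>0 where "\<eta>0 = \<sigma>2 / (2 * real p)"
  have \<eta>0: "\<eta>0 > 0" "\<eta>0 * real p \<le> \<sigma>2 / 2" using pos p0 by (auto simp: \<eta>0_def)
  have data_event: "wpa1 M (\<lambda>n \<omega>. sem_data p Gs \<beta> n (x \<omega>) (e \<omega>) \<sigma>2 \<eta>)"
    if "\<eta> > 0" "\<eta> * real p \<le> \<sigma>2 / 2" for \<eta>
    unfolding wpa1_def using event[OF _ that] by meson
  have post_bound: "wpa1 M (\<lambda>n \<omega>. post n \<omega> \<le> 1 \<and> 1 - post n \<omega> \<le> SG n \<omega> + SB n \<omega>)"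
  proof (rule wpa1_mono[OF data_event[OF \<eta>0], where m = 0])
    fix n \<omega> assume "sem_data p Gs \<beta> n (x \<omega>) (e \<omega>) \<sigma>2 \<eta>0"
    then interpret D: sem_data p Gs \<beta> n "x \<omega>" "e \<omega>" \<sigma>2 \<eta>0 .
    have "m n \<omega> Gs > 0"
      unfolding m_def using marg_lik_ratio(1)[OF DAG DAG \<open>p \<ge> 1\<close> D.n2 D.posdef_gram] pri[OF DAG] by simp
    note b = weight_fraction_bounds[where f = "m n \<omega>", OF finite_DAGs DAG m_nonneg this]
    have "DAGs p - {Gs} = Supersets \<union> Bad" "Supersets \<inter> Bad = {}" by (auto simp: Supersets_def Bad_def)
    then have "(\<Sum>E\<in>DAGs p - {Gs}. m n \<omega> E / m n \<omega> Gs) = SG n \<omega> + SB n \<omega>"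
      using finB finS by (simp add: SG_def SB_def sum.union_disjoint)
    moreover have "post n \<omega> = m n \<omega> Gs / sum (m n \<omega>) (DAGs p)"
      by (simp add: post_def posterior_def m_def x_def)
    ultimately show "post n \<omega> \<le> 1 \<and> 1 - post n \<omega> \<le> SG n \<omega> + SB n \<omega>" using b by simp
  qed
  have SG_rate: "\<exists>K N. \<forall>n\<ge>N. \<exists>S\<in>events. prob S \<ge> 1 - d \<and> (\<forall>\<omega>\<in>S. SG n \<omega> \<le> K / sqrt (real n))"
    if d: "d > 0" for d
  proof -
    from event[OF d \<eta>0] obtain K N where N: "\<And>n. n \<ge> N \<Longrightarrow> \<exists>S\<in>events. prob S \<ge> 1 - d \<and>
      (\<forall>\<omega>\<in>S. sem_data p Gs \<beta> n (x \<omega>) (e \<omega>) \<sigma>2 \<eta>0 \<and>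
        (\<forall>a\<in>{1..p}. \<forall>b\<in>{1..p}. a \<noteq> b \<longrightarrow> \<bar>gram n (e \<omega>) a b\<bar> \<le> K * sqrt (real n)))" by blast
    let ?r = "exp (2 * (real p)\<^sup>2 * K\<^sup>2 / \<sigma>2\<^sup>2)"
    have "SG n \<omega> \<le> c * ?r / sqrt (real n)"
      if "sem_data p Gs \<beta> n (x \<omega>) (e \<omega>) \<sigma>2 \<eta>0" "\<forall>a\<in>{1..p}. \<forall>b\<in>{1..p}. a \<noteq> b \<longrightarrow> \<bar>gram n (e \<omega>) a b\<bar> \<le> K * sqrt (real n)" for n \<omega>
    proof -
      interpret D: sem_data p Gs \<beta> n "x \<omega>" "e \<omega>" \<sigma>2 \<eta>0 by fact
      have "SG n \<omega> \<le> c * (?r / sqrt (real n))"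
        unfolding SG_def
      proof (rule weights_le)
        show "marg_lik (real n) p n E (x \<omega>) / marg_lik (real n) p n Gs (x \<omega>) \<le> ?r / sqrt (real n)" if "E \<in> Supersets" for E
          using that \<open>\<forall>a\<in>{1..p}. \<forall>b\<in>{1..p}. a \<noteq> b \<longrightarrow> \<bar>gram n (e \<omega>) a b\<bar> \<le> K * sqrt (real n)\<close>
          by (intro D.marg_ratio_superset) (auto simp: Supersets_def)
      qed (auto simp: Supersets_def)
      then show ?thesis by simp
    qed
    then show ?thesis using N by (intro exI[of _ "c * ?r"] exI[of _ N]) meson
  qed
  have risk: "resid_risk M p (X 1) E = \<sigma>2 * (\<Sum>j\<in>{1..p}. lsq p y (pa E j) j)" if "E \<in> DAGs p" for E
    using assms(10) that by (intro resid_risk_eq) (unfold_locales, auto)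
  have gap: "\<delta> \<le> ln ((\<Sum>j\<in>{1..p}. lsq p y (pa E j) j) / real p)" if "E \<in> Bad" for E
  proof -
    have E: "E \<in> DAGs p" using that by (simp add: Bad_def)
    have R: "(\<Sum>j\<in>{1..p}. lsq p y (pa E j) j) > 0" using sum_lsq_ge(1)[OF E] p0 by linarith
    have "\<delta> \<le> ln (resid_risk M p (X 1) E) - ln (real p * \<sigma>2)"
      unfolding \<delta>_def using finB that by (intro diff_right_mono Min_le) auto
    also have "\<dots> = ln ((\<Sum>j\<in>{1..p}. lsq p y (pa E j) j) / real p)"
      unfolding risk[OF E] using R pos p0 by (simp add: ln_mult ln_div)
    finally show ?thesis .
  qed
  have \<delta>_pos: "\<delta> > 0" if "Bad \<noteq> {}"
  proof -
    have "ln (real p * \<sigma>2) < ln (resid_risk M p (X 1) E)" if "E \<in> Bad" for E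
    proof -
      have E: "E \<in> DAGs p" "\<not> Gs \<subseteq> E" using that by (auto simp: Bad_def)
      have "real p * \<sigma>2 < resid_risk M p (X 1) E"
        unfolding risk[OF E(1)] using sum_lsq_gt[OF assms(4) E] pos by (simp add: mult.commute)
      moreover have "real p * \<sigma>2 > 0" using pos p0 by simp
      ultimately show ?thesis by (intro ln_less_cancel_iff[THEN iffD2]) linarith+
    qed
    then have "ln (real p * \<sigma>2) < Min ((\<lambda>G. ln (resid_risk M p (X 1) G)) ` Bad)"
      using finB \<open>Bad \<noteq> {}\<close> by simp
    then show ?thesis by (simp add: \<delta>_def)
  qed
  have SB_rate: "wpa1 M (\<lambda>n \<omega>. SB n \<omega> \<le> exp (- (real n * real p / 2) * (\<delta> - s)) * (1 + real n) powr \<kappa>)"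
    if s: "s > 0" for s
  proof -
    \<comment> \<open>The slack \<open>s\<close> is halved: \<open>marg_ratio_general\<close> is
      applied with \<open>s / 2\<close>, whence the 16, and the other half absorbs the factor
      \<open>c\<close>.\<close>
    define \<eta> where "\<eta> = min \<eta>0 (s * \<sigma>2 / (16 * real p))"
    have \<eta>: "\<eta> > 0" "\<eta> * real p \<le> \<sigma>2 / 2" "8 * \<eta> * real p \<le> s / 2 * \<sigma>2"
    proof -
      show "\<eta> > 0" using \<eta>0(1) s pos p0 by (simp add: \<eta>_def)
      have "\<eta> * real p \<le> \<eta>0 * real p" by (intro mult_right_mono) (auto simp: \<eta>_def)
      then show "\<eta> * real p \<le> \<sigma>2 / 2" using \<eta>0(2) by simp
      have "\<eta> * real p \<le> s * \<sigma>2 / (16 * real p) * real p" by (intro mult_right_mono) (auto simp: \<eta>_def)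
      also have "\<dots> = s * \<sigma>2 / 16" using p0 by simp
      finally show "8 * \<eta> * real p \<le> s / 2 * \<sigma>2" by simp
    qed
    let ?\<Lambda> = "\<Sum>j\<in>{1..p}. gram p y j j"
    obtain N1 :: nat where N1: "4 * ?\<Lambda> / (s * real p) \<le> real N1" using real_arch_simple by blast
    \<comment> \<open>For such \<open>n\<close> the constant \<open>c\<close> is at most the second
      half of the slack in the exponent, hence at most its exponential.\<close>
    obtain N2 :: nat where N2: "4 * c / (s * real p) \<le> real N2" using real_arch_simple by blast
    show ?thesis
    proof (rule wpa1_mono[OF data_event[OF \<eta>(1,2)], where m = "max N1 N2"])
      fix n \<omega> assume n: "n \<ge> max N1 N2" and "sem_data p Gs \<beta> n (x \<omega>) (e \<omega>) \<sigma>2 \<eta>"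
      then interpret D: sem_data p Gs \<beta> n "x \<omega>" "e \<omega>" \<sigma>2 \<eta> by simp
      have "4 * ?\<Lambda> / (s * real p) \<le> real n" using N1 n by simp
      then have n1: "2 * ?\<Lambda> \<le> s / 2 * (real n * real p)" using s p0 by (simp add: divide_le_eq mult_ac)
      have "4 * c / (s * real p) \<le> real n" using N2 n by simp
      then have "c \<le> real n * real p / 2 * (s / 2)" using s p0 by (simp add: divide_le_eq mult_ac)
      also have "\<dots> \<le> exp (real n * real p / 2 * (s / 2))"
        using exp_ge_add_one_self[of "real n * real p / 2 * (s / 2)"] by linarith
      finally have c_le: "c \<le> exp (real n * real p / 2 * (s / 2))" .
      have "SB n \<omega> \<le> c * (exp (- (real n * real p / 2) * (\<delta> - s / 2)) * (1 + real n) powr \<kappa>)"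
        unfolding SB_def
      proof (rule weights_le)
        show "marg_lik (real n) p n E (x \<omega>) / marg_lik (real n) p n Gs (x \<omega>)
            \<le> exp (- (real n * real p / 2) * (\<delta> - s / 2)) * (1 + real n) powr \<kappa>" if "E \<in> Bad" for E
          unfolding \<kappa>_def using \<eta>(3) n1 gap[OF that] that
          by (intro D.marg_ratio_general) (auto simp: Bad_def)
      qed (auto simp: Bad_def)
      also have "\<dots> \<le> exp (real n * real p / 2 * (s / 2)) * (exp (- (real n * real p / 2) * (\<delta> - s / 2)) * (1 + real n) powr \<kappa>)"
        by (intro mult_right_mono c_le) simp
      also have "\<dots> = exp (- (real n * real p / 2) * (\<delta> - s)) * (1 + real n) powr \<kappa>"
      proof -
        have "real n * real p / 2 * (s / 2) + - (real n * real p / 2) * (\<delta> - s / 2) = - (real n * real p / 2) * (\<delta> - s)"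
          by (simp add: field_simps)
        then show ?thesis by (simp only: mult.assoc[symmetric] exp_add[symmetric])
      qed
      finally show "SB n \<omega> \<le> exp (- (real n * real p / 2) * (\<delta> - s)) * (1 + real n) powr \<kappa>" .
    qed
  qed
  obtain A where A: "bounded_in_prob M A" "\<And>n \<omega>. n \<ge> 1 \<Longrightarrow> SG n \<omega> \<le> exp (A n \<omega>) / sqrt (real n)"
    using exp_bounded_in_prob_rate[OF SG_nonneg SG_rate] by blast
  obtain B where B: "tendsto_zero_in_prob M B"
    "\<And>n \<omega>. n \<ge> 1 \<Longrightarrow> SB n \<omega> \<le> exp (- (real n * real p / 2) * (\<delta> + B n \<omega>)) * (1 + real n) powr \<kappa>"
    using exp_small_in_prob_rate[OF SB_nonneg p0 SB_rate] by blast
  define T2 where "T2 B n \<omega> = (if Bad = {} then 0 else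
      exp (- (real n * real p / 2) * (\<delta> + B n \<omega>)) * (1 + real n) powr \<kappa>)" for B :: "nat \<Rightarrow> 'a \<Rightarrow> real" and n \<omega>
  \<comment> \<open>Without bad graphs \<open>SB\<close> is an empty sum, in accordance with the
    value 0 of \<open>T2\<close>; \<open>\<delta>\<close> would then involve the minimum of an empty
    set.\<close>
  have SB_le: "SB n \<omega> \<le> T2 B n \<omega>" if "n \<ge> 1" for n \<omega>
    using B(2)[OF that, of \<omega>] by (auto simp: T2_def SB_def)
  have main: "wpa1 M (\<lambda>n \<omega>. 1 - post n \<omega> \<le> exp (A n \<omega>) / sqrt (real n) + T2 B n \<omega>)"
    by (rule wpa1_mono[OF post_bound, where m = 1]) (use A(2) SB_le in \<open>meson add_mono order_trans\<close>)
  have complete: "wpa1 M (\<lambda>n \<omega>. 1 - post n \<omega> \<le> T2 B n \<omega>)" if "complete_DAG p Gs"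
  proof (rule wpa1_mono[OF post_bound, where m = 1])
    have "Supersets = {}" using complete_DAG_maximal[OF that] by (auto simp: Supersets_def)
    then have "SG n \<omega> = 0" for n \<omega> by (simp add: SG_def)
    then show "1 - post n \<omega> \<le> T2 B n \<omega>" if "n \<ge> 1" "post n \<omega> \<le> 1 \<and> 1 - post n \<omega> \<le> SG n \<omega> + SB n \<omega>" for n \<omega>
      using SB_le[OF that(1), of \<omega>] that(2) by simp
  qed
  have SG_small: "wpa1 M (\<lambda>n \<omega>. SG n \<omega> \<le> s)" if s: "s > 0" for s
    unfolding wpa1_def
  proof (intro allI impI)
    fix d :: real assume "d > 0"
    from SG_rate[OF this] obtain K N where N: "\<And>n. n \<ge> N \<Longrightarrow> \<exists>S\<in>events. prob S \<ge> 1 - d \<and> (\<forall>\<omega>\<in>S. SG n \<omega> \<le> K / sqrt (real n))" by blast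
    have "(\<lambda>n. K / sqrt (real n)) \<longlonglongrightarrow> 0" by real_asymp
    then have "\<forall>\<^sub>F n in sequentially. K / sqrt (real n) < s" using s by (rule order_tendstoD)
    then obtain N' where N': "\<And>n. n \<ge> N' \<Longrightarrow> K / sqrt (real n) < s" unfolding eventually_sequentially by blast
    show "\<exists>N. \<forall>n\<ge>N. \<exists>S\<in>events. prob S \<ge> 1 - d \<and> (\<forall>\<omega>\<in>S. SG n \<omega> \<le> s)"
    proof (intro exI[of _ "max N N'"] allI impI)
      fix n assume "n \<ge> max N N'"
      then show "\<exists>S\<in>events. prob S \<ge> 1 - d \<and> (\<forall>\<omega>\<in>S. SG n \<omega> \<le> s)"
        using N[of n] N'[of n] by (meson less_imp_le max.bounded_iff order_trans)
    qed
  qed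
  have SB_small: "wpa1 M (\<lambda>n \<omega>. SB n \<omega> \<le> s)" if s: "s > 0" for s
  proof (cases "Bad = {}")
    case True
    show ?thesis
      by (rule wpa1_mono[OF post_bound]) (use True s in \<open>simp add: SB_def\<close>)
  next
    case False
    \<comment> \<open>\<open>SB_rate\<close> with slack \<open>\<delta> / 2\<close> leaves half of
      the exponent, that is \<open>n * p / 2\<close> times \<open>\<delta> / 2\<close>; this still
      beats the polynomial factor.\<close>
    define r where "r = real p * \<delta> / 4"
    have r: "r > 0" using \<delta>_pos[OF False] p0 by (simp add: r_def)
    have "\<forall>\<^sub>F n in sequentially. exp (- r * real n) * (1 + real n) powr \<kappa> < s"
      using exp_powr_tendsto_0[OF r] s by (rule order_tendstoD)
    then obtain N' where N': "\<And>n. n \<ge> N' \<Longrightarrow> exp (- r * real n) * (1 + real n) powr \<kappa> < s"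
      unfolding eventually_sequentially by blast
    have "\<delta> / 2 > 0" using \<delta>_pos[OF False] by simp
    show ?thesis
    proof (rule wpa1_mono[OF SB_rate[OF \<open>\<delta> / 2 > 0\<close>], where m = N'])
      fix n \<omega> assume n: "n \<ge> N'" and le: "SB n \<omega> \<le> exp (- (real n * real p / 2) * (\<delta> - \<delta> / 2)) * (1 + real n) powr \<kappa>"
      have "- (real n * real p / 2) * (\<delta> - \<delta> / 2) = - r * real n" by (simp add: r_def)
      from le[unfolded this] N'[OF n] show "SB n \<omega> \<le> s" by (rule order_trans[OF _ less_imp_le])
    qed
  qed
  have consistent: "tendsto_zero_in_prob M (\<lambda>n \<omega>. post n \<omega> - 1)"
    unfolding tendsto_zero_in_prob_iff_wpa1
  proof (intro allI impI)
    fix s :: real assume "s > 0"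
    then have "s / 2 > 0" by simp
    from wpa1_conj[OF post_bound wpa1_conj[OF SG_small[OF this] SB_small[OF this]]]
    show "wpa1 M (\<lambda>n \<omega>. \<bar>post n \<omega> - 1\<bar> \<le> s)" by (rule wpa1_mono[where m = 0]) auto
  qed
  show ?thesis
    unfolding Let_def post_def[symmetric] Bad_def[symmetric] \<delta>_def[symmetric] \<kappa>_def[symmetric]
    using \<delta>_pos A(1) B(1) main complete consistent unfolding T2_def by blast
qed

end
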